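(* Suppose $\rho<1$. Consider the sequence of systems, indexed by $r$, under the LQFS-LB rule, with input rates $\lambda_i^r=r\lambda_i$ and pool sizes $r\beta_j$, and denote by $\mu^r$ the stationary distribution of the process $\hat\Psi^r_{\mathcal E}(\cdot)=(\hat\Psi^r_{ij}(\cdot))_{(ij)\in\mathcal E}$, a probability measure on $\mathbb R^{I+J-1}$. Let $b_K=\{|z|\le K\}\subset\mathbb R^{I+J-1}$. Suppose the matrix $A_u$ has eigenvalues with positive real parts and no pure imaginary eigenvalues. Then for any $K$, $\mu^r(b_K)\to0$ as $r\to\infty$.
   Context: Model. Customer types $i\in\mathcal I$, $|\mathcal I|=I$; server pools $j\in\mathcal J$, $|\mathcal J|=J$ (finite). Parameters: $\lambda_i>0$, $\beta_j>0$, $\mu_{ij}\ge 0$ ($\mu_{ij}=0$ means pool $j$ cannot serve type $i$). Static planning problem (SPP): minimize $\rho$ over $(\lambda_{ij}),\rho$ subject to $\lambda_{ij}\ge0$, $\sum_j\lambda_{ij}=\lambda_i$ for all $i$, and $\sum_i\lambda_{ij}/(\beta_j\mu_{ij})\le\rho$ for all $j$. Standing assumption (complete resource pooling): the SPP has a unique optimal solution $(\lambda_{ij}),\rho$, and the set of basic activities $\mathcal E=\{(ij):\lambda_{ij}>0\}$ is the edge set of a (connected) tree on the vertex set $\mathcal I\cup\mathcal J$ (so $|\mathcal E|=I+J-1$). Type $i$ service in pool $j$ is allowed only if $(ij)\in\mathcal E$. $\mathcal S(i)=\{j:(ij)\in\mathcal E\}$, $\mathcal C(j)=\{i:(ij)\in\mathcal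 E\}$. $\psi_{ij}^*=\lambda_{ij}/\mu_{ij}$ for $(ij)\in\mathcal E$. Stochastic system with parameter $r$. Type $i$ customers arrive as independent Poisson processes of rates $\lambda_i^r=r\lambda_i$; pool $j$ has $r\beta_j$ servers; service of a type $i$ customer in pool $j$ is exponential of rate $\mu_{ij}$ (not depending on $r$); no abandonment; one queue per type. $\Psi_{ij}^r(t)$ = number of pool $j$ servers serving type $i$ at time $t$; $\Psi_j^r=\sum_i\Psi_{ij}^r$; $\Xi_j^r=\Psi_j^r/\beta_j$; $Q_i^r$ = number of type $i$ customers in queue. LQFS-LB rule. Routing: an arriving type $i$ customer seeing idle servers in pools of $\mathcal S(i)$ immediately enters service in a pool $j\in\arg\min_{j\in\mathcal S(i)}\Xi_j^r$; otherwise it joins queue $i$. Scheduling: a pool $j$ server completing a service takes a customer from the longest queue $Q_i^r$ among $i\in\mathcal C(j)$, if any of these is nonempty, and otherwise idles. Ties are broken in an arbitrary Markovian manner. Diffusion scaling: $\hat\Psi_{ij}^r(t)=(\Psi_{ij}^r(t)-r\psi_{ij}^* )/\sqrt r$. Matrix $A_u$. For $y\in\mathbb R^I$ let $z=My\in\mathbb R^{\mathcal E}$ be the unique solution of $\sum_{i\in\mathcal C(j)}z_{ij}=\eta\beta_j$ for all $j$ and $\sum_{j\in\mathcal S(i)}z_{ij}=y_i$ for all $i$, where $\eta=\sum_iy_i/\sum_j\beta_j$. $A_u$ is the $I\times I$ matrix of the linear map $y\mapsto\big(-\sum_{j\in\mathcal S(i)}\mu_{ij}(My)_{ij}\big)_{i}$.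 *)

theory Defs
  imports "HOL-Probability.Probability"
begin

text \<open>
  Customer types are the elements of a finite type \<open>'i\<close>, server pools those of a finite
  type \<open>'j\<close>; an activity is a pair \<open>(i, j)\<close>.  Vectors in \<open>\<real>\<^sup>E\<close>, for a set \<open>E\<close> of activities, are
  functions on pairs that are \<open>undefined\<close> outside \<open>E\<close> (elements of \<^term>\<open>PiE E (\<lambda>_. UNIV)\<close>).
\<close>

subsection \<open>Static planning problem and complete resource pooling\<close>

text \<open>
  The load \<open>l i j / (\<beta> j * \<mu> i j)\<close> of an activity with \<open>\<mu> i j = 0\<close> is infinite
  unless \<open>l i j = 0\<close>, whereas division by zero yields \<open>0\<close> in HOL; hence the explicit clause
  excluding flow along such activities.
\<close>

definition spp_feasible ::
  "('i::finite \<Rightarrow> real) \<Rightarrow> ('j::finite \<Rightarrow> real) \<Rightarrow> ('i \<Rightarrow> 'j \<Rightarrow> real) \<Rightarrow> ('i \<Rightarrow> 'j \<Rightarrow> real) \<Rightarrow> real \<Rightarrow> bool"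
where
  "spp_feasible \<Lambda> \<beta> \<mu> l \<rho> \<longleftrightarrow>
     (\<forall>i j. 0 \<le> l i j) \<and>
     (\<forall>i j. \<mu> i j = 0 \<longrightarrow> l i j = 0) \<and>
     (\<forall>i. (\<Sum>j\<in>UNIV. l i j) = \<Lambda> i) \<and>
     (\<forall>j. (\<Sum>i\<in>UNIV. l i j / (\<beta> j * \<mu> i j)) \<le> \<rho>)"

definition spp_optimal ::
  "('i::finite \<Rightarrow> real) \<Rightarrow> ('j::finite \<Rightarrow> real) \<Rightarrow> ('i \<Rightarrow> 'j \<Rightarrow> real) \<Rightarrow> ('i \<Rightarrow> 'j \<Rightarrow> real) \<Rightarrow> real \<Rightarrow> bool"
where
  "spp_optimal \<Lambda> \<beta> \<mu> l \<rho> \<longleftrightarrow>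
     spp_feasible \<Lambda> \<beta> \<mu> l \<rho> \<and> (\<forall>l' \<rho>'. spp_feasible \<Lambda> \<beta> \<mu> l' \<rho>' \<longrightarrow> \<rho> \<le> \<rho>')"

definition basic_activities :: "('i \<Rightarrow> 'j \<Rightarrow> real) \<Rightarrow> ('i \<times> 'j) set" where
  "basic_activities l = {(i, j). 0 < l i j}"

text \<open>
  The undirected bipartite graph on the vertex set \<open>'i + 'j\<close> whose edges are the activities in \<open>E\<close>.
\<close>

definition activity_adj :: "('i \<times> 'j) set \<Rightarrow> 'i + 'j \<Rightarrow> 'i + 'j \<Rightarrow> bool" where
  "activity_adj E u v \<longleftrightarrow>
     (\<exists>i j. (i, j) \<in> E \<and> (u = Inl i \<and> v = Inr j \<or> u = Inr j \<and> v = Inl i))"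

definition activity_tree :: "('i \<times> 'j) set \<Rightarrow> bool" where
  "activity_tree E \<longleftrightarrow>
     (\<forall>u v. (activity_adj E)\<^sup>*\<^sup>* u v) \<and>
     (\<nexists>vs. 3 \<le> length vs \<and> distinct vs \<and> successively (activity_adj E) vs \<and>
           activity_adj E (last vs) (hd vs))"

definition complete_resource_pooling ::
  "('i::finite \<Rightarrow> real) \<Rightarrow> ('j::finite \<Rightarrow> real) \<Rightarrow> ('i \<Rightarrow> 'j \<Rightarrow> real) \<Rightarrow> ('i \<Rightarrow> 'j \<Rightarrow> real) \<Rightarrow> real \<Rightarrow> bool"
where
  "complete_resource_pooling \<Lambda> \<beta> \<mu> l \<rho> \<longleftrightarrow>
     spp_optimal \<Lambda> \<beta> \<mu> l \<rho> \<and>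
     (\<forall>l' \<rho>'. spp_optimal \<Lambda> \<beta> \<mu> l' \<rho>' \<longrightarrow> l' = l \<and> \<rho>' = \<rho>) \<and>
     activity_tree (basic_activities l)"

definition pools :: "('i \<times> 'j) set \<Rightarrow> 'i \<Rightarrow> 'j set" where
  "pools E i = {j. (i, j) \<in> E}"

definition types :: "('i \<times> 'j) set \<Rightarrow> 'j \<Rightarrow> 'i set" where
  "types E j = {i. (i, j) \<in> E}"

subsection \<open>Continuous-time Markov chains with a given rate matrix\<close>

text \<open>
  \<open>P t x\<close> is the law at time \<open>t\<close> of the chain on \<open>X\<close> started in \<open>x\<close>, and \<open>G x y\<close> is its
  transition rate matrix (including the diagonal).
\<close>

definition markov_semigroup ::
  "'s set \<Rightarrow> ('s \<Rightarrow> 's \<Rightarrow> real) \<Rightarrow> (real \<Rightarrow> 's \<Rightarrow> 's pmf) \<Rightarrow> bool"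
where
  "markov_semigroup X G P \<longleftrightarrow>
     (\<forall>x\<in>X. P 0 x = return_pmf x) \<and>
     (\<forall>t\<ge>0. \<forall>x\<in>X. set_pmf (P t x) \<subseteq> X) \<and>
     (\<forall>s\<ge>0. \<forall>t\<ge>0. \<forall>x\<in>X. P (s + t) x = bind_pmf (P s x) (P t)) \<and>
     (\<forall>x\<in>X. \<forall>y\<in>X. ((\<lambda>t. pmf (P t x) y) has_real_derivative G x y) (at 0 within {0..}))"

definition stationary_distribution ::
  "'s set \<Rightarrow> (real \<Rightarrow> 's \<Rightarrow> 's pmf) \<Rightarrow> 's pmf \<Rightarrow> bool"
where
  "stationary_distribution X P \<pi> \<longleftrightarrow>
     set_pmf \<pi> \<subseteq> X \<and> (\<forall>t\<ge>0. bind_pmf \<pi> (P t) = \<pi>)"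

subsection \<open>The system with scaling parameter \<open>r\<close> under the LQFS-LB rule\<close>

text \<open>
  A state \<open>(\<Psi>, Q)\<close> records the number \<open>\<Psi> i j\<close> of pool \<open>j\<close> servers serving type \<open>i\<close> and
  the number \<open>Q i\<close> of type \<open>i\<close> customers in queue.
\<close>

type_synonym ('i, 'j) state = "('i \<Rightarrow> 'j \<Rightarrow> nat) \<times> ('i \<Rightarrow> nat)"

definition busy :: "('i::finite \<Rightarrow> 'j \<Rightarrow> nat) \<Rightarrow> 'j \<Rightarrow> nat" where
  "busy \<Psi> j = (\<Sum>i\<in>UNIV. \<Psi> i j)"

text \<open>
  The last clause is the invariant maintained by LQFS-LB that a type has customers waiting only
  if every pool allowed to serve it is fully occupied.
\<close>

definition state_space ::
  "('j \<Rightarrow> real) \<Rightarrow> ('i::finite \<times> 'j) set \<Rightarrow> real \<Rightarrow> ('i, 'j) state set"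
where
  "state_space \<beta> E r = {(\<Psi>, Q).
     (\<forall>i j. (i, j) \<notin> E \<longrightarrow> \<Psi> i j = 0) \<and>
     (\<forall>j. real (busy \<Psi> j) \<le> r * \<beta> j) \<and>
     (\<forall>i. 0 < Q i \<longrightarrow> (\<forall>j\<in>pools E i. real (busy \<Psi> j) = r * \<beta> j))}"

definition start_service :: "'i \<Rightarrow> 'j \<Rightarrow> ('i \<Rightarrow> 'j \<Rightarrow> nat) \<Rightarrow> 'i \<Rightarrow> 'j \<Rightarrow> nat" where
  "start_service i j \<Psi> = \<Psi>(i := (\<Psi> i)(j := \<Psi> i j + 1))"

definition end_service :: "'i \<Rightarrow> 'j \<Rightarrow> ('i \<Rightarrow> 'j \<Rightarrow> nat) \<Rightarrow> 'i \<Rightarrow> 'j \<Rightarrow> nat" where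
  "end_service i j \<Psi> = \<Psi>(i := (\<Psi> i)(j := \<Psi> i j - 1))"

text \<open>
  Randomised decisions: \<open>route x i\<close> is the law of the pool chosen by a type \<open>i\<close> arrival that
  finds the system in state \<open>x\<close> with an idle server available to it; \<open>sched x i j\<close> is the law of the type
  taken next by a pool \<open>j\<close> server that completes a type \<open>i\<close> service, \<open>x\<close> being the state just
  before the completion.  LQFS-LB prescribes only their supports; within these, the choice
  (the tie-breaking) is arbitrary.
\<close>

definition lqfs_lb_rule ::
  "('j \<Rightarrow> real) \<Rightarrow> ('i::finite \<times> 'j) set \<Rightarrow> real \<Rightarrow>
   (('i, 'j) state \<Rightarrow> 'i \<Rightarrow> 'j pmf) \<Rightarrow> (('i, 'j) state \<Rightarrow> 'i \<Rightarrow> 'j \<Rightarrow> 'i pmf) \<Rightarrow> bool"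
where
  "lqfs_lb_rule \<beta> E r route sched \<longleftrightarrow>
     (\<forall>(\<Psi>, Q)\<in>state_space \<beta> E r.
        (\<forall>i. (\<exists>j\<in>pools E i. real (busy \<Psi> j) < r * \<beta> j) \<longrightarrow>
           set_pmf (route (\<Psi>, Q) i) \<subseteq>
             {j. is_arg_min (\<lambda>k. real (busy \<Psi> k) / \<beta> k) (\<lambda>k. k \<in> pools E i) j}) \<and>
        (\<forall>i j. 0 < \<Psi> i j \<and> (\<exists>k\<in>types E j. 0 < Q k) \<longrightarrow>
           set_pmf (sched (\<Psi>, Q) i j) \<subseteq> {k. is_arg_max Q (\<lambda>k. k \<in> types E j) k}))"

definition after_arrival ::
  "('j \<Rightarrow> real) \<Rightarrow> ('i::finite \<times> 'j) set \<Rightarrow> real \<Rightarrow> (('i, 'j) state \<Rightarrow> 'i \<Rightarrow> 'j pmf) \<Rightarrow>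
   'i \<Rightarrow> ('i, 'j) state \<Rightarrow> ('i, 'j) state pmf"
where
  "after_arrival \<beta> E r route i = (\<lambda>(\<Psi>, Q).
     if \<exists>j\<in>pools E i. real (busy \<Psi> j) < r * \<beta> j
     then map_pmf (\<lambda>j. (start_service i j \<Psi>, Q)) (route (\<Psi>, Q) i)
     else return_pmf (\<Psi>, Q(i := Q i + 1)))"

definition after_completion ::
  "('i \<times> 'j) set \<Rightarrow> (('i, 'j) state \<Rightarrow> 'i \<Rightarrow> 'j \<Rightarrow> 'i pmf) \<Rightarrow>
   'i \<Rightarrow> 'j \<Rightarrow> ('i, 'j) state \<Rightarrow> ('i, 'j) state pmf"
where
  "after_completion E sched i j = (\<lambda>(\<Psi>, Q).
     if \<exists>k\<in>types E j. 0 < Q k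
     then map_pmf (\<lambda>k. (start_service k j (end_service i j \<Psi>), Q(k := Q k - 1)))
            (sched (\<Psi>, Q) i j)
     else return_pmf (end_service i j \<Psi>, Q))"

text \<open>
  Every event changes the state (the total number of customers moves by one), so subtracting
  \<open>pmf (return_pmf x) y\<close> event by event puts minus the total event rate on the diagonal.
\<close>

definition lqfs_lb_rates ::
  "('i::finite \<Rightarrow> real) \<Rightarrow> ('j::finite \<Rightarrow> real) \<Rightarrow> ('i \<Rightarrow> 'j \<Rightarrow> real) \<Rightarrow> ('i \<times> 'j) set \<Rightarrow> real \<Rightarrow>
   (('i, 'j) state \<Rightarrow> 'i \<Rightarrow> 'j pmf) \<Rightarrow> (('i, 'j) state \<Rightarrow> 'i \<Rightarrow> 'j \<Rightarrow> 'i pmf) \<Rightarrow>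
   ('i, 'j) state \<Rightarrow> ('i, 'j) state \<Rightarrow> real"
where
  "lqfs_lb_rates \<Lambda> \<beta> \<mu> E r route sched x y =
     (\<Sum>i\<in>UNIV. r * \<Lambda> i * (pmf (after_arrival \<beta> E r route i x) y - pmf (return_pmf x) y)) +
     (\<Sum>i\<in>UNIV. \<Sum>j\<in>UNIV. \<mu> i j * real (fst x i j) *
        (pmf (after_completion E sched i j x) y - pmf (return_pmf x) y))"

subsection \<open>Diffusion scaling\<close>

definition diffusion_scaling ::
  "('i \<Rightarrow> 'j \<Rightarrow> real) \<Rightarrow> ('i \<Rightarrow> 'j \<Rightarrow> real) \<Rightarrow> real \<Rightarrow> ('i, 'j) state \<Rightarrow> 'i \<times> 'j \<Rightarrow> real"
where
  "diffusion_scaling \<mu> l r x =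
     (\<lambda>(i, j)\<in>basic_activities l. (real (fst x i j) - r * (l i j / \<mu> i j)) / sqrt r)"

text \<open>
  The image on \<open>\<real>\<^sup>E\<close> of a law \<open>\<pi>\<close> of the state under the diffusion scaling.
\<close>

definition scaled_distribution ::
  "('i \<Rightarrow> 'j \<Rightarrow> real) \<Rightarrow> ('i \<Rightarrow> 'j \<Rightarrow> real) \<Rightarrow> real \<Rightarrow> ('i, 'j) state pmf \<Rightarrow> ('i \<times> 'j \<Rightarrow> real) measure"
where
  "scaled_distribution \<mu> l r \<pi> =
     distr (measure_pmf \<pi>) (Pi\<^sub>M (basic_activities l) (\<lambda>_. borel)) (diffusion_scaling \<mu> l r)"

definition euclidean_cball :: "'e set \<Rightarrow> real \<Rightarrow> ('e \<Rightarrow> real) set" where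
  "euclidean_cball E K = {z \<in> PiE E (\<lambda>_. UNIV). L2_set z E \<le> K}"

subsection \<open>The matrix \<open>A\<^sub>u\<close> and its eigenvalues\<close>

definition balanced_allocation ::
  "('j::finite \<Rightarrow> real) \<Rightarrow> ('i::finite \<times> 'j) set \<Rightarrow> real^'i \<Rightarrow> ('i \<times> 'j \<Rightarrow> real)"
where
  "balanced_allocation \<beta> E y = (THE z. z \<in> PiE E (\<lambda>_. UNIV) \<and>
     (\<forall>j. (\<Sum>i\<in>types E j. z (i, j)) = (\<Sum>i\<in>UNIV. y $ i) / (\<Sum>k\<in>UNIV. \<beta> k) * \<beta> j) \<and>
     (\<forall>i. (\<Sum>j\<in>pools E i. z (i, j)) = y $ i))"

definition A_u ::
  "('j::finite \<Rightarrow> real) \<Rightarrow> ('i::finite \<Rightarrow> 'j \<Rightarrow> real) \<Rightarrow> ('i \<times> 'j) set \<Rightarrow> real^'i^'i"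
where
  "A_u \<beta> \<mu> E =
     matrix (\<lambda>y. \<chi> i. - (\<Sum>j\<in>pools E i. \<mu> i j * balanced_allocation \<beta> E y (i, j)))"

definition eigenvalue :: "real^'n^'n \<Rightarrow> complex \<Rightarrow> bool" where
  "eigenvalue A c \<longleftrightarrow> (\<exists>v. v \<noteq> 0 \<and> map_matrix complex_of_real A *v v = c *s v)"

end

theory Submission
  imports Defs
begin

text \<open>
  Put everything in diffusion scaling: \<open>X\<close> is the vector of numbers in service by type, \<open>imbalance\<close> the
  deviation of the pool loads from their mean, and \<open>Z\<close> the coordinate of \<open>X\<close> along a left eigenvector of
  \<open>A\<^sub>u\<close> whose eigenvalue has positive real part.  Consider
  \<open>W = \<epsilon> * V + \<epsilon> * ln (1 + |X|\<^sup>2) + 1/2 * 1 / (1 + \<theta> * |Z|\<^sup>2)\<close>, where \<open>V\<close> is the weighted square norm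
  of the imbalance.  On \<open>{W < 1}\<close> no pool is full once \<open>r\<close> is large, and there the rule pushes the
  imbalance down at speed of order \<open>sqrt r\<close>, which absorbs all error terms linear in the imbalance.
  The logarithm has bounded drift because the drift of \<open>X\<close> is linear, and the last term decreases because
  \<open>|Z|\<^sup>2\<close> grows exponentially and is fed by nondegenerate noise.  Hence the drift of \<open>W\<close> is at most
  \<open>C * \<epsilon> - \<sigma> / (1 + \<theta> * |Z|\<^sup>2)\<^sup>2\<close>.  The function \<open>max 0 (1 - W)\<close> has finite support and its drift on
  \<open>{W < 1}\<close> is at least minus that of \<open>W\<close>, while its mean drift under a stationary law is at most \<open>0\<close>.
  So a fixed ball has stationary mass \<open>O(\<epsilon>)\<close>.
\<close>

subsection \<open>Stationary laws and trees\<close>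

text \<open>No moment bound on the stationary law is at hand, so the test function must live on
  finitely many states; hence the cut at level 1. For the cut to give a bounded set,
  \<open>W\<close> must confine \<open>X\<close>, although \<open>X\<close> is itself unstable: the
  square norm would have a drift of its own size, while the logarithm pays only a bounded drift,
  made small by the weight \<open>\<epsilon>\<close>. At \<open>Z = 0\<close> the unstable drift
  vanishes and the strictly negative drift of the last term comes from the noise alone. The order of
  choices matters: first the target ball, then \<open>\<epsilon>\<close> so small that the ball lies
  in \<open>{W < 1}\<close>, then \<open>r\<close>. The bound on the size of \<open>{W < 1}\<close>
  is exponential in \<open>1 / \<epsilon>\<close>, but only the threshold for \<open>r\<close>
  depends on it; \<open>C\<close> and \<open>\<sigma>\<close> do not. That all pools keep room of
  order \<open>r\<close> against fluctuations of order \<open>sqrt r\<close> rests on the planning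
  problem: uniqueness of its optimum, carried along the tree, forces every pool to the same load
  \<open>\<rho>\<close>. Equal loads also turn the choice of the least busy pool into the choice of
  the smallest imbalance.\<close>

lemma right_derivative_nonpos:
  fixes \<phi> :: "real \<Rightarrow> real"
  assumes "(\<phi> has_real_derivative D) (at 0 within {0..})" and "\<And>t. 0 \<le> t \<Longrightarrow> \<phi> t \<le> \<phi> 0"
  shows "D \<le> 0"
proof -
  have lim: "((\<lambda>y. (\<phi> y - \<phi> 0) / (y - 0)) \<longlongrightarrow> D) (at 0 within {0..})"
    using assms(1) by (simp add: has_field_derivative_iff)
  have ev: "\<forall>\<^sub>F y in at 0 within {0..}. (\<phi> y - \<phi> 0) / (y - 0) \<le> 0"
    unfolding eventually_at_filter
    using assms(2) by (auto intro!: always_eventually divide_nonpos_nonneg)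
  have "at (0::real) within {0..} \<noteq> bot"
    by (simp add: at_within_Ici_at_right)
  then show ?thesis
    using tendsto_upperbound[OF lim ev] by simp
qed

text \<open>The sum is the right derivative at 0 of the mean of \<open>f\<close>, cut to
  \<open>S\<close>, at time \<open>t\<close> over stationary starts in \<open>S\<close>.
  Stationarity and \<open>f\<close> being nonnegative bound this mean by its value at time
  0.\<close>

lemma stationary_generator_nonpos:
  assumes P: "markov_semigroup X G P" and st: "stationary_distribution X P \<pi>"
    and S: "finite S" "S \<subseteq> X" and f: "\<And>y. y \<in> S \<Longrightarrow> 0 \<le> f y"
  shows "(\<Sum>x\<in>S. pmf \<pi> x * (\<Sum>y\<in>S. f y * G x y)) \<le> 0"
proof (rule right_derivative_nonpos)
  let ?\<phi> = "\<lambda>t. \<Sum>x\<in>S. pmf \<pi> x * (\<Sum>y\<in>S. f y * pmf (P t x) y)"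
  have deriv: "((\<lambda>t. pmf (P t x) y) has_real_derivative G x y) (at 0 within {0..})"
    if "x \<in> S" "y \<in> S" for x y
    using P S that unfolding markov_semigroup_def by blast
  show "(?\<phi> has_real_derivative (\<Sum>x\<in>S. pmf \<pi> x * (\<Sum>y\<in>S. f y * G x y))) (at 0 within {0..})"
    using deriv by (intro DERIV_sum DERIV_cmult)
  fix t :: real assume t: "0 \<le> t"
  have P0: "P 0 x = return_pmf x" if "x \<in> S" for x
    using P S that unfolding markov_semigroup_def by blast
  have \<phi>0: "?\<phi> 0 = (\<Sum>y\<in>S. f y * pmf \<pi> y)"
  proof (rule sum.cong[OF refl])
    fix x assume x: "x \<in> S"
    have "(\<Sum>y\<in>S. f y * pmf (P 0 x) y) = (\<Sum>y\<in>S. if y = x then f y else 0)"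
      using P0[OF x] by (intro sum.cong) (auto simp: pmf_return)
    also have "\<dots> = f x" using S x by simp
    finally show "pmf \<pi> x * (\<Sum>y\<in>S. f y * pmf (P 0 x) y) = f x * pmf \<pi> x" by simp
  qed
  have inv: "pmf \<pi> y = measure_pmf.expectation \<pi> (\<lambda>x. pmf (P t x) y)" for y
  proof -
    have "bind_pmf \<pi> (P t) = \<pi>" using st t by (simp add: stationary_distribution_def)
    then show ?thesis by (metis pmf_bind)
  qed
  have int: "integrable \<pi> (\<lambda>x. f y * pmf (P t x) y)" for y
    by (rule measure_pmf.integrable_const_bound[where B="\<bar>f y\<bar>"])
       (auto simp: abs_mult pmf_le_1 intro!: mult_left_le)
  have "?\<phi> t = measure_pmf.expectation \<pi> (\<lambda>x. indicator S x * (\<Sum>y\<in>S. f y * pmf (P t x) y))"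
    by (subst integral_measure_pmf_real[where A=S])
       (use S in \<open>auto simp: indicator_def mult.commute intro!: sum.cong split: if_splits\<close>)
  \<comment> \<open>Dropping the mass outside \<open>S\<close> leaves finite sums only, so no domination is needed as \<open>t\<close> tends to \<open>0\<close>.\<close>
  also have "\<dots> \<le> measure_pmf.expectation \<pi> (\<lambda>x. \<Sum>y\<in>S. f y * pmf (P t x) y)"
  proof (rule integral_mono)
    show "integrable \<pi> (\<lambda>x. indicator S x * (\<Sum>y\<in>S. f y * pmf (P t x) y))"
      using integrable_mult_indicator[of S "measure_pmf \<pi>" "\<lambda>x. \<Sum>y\<in>S. f y * pmf (P t x) y"] int by simp
  qed (use f int in \<open>auto simp: indicator_def intro!: sum_nonneg\<close>)
  also have "\<dots> = (\<Sum>y\<in>S. f y * pmf \<pi> y)"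
    using int by (simp add: Bochner_Integration.integral_sum inv[symmetric])
  finally show "?\<phi> t \<le> ?\<phi> 0" using \<phi>0 by simp
qed

section \<open>Cycles and flows in the activity tree\<close>

text \<open>Take a longest simple path. Its first vertex has a neighbour other than the second
  vertex, and by maximality this neighbour lies on the path, which closes a cycle. Assumption
  \<open>ext\<close> says that no vertex is a leaf.\<close>

lemma exists_cycle:
  fixes R :: "'v::finite \<Rightarrow> 'v \<Rightarrow> bool"
  assumes irr: "\<And>u. \<not> R u u" and sym: "\<And>u v. R u v \<Longrightarrow> R v u" and "R a b"
    and ext: "\<And>u v. R u v \<Longrightarrow> \<exists>w. w \<noteq> v \<and> R u w"
  shows "\<exists>vs. 3 \<le> length vs \<and> distinct vs \<and> successively R vs \<and> R (last vs) (hd vs)"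
proof -
  let ?Q = "\<lambda>vs. 2 \<le> length vs \<and> distinct vs \<and> successively R vs"
  have "?Q [a, b]" using \<open>R a b\<close> irr by auto
  moreover have "\<forall>vs. ?Q vs \<longrightarrow> length vs < Suc CARD('v)"
    by (metis card_mono less_Suc_eq_le distinct_card finite subset_UNIV)
  ultimately obtain vs where Q: "?Q vs" and mx: "\<And>ws. ?Q ws \<Longrightarrow> length ws \<le> length vs"
    using ex_has_greatest_nat[of ?Q "[a, b]" length "Suc CARD('v)"] by (metis (no_types, lifting))
  obtain c d rest where vs: "vs = c # d # rest"
    using Q by (metis One_nat_def Suc_1 Suc_le_length_iff)
  have "R c d" using Q vs by simp
  then obtain w where w: "w \<noteq> d" "R c w" using ext by blast
  have "w \<in> set vs"
  proof (rule ccontr)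
    assume "w \<notin> set vs"
    then have "?Q (w # vs)" using Q vs sym[OF w(2)] by auto
    from mx[OF this] show False by simp
  qed
  then obtain k where k: "k < length vs" "vs ! k = w" by (auto simp: in_set_conv_nth)
  \<comment> \<open>Index 0 would be a loop at \<open>c\<close>, and index 1 is \<open>d\<close>,
    which \<open>w\<close> avoids; so the cycle has at least three vertices.\<close>
  have "2 \<le> k"
    using k w irr vs by (cases k; cases "k - 1") auto
  let ?ws = "take (Suc k) vs"
  have "successively R ?ws"
    using Q by (metis append_take_drop_id successively_append_iff)
  moreover have "last ?ws = w" using k by (simp add: take_Suc_conv_app_nth)
  moreover have "hd ?ws = c" using vs by simp
  ultimately show ?thesis
    using Q k \<open>2 \<le> k\<close> sym[OF w(2)] by (intro exI[of _ ?ws]) auto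
qed

lemma activity_adj_sym: "activity_adj E u v \<Longrightarrow> activity_adj E v u"
  unfolding activity_adj_def by blast

lemma activity_adj_irrefl: "\<not> activity_adj E u u"
  unfolding activity_adj_def by blast

lemma sum_zero_other_nonzero:
  fixes g :: "'a::finite \<Rightarrow> real"
  assumes "sum g UNIV = 0" "g a \<noteq> 0"
  shows "\<exists>b. b \<noteq> a \<and> g b \<noteq> 0"
proof (rule ccontr)
  assume "\<not> ?thesis"
  then have "sum g (UNIV - {a}) = 0" by (intro sum.neutral) auto
  then show False using assms by (simp add: sum.remove[of UNIV a])
qed

text \<open>With zero row and column sums no vertex meets exactly one nonzero entry, so the support
  of a nonzero \<open>z\<close> would be a leafless subgraph and contain a cycle.\<close>

lemma tree_allocation_zero:
  fixes z :: "'i::finite \<Rightarrow> 'j::finite \<Rightarrow> real"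
  assumes tree: "activity_tree E" and supp: "\<And>i j. (i, j) \<notin> E \<Longrightarrow> z i j = 0"
    and row: "\<And>i. (\<Sum>j\<in>UNIV. z i j) = 0" and col: "\<And>j. (\<Sum>i\<in>UNIV. z i j) = 0"
  shows "z i j = 0"
proof (rule ccontr)
  assume nz: "z i j \<noteq> 0"
  let ?R = "activity_adj {(i, j). z i j \<noteq> 0}"
  have "\<exists>vs. 3 \<le> length vs \<and> distinct vs \<and> successively ?R vs \<and> ?R (last vs) (hd vs)"
  proof (rule exists_cycle)
    show "?R (Inl i) (Inr j)" using nz by (auto simp: activity_adj_def)
    fix u v assume "?R u v"
    then obtain i j where "z i j \<noteq> 0" "u = Inl i \<and> v = Inr j \<or> u = Inr j \<and> v = Inl i"
      by (auto simp: activity_adj_def)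
    then show "\<exists>w. w \<noteq> v \<and> ?R u w"
      using sum_zero_other_nonzero[of "z i" j] sum_zero_other_nonzero[of "\<lambda>i. z i j" i] row col
      by (fastforce simp: activity_adj_def)
  qed (use activity_adj_sym activity_adj_irrefl in blast)+
  moreover have "activity_adj E u v" if "?R u v" for u v
    using that supp unfolding activity_adj_def by blast
  ultimately show False
    using tree unfolding activity_tree_def by (meson successively_mono)
qed

text \<open>One unit is sent along a path from \<open>u\<close> to \<open>v\<close>. An edge used
  from type to pool counts 1 and the other way -1, which is why row and column sums carry opposite
  signs.\<close>

lemma path_unit_flow:
  fixes E :: "('i::finite \<times> 'j::finite) set"
  assumes "(activity_adj E)\<^sup>*\<^sup>* u v"
  shows "\<exists>n :: 'i \<Rightarrow> 'j \<Rightarrow> real. (\<forall>i j. (i, j) \<notin> E \<longrightarrow> n i j = 0) \<and>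
    (\<forall>i. (\<Sum>j\<in>UNIV. n i j) = of_bool (u = Inl i) - of_bool (v = Inl i)) \<and>
    (\<forall>j. (\<Sum>i\<in>UNIV. n i j) = of_bool (v = Inr j) - of_bool (u = Inr j))"
  using assms
proof (induction rule: rtranclp_induct)
  case base
  show ?case by (intro exI[of _ "\<lambda>_ _. 0"]) simp
next
  case (step v w)
  then obtain n :: "'i \<Rightarrow> 'j \<Rightarrow> real" where n: "\<And>i j. (i, j) \<notin> E \<Longrightarrow> n i j = 0"
    "\<And>i. (\<Sum>j\<in>UNIV. n i j) = of_bool (u = Inl i) - of_bool (v = Inl i)"
    "\<And>j. (\<Sum>i\<in>UNIV. n i j) = of_bool (v = Inr j) - of_bool (u = Inr j)"
    by metis
  from step(2) obtain a b where ab: "(a, b) \<in> E"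
    "v = Inl a \<and> w = Inr b \<or> v = Inr b \<and> w = Inl a"
    by (auto simp: activity_adj_def)
  define s :: real where "s = (if v = Inl a then 1 else -1)"
  define m where "m = (\<lambda>i j. n i j + (if i = a then if j = b then s else 0 else 0))"
  have "(\<Sum>j\<in>UNIV. m i j) = (\<Sum>j\<in>UNIV. n i j) + (if i = a then s else 0)" for i
    by (simp add: m_def sum.distrib)
  moreover have "(\<Sum>i\<in>UNIV. m i j) = (\<Sum>i\<in>UNIV. n i j) + (if j = b then s else 0)" for j
    by (simp add: m_def sum.distrib)
  ultimately show ?case
    using ab by (intro exI[of _ m]) (auto simp: m_def n s_def)
qed

text \<open>Every vertex sends its unit flow to a common root; superposing these flows realises any
  prescribed row sums \<open>a\<close> and column sums \<open>b\<close> of equal total.\<close>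

lemma tree_flow:
  fixes E :: "('i::finite \<times> 'j::finite) set"
  assumes tree: "activity_tree E"
  obtains n :: "'i + 'j \<Rightarrow> 'i \<Rightarrow> 'j \<Rightarrow> real" where
    "\<And>v i j. (i, j) \<notin> E \<Longrightarrow> n v i j = 0"
    "\<And>a b i. sum a UNIV = sum b UNIV \<Longrightarrow>
       (\<Sum>j\<in>UNIV. (\<Sum>k\<in>UNIV. a k * n (Inl k) i j) - (\<Sum>k\<in>UNIV. b k * n (Inr k) i j)) = a i"
    "\<And>a b j. sum a UNIV = sum b UNIV \<Longrightarrow>
       (\<Sum>i\<in>UNIV. (\<Sum>k\<in>UNIV. a k * n (Inl k) i j) - (\<Sum>k\<in>UNIV. b k * n (Inr k) i j)) = b j"
proof -
  \<comment> \<open>With a type as root the column sums do not see the root, and the row sums see it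
    with weight \<open>sum a UNIV - sum b UNIV\<close>, which is 0.\<close>
  define root :: "'i + 'j" where "root = Inl undefined"
  have "\<forall>u. \<exists>n :: 'i \<Rightarrow> 'j \<Rightarrow> real. (\<forall>i j. (i, j) \<notin> E \<longrightarrow> n i j = 0) \<and>
    (\<forall>i. (\<Sum>j\<in>UNIV. n i j) = of_bool (u = Inl i) - of_bool (root = Inl i)) \<and>
    (\<forall>j. (\<Sum>i\<in>UNIV. n i j) = of_bool (root = Inr j) - of_bool (u = Inr j))"
    using tree path_unit_flow unfolding activity_tree_def by blast
  then obtain n :: "'i + 'j \<Rightarrow> 'i \<Rightarrow> 'j \<Rightarrow> real" where n: "\<And>u i j. (i, j) \<notin> E \<Longrightarrow> n u i j = 0"
    "\<And>u i. (\<Sum>j\<in>UNIV. n u i j) = of_bool (u = Inl i) - of_bool (root = Inl i)"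
    "\<And>u j. (\<Sum>i\<in>UNIV. n u i j) = of_bool (root = Inr j) - of_bool (u = Inr j)"
    by metis
  have swap: "(\<Sum>j\<in>J. \<Sum>k\<in>UNIV. c k * f j k) = (\<Sum>k\<in>UNIV. c k * (\<Sum>j\<in>J. f j k))"
    for c :: "'k::finite \<Rightarrow> real" and f :: "'l \<Rightarrow> 'k \<Rightarrow> real" and J
    by (subst sum.swap) (simp add: sum_distrib_left)
  have delta: "(\<Sum>k\<in>UNIV. c k * (of_bool (k = k0) - d)) = c k0 - sum c UNIV * d"
    for c :: "'k::finite \<Rightarrow> real" and k0 d
  proof -
    have "(\<Sum>k\<in>UNIV. c k * (of_bool (k = k0) - d)) = (\<Sum>k\<in>UNIV. (if k = k0 then c k else 0) - c k * d)"
      by (intro sum.cong) (auto simp: right_diff_distrib)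
    then show ?thesis by (simp add: sum_subtractf sum_distrib_right)
  qed
  show thesis
  proof (rule that[of n])
    fix a :: "'i \<Rightarrow> real" and b :: "'j \<Rightarrow> real"
    assume ab: "sum a UNIV = sum b UNIV"
    show "(\<Sum>j\<in>UNIV. (\<Sum>k\<in>UNIV. a k * n (Inl k) i j) - (\<Sum>k\<in>UNIV. b k * n (Inr k) i j)) = a i" for i
      using ab delta[of a i "of_bool (root = Inl i)"]
      by (simp add: sum_subtractf swap n sum_distrib_right[symmetric] sum_negf)
    have "(\<Sum>k\<in>UNIV. b k * (- of_bool (k = j))) = - b j" for j
      using delta[of b j 0] by (simp add: sum_negf)
    then show "(\<Sum>i\<in>UNIV. (\<Sum>k\<in>UNIV. a k * n (Inl k) i j) - (\<Sum>k\<in>UNIV. b k * n (Inr k) i j)) = b j" for j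
      by (simp add: root_def sum_subtractf swap n)
  qed (use n in auto)
qed

section \<open>Equal loads at the optimum of the planning problem\<close>

text \<open>An exchange argument. If a tight pool and a slack pool share a basic type, some of its
  flow can be moved to the slack pool at the same \<open>\<rho>\<close>, against uniqueness. So
  tightness spreads over the whole tree from one tight pool.\<close>

lemma spp_load_tight:
  fixes \<Lambda> :: "'i::finite \<Rightarrow> real" and \<beta> :: "'j::finite \<Rightarrow> real"
  assumes \<beta>: "\<And>j. 0 < \<beta> j" and \<mu>: "\<And>i j. 0 \<le> \<mu> i j"
    and crp: "complete_resource_pooling \<Lambda> \<beta> \<mu> l \<rho>"
  shows "(\<Sum>i\<in>UNIV. l i j / (\<beta> j * \<mu> i j)) = \<rho>"
proof -
  define load where "load m j = (\<Sum>i\<in>UNIV. m i j / (\<beta> j * \<mu> i j))" for m j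
  define E where "E = basic_activities l"
  have feas: "spp_feasible \<Lambda> \<beta> \<mu> l \<rho>"
    and opt: "\<And>l' \<rho>'. spp_feasible \<Lambda> \<beta> \<mu> l' \<rho>' \<Longrightarrow> \<rho> \<le> \<rho>'"
    and uniq: "\<And>l'. spp_optimal \<Lambda> \<beta> \<mu> l' \<rho> \<Longrightarrow> l' = l"
    and tree: "activity_tree E"
    using crp unfolding complete_resource_pooling_def spp_optimal_def E_def by blast+
  have load_le: "load l j \<le> \<rho>" for j
    using feas by (simp add: spp_feasible_def load_def)
  \<comment> \<open>Without a tight pool the largest load would be a feasible value below
    \<open>\<rho>\<close>.\<close>
  obtain j0 where j0: "load l j0 = \<rho>"
  proof -
    have "spp_feasible \<Lambda> \<beta> \<mu> l (Max (range (load l)))"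
      using feas by (auto simp: spp_feasible_def load_def[symmetric])
    then have "\<rho> \<le> Max (range (load l))" by (rule opt)
    moreover have "Max (range (load l)) \<in> range (load l)" by (intro Max_in) auto
    ultimately show thesis using that load_le by (metis (no_types, lifting) imageE order_antisym)
  qed
  have shift: False
    if e: "(i, j) \<in> E" "(i, k) \<in> E" and "load l j = \<rho>" and slack: "load l k < \<rho>" for i j k
  proof -
    have lj: "0 < l i j" and lk: "0 < l i k" using e by (auto simp: E_def basic_activities_def)
    have jk: "j \<noteq> k" using that by auto
    have "\<mu> i j \<noteq> 0" "\<mu> i k \<noteq> 0" using feas lj lk by (auto simp: spp_feasible_def)
    then have mj: "0 < \<mu> i j" and mk: "0 < \<mu> i k" using \<mu>[of i j] \<mu>[of i k] by linarith+
    \<comment> \<open>The first bound keeps the flow on \<open>(i, j)\<close> nonnegative, the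
      second keeps the load of \<open>k\<close> at most \<open>\<rho>\<close>.\<close>
    define e where "e = min (l i j) ((\<rho> - load l k) * (\<beta> k * \<mu> i k))"
    have e0: "0 < e" using lj slack mk \<beta>[of k] by (simp add: e_def)
    define l' where "l' = (\<lambda>a b. l a b + (if a = i then (if b = k then e else 0) - (if b = j then e else 0) else 0))"
    have load': "load l' b = load l b + ((if b = k then e else 0) - (if b = j then e else 0)) / (\<beta> b * \<mu> i b)" for b
    proof -
      have "load l' b = (\<Sum>a\<in>UNIV. l a b / (\<beta> b * \<mu> a b) +
        (if a = i then ((if b = k then e else 0) - (if b = j then e else 0)) / (\<beta> b * \<mu> a b) else 0))"
        unfolding load_def l'_def by (intro sum.cong) (auto simp: add_divide_distrib diff_divide_distrib)
      then show ?thesis by (simp add: sum.distrib load_def)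
    qed
    have "e / (\<beta> k * \<mu> i k) \<le> \<rho> - load l k"
      using mk \<beta>[of k] by (simp add: e_def pos_divide_le_eq)
    moreover have "0 \<le> e / (\<beta> j * \<mu> i j)" using e0 mj \<beta>[of j] by simp
    ultimately have "load l' b \<le> \<rho>" for b
      using load_le[of b] jk by (auto simp: load')
    moreover have "e \<le> l i j" by (simp add: e_def)
    then have "0 \<le> l' a b" for a b
      using feas e0 jk by (auto simp: l'_def spp_feasible_def add_nonneg_nonneg)
    moreover have "(\<Sum>b\<in>UNIV. l' a b) = \<Lambda> a" for a
    proof -
      have "(\<Sum>b\<in>UNIV. l' a b) = (\<Sum>b\<in>UNIV. l a b)"
        by (cases "a = i") (simp_all add: l'_def sum.distrib sum_subtractf)
      then show ?thesis using feas by (simp add: spp_feasible_def)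
    qed
    moreover have "\<mu> a b = 0 \<longrightarrow> l' a b = 0" for a b
      using feas mj mk by (auto simp: l'_def spp_feasible_def)
    ultimately have "spp_feasible \<Lambda> \<beta> \<mu> l' \<rho>"
      by (auto simp: spp_feasible_def load_def[symmetric])
    then have "l' = l" using opt uniq unfolding spp_optimal_def by blast
    then have "l' i k = l i k" by simp
    then show False using e0 jk by (simp add: l'_def)
  qed
  \<comment> \<open>Paths alternate between pools and types, so the induction needs a notion for
    types too: a type is tight if some pool adjacent to it is.\<close>
  define tight where "tight v = (case v of Inl i \<Rightarrow> \<exists>j. (i, j) \<in> E \<and> load l j = \<rho> | Inr j \<Rightarrow> load l j = \<rho>)" for v
  have "(activity_adj E)\<^sup>*\<^sup>* (Inr j0) (Inr j)" using tree by (simp add: activity_tree_def)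
  then have "tight (Inr j)"
  proof (induction rule: rtranclp_induct)
    case (step v w)
    have key: "load l k = \<rho>" if "(i, j) \<in> E" "(i, k) \<in> E" "load l j = \<rho>" for i j k
      using shift[OF that] load_le[of k] by (metis less_le)
    from step(2) obtain i b where e: "(i, b) \<in> E" and "v = Inl i \<and> w = Inr b \<or> v = Inr b \<and> w = Inl i"
      unfolding activity_adj_def by blast
    then consider "v = Inl i" "w = Inr b" | "v = Inr b" "w = Inl i" by blast
    then show ?case
    proof cases
      case 1
      then obtain j where "(i, j) \<in> E" "load l j = \<rho>" using step(3) by (auto simp: tight_def)
      with e key have "load l b = \<rho>" by blast
      then show ?thesis using 1 by (simp add: tight_def)
    next
      case 2
      then show ?thesis using step(3) e by (auto simp: tight_def)
    qed
  qed (simp add: tight_def j0)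
  then show ?thesis by (simp add: tight_def load_def)
qed

section \<open>Left eigenvectors in real coordinates\<close>

text \<open>Singularity of \<open>A - c\<close> passes to the transpose. A left eigenvector is
  wanted because the coordinate it defines evolves by itself under \<open>A\<close>, as
  multiplication by \<open>c\<close>.\<close>

lemma eigenvalue_left_eigenvector:
  fixes A :: "real^'n^'n"
  assumes "eigenvalue A c"
  obtains w :: "complex^'n" where "w \<noteq> 0"
    "\<And>y :: real^'n. (\<Sum>i\<in>UNIV. w $ i * complex_of_real ((A *v y) $ i)) = c * (\<Sum>i\<in>UNIV. w $ i * complex_of_real (y $ i))"
proof -
  define B where "B = map_matrix complex_of_real A - mat c"
  have mat_c: "mat c *v v = c *s v" for v :: "complex^'n"
    by (simp add: vec_eq_iff matrix_vector_mult_def mat_def if_distrib[of "\<lambda>x. x * _"] cong: if_cong)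
  obtain v where "v \<noteq> 0" "B *v v = 0"
    using assms by (auto simp: eigenvalue_def B_def matrix_vector_mult_diff_rdistrib mat_c)
  then have "\<not> invertible B"
    unfolding invertible_def using matrix_left_invertible_ker[of B] by blast
  then have "\<not> invertible (transpose B)"
    by (simp add: invertible_det_nz)
  then have "\<not> (\<exists>C. C ** transpose B = mat 1)"
    using invertible_left_inverse by blast
  then obtain w where w: "w \<noteq> 0" "transpose B *v w = 0"
    unfolding matrix_left_invertible_ker by blast
  have col: "(\<Sum>i\<in>UNIV. w $ i * complex_of_real (A $ i $ k)) = c * w $ k" for k
  proof -
    have "0 = (transpose B *v w) $ k" using w by simp
    also have "\<dots> = (\<Sum>i\<in>UNIV. w $ i * complex_of_real (A $ i $ k) - (if i = k then c * w $ k else 0))"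
      unfolding matrix_vector_mult_def transpose_def B_def
      by (auto simp: mat_def map_matrix_def algebra_simps intro!: sum.cong)
    also have "\<dots> = (\<Sum>i\<in>UNIV. w $ i * complex_of_real (A $ i $ k)) - c * w $ k"
      by (simp add: sum_subtractf)
    finally show ?thesis by simp
  qed
  show thesis
  proof (rule that[OF w(1)])
    fix y :: "real^'n"
    have "(\<Sum>i\<in>UNIV. w $ i * complex_of_real ((A *v y) $ i)) =
      (\<Sum>i\<in>UNIV. \<Sum>k\<in>UNIV. w $ i * complex_of_real (A $ i $ k) * complex_of_real (y $ k))"
      by (simp add: matrix_vector_mult_def sum_distrib_left mult.assoc)
    also have "\<dots> = (\<Sum>k\<in>UNIV. (\<Sum>i\<in>UNIV. w $ i * complex_of_real (A $ i $ k)) * complex_of_real (y $ k))"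
      by (subst sum.swap) (simp add: sum_distrib_right)
    finally show "(\<Sum>i\<in>UNIV. w $ i * complex_of_real ((A *v y) $ i)) = c * (\<Sum>i\<in>UNIV. w $ i * complex_of_real (y $ i))"
      by (simp add: col sum_distrib_left mult.assoc)
  qed
qed

text \<open>Real and imaginary parts of the left eigenvector; for a nonreal \<open>c\<close> the two
  coordinates are rotated into each other by \<open>Im c\<close> and stretched by
  \<open>Re c\<close>.\<close>

lemma unstable_left_eigenvector:
  fixes A :: "real^'n^'n"
  assumes "eigenvalue A c"
  obtains u v :: "'n \<Rightarrow> real" where "\<exists>i. u i \<noteq> 0 \<or> v i \<noteq> 0"
    "\<And>y. (\<Sum>i\<in>UNIV. u i * (A *v y) $ i) = Re c * (\<Sum>i\<in>UNIV. u i * y $ i) - Im c * (\<Sum>i\<in>UNIV. v i * y $ i)"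
    "\<And>y. (\<Sum>i\<in>UNIV. v i * (A *v y) $ i) = Re c * (\<Sum>i\<in>UNIV. v i * y $ i) + Im c * (\<Sum>i\<in>UNIV. u i * y $ i)"
proof -
  obtain w :: "complex^'n" where w: "w \<noteq> 0"
    "\<And>y :: real^'n. (\<Sum>i\<in>UNIV. w $ i * complex_of_real ((A *v y) $ i)) = c * (\<Sum>i\<in>UNIV. w $ i * complex_of_real (y $ i))"
    using eigenvalue_left_eigenvector[OF assms] by blast
  show thesis
  proof (rule that[of "\<lambda>i. Re (w $ i)" "\<lambda>i. Im (w $ i)"])
    show "\<exists>i. Re (w $ i) \<noteq> 0 \<or> Im (w $ i) \<noteq> 0"
      using w(1) by (auto simp: vec_eq_iff complex_eq_iff)
    fix y
    show "(\<Sum>i\<in>UNIV. Re (w $ i) * (A *v y) $ i) = Re c * (\<Sum>i\<in>UNIV. Re (w $ i) * y $ i) - Im c * (\<Sum>i\<in>UNIV. Im (w $ i) * y $ i)"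
      using arg_cong[OF w(2)[of y], of Re] by simp
    show "(\<Sum>i\<in>UNIV. Im (w $ i) * (A *v y) $ i) = Re c * (\<Sum>i\<in>UNIV. Im (w $ i) * y $ i) + Im c * (\<Sum>i\<in>UNIV. Re (w $ i) * y $ i)"
      using arg_cong[OF w(2)[of y], of Im] by simp
  qed
qed

subsection \<open>Allocations in a tree network\<close>

locale network =
  fixes \<Lambda> :: "'i::finite \<Rightarrow> real" and \<beta> :: "'j::finite \<Rightarrow> real"
    and \<mu> l :: "'i \<Rightarrow> 'j \<Rightarrow> real" and E :: "('i \<times> 'j) set"
  assumes \<Lambda>_pos: "\<And>i. 0 < \<Lambda> i" and \<beta>_pos: "\<And>j. 0 < \<beta> j" and \<mu>_nonneg: "\<And>i j. 0 \<le> \<mu> i j"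
    and l_nonneg: "\<And>i j. 0 \<le> l i j" and E_eq: "E = basic_activities l"
    and l_row: "\<And>i. (\<Sum>j\<in>UNIV. l i j) = \<Lambda> i" and tree: "activity_tree E"
begin

definition row :: "('i \<Rightarrow> 'j \<Rightarrow> real) \<Rightarrow> 'i \<Rightarrow> real" where
  "row z i = (\<Sum>j\<in>UNIV. z i j)"

definition col :: "('i \<Rightarrow> 'j \<Rightarrow> real) \<Rightarrow> 'j \<Rightarrow> real" where
  "col z j = (\<Sum>i\<in>UNIV. z i j)"

definition imbalance :: "('i \<Rightarrow> 'j \<Rightarrow> real) \<Rightarrow> 'j \<Rightarrow> real" where
  "imbalance z j = col z j / \<beta> j - (\<Sum>k\<in>UNIV. col z k) / (\<Sum>k\<in>UNIV. \<beta> k)"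

definition total_imbalance :: "('i \<Rightarrow> 'j \<Rightarrow> real) \<Rightarrow> real" where
  "total_imbalance z = (\<Sum>j\<in>UNIV. \<bar>imbalance z j\<bar>)"

definition supported :: "('i \<Rightarrow> 'j \<Rightarrow> real) \<Rightarrow> bool" where
  "supported z \<longleftrightarrow> (\<forall>i j. (i, j) \<notin> E \<longrightarrow> z i j = 0)"

definition bump :: "('i \<Rightarrow> 'j \<Rightarrow> real) \<Rightarrow> 'i \<Rightarrow> 'j \<Rightarrow> real \<Rightarrow> 'i \<Rightarrow> 'j \<Rightarrow> real" where
  "bump z i j t = (\<lambda>i' j'. z i' j' + (if i' = i then if j' = j then t else 0 else 0))"

lemma beta_sum_pos: "0 < (\<Sum>j\<in>UNIV. \<beta> j)"
  using \<beta>_pos by (intro sum_pos) auto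

lemma row_bump: "row (bump z i j t) k = row z k + (if k = i then t else 0)"
  by (simp add: row_def bump_def sum.distrib)

lemma col_bump: "col (bump z i j t) k = col z k + (if k = j then t else 0)"
  by (simp add: col_def bump_def sum.distrib)

lemma sum_row: "(\<Sum>i\<in>UNIV. row z i) = (\<Sum>j\<in>UNIV. col z j)"
  unfolding row_def col_def by (rule sum.swap)

lemma col_eq: "col z j = \<beta> j * (imbalance z j + (\<Sum>i\<in>UNIV. row z i) / (\<Sum>k\<in>UNIV. \<beta> k))"
  using \<beta>_pos[of j] by (simp add: imbalance_def sum_row)

lemma weighted_imbalance: "(\<Sum>j\<in>UNIV. \<beta> j * imbalance z j) = 0"
proof -
  define q where "q = (\<Sum>k\<in>UNIV. col z k) / (\<Sum>k\<in>UNIV. \<beta> k)"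
  have "\<beta> j * imbalance z j = col z j - \<beta> j * q" for j
    using \<beta>_pos[of j] by (simp add: imbalance_def q_def right_diff_distrib)
  moreover have "(\<Sum>j\<in>UNIV. \<beta> j) * q = (\<Sum>j\<in>UNIV. col z j)"
    using beta_sum_pos by (simp add: q_def)
  ultimately show ?thesis
    by (simp add: sum_subtractf sum_distrib_right[symmetric])
qed

lemma total_imbalance_nonneg: "0 \<le> total_imbalance z"
  by (simp add: total_imbalance_def sum_nonneg)

lemma imbalance_le_total: "\<bar>imbalance z j\<bar> \<le> total_imbalance z"
  unfolding total_imbalance_def by (rule member_le_sum) auto

lemma l_pos: "(i, j) \<in> E \<longleftrightarrow> 0 < l i j"
  by (simp add: E_eq basic_activities_def)

lemma tree_allocation_unique:
  assumes "supported y" "supported z" "\<And>i. row y i = row z i" "\<And>j. col y j = col z j"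
  shows "y i j = z i j"
proof -
  have "y i j - z i j = 0"
  proof (rule tree_allocation_zero[OF tree, where z="\<lambda>i j. y i j - z i j"])
    show "(i, j) \<notin> E \<Longrightarrow> y i j - z i j = 0" for i j
      using assms by (simp add: supported_def)
  qed (use assms in \<open>simp_all add: row_def col_def sum_subtractf\<close>)
  then show ?thesis by simp
qed

text \<open>The tree flows give coefficients \<open>n\<close>, depending on the tree alone, that
  recover an allocation from its row and column sums. The same coefficients serve the balanced
  allocation, so that object, given by \<open>THE\<close>, becomes explicit and comparable with
  \<open>z\<close>.\<close>

lemma flow_representation:
  obtains n :: "'i + 'j \<Rightarrow> 'i \<Rightarrow> 'j \<Rightarrow> real" where
    "\<And>z i j. supported z \<Longrightarrow>
       z i j = (\<Sum>k\<in>UNIV. row z k * n (Inl k) i j) - (\<Sum>k\<in>UNIV. col z k * n (Inr k) i j)"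
    "\<And>y i j. (i, j) \<in> E \<Longrightarrow> balanced_allocation \<beta> E y (i, j) =
       (\<Sum>k\<in>UNIV. y $ k * n (Inl k) i j) -
       (\<Sum>k\<in>UNIV. (\<Sum>i\<in>UNIV. y $ i) / (\<Sum>k\<in>UNIV. \<beta> k) * \<beta> k * n (Inr k) i j)"
proof -
  obtain n :: "'i + 'j \<Rightarrow> 'i \<Rightarrow> 'j \<Rightarrow> real" where n: "\<And>v i j. (i, j) \<notin> E \<Longrightarrow> n v i j = 0"
    "\<And>a b i. sum a UNIV = sum b UNIV \<Longrightarrow>
       row (\<lambda>i j. (\<Sum>k\<in>UNIV. a k * n (Inl k) i j) - (\<Sum>k\<in>UNIV. b k * n (Inr k) i j)) i = a i"
    "\<And>a b j. sum a UNIV = sum b UNIV \<Longrightarrow>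
       col (\<lambda>i j. (\<Sum>k\<in>UNIV. a k * n (Inl k) i j) - (\<Sum>k\<in>UNIV. b k * n (Inr k) i j)) j = b j"
    unfolding row_def col_def by (rule tree_flow[OF tree]) blast
  define m where "m a b = (\<lambda>i j. (\<Sum>k\<in>UNIV. a k * n (Inl k) i j) - (\<Sum>k\<in>UNIV. b k * n (Inr k) i j))" for a b
  have m: "supported (m a b)" "sum a UNIV = sum b UNIV \<Longrightarrow> row (m a b) i = a i"
    "sum a UNIV = sum b UNIV \<Longrightarrow> col (m a b) j = b j" for a b i j
    using n by (simp_all add: m_def supported_def)
  show thesis
  proof (rule that[of n])
    fix z i j assume z: "supported z"
    have "z i j = m (row z) (col z) i j"
      by (rule tree_allocation_unique[OF z m(1)]) (simp_all only: m(2,3)[OF sum_row])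
    then show "z i j = (\<Sum>k\<in>UNIV. row z k * n (Inl k) i j) - (\<Sum>k\<in>UNIV. col z k * n (Inr k) i j)"
      by (simp only: m_def)
  next
    fix y :: "real^'i" and i j assume ij: "(i, j) \<in> E"
    define b where "b k = (\<Sum>i\<in>UNIV. y $ i) / (\<Sum>k\<in>UNIV. \<beta> k) * \<beta> k" for k
    have "sum b UNIV = (\<Sum>i\<in>UNIV. y $ i) / (\<Sum>k\<in>UNIV. \<beta> k) * (\<Sum>k\<in>UNIV. \<beta> k)"
      unfolding b_def by (rule sum_distrib_left[symmetric])
    then have sums: "sum (\<lambda>k. y $ k) UNIV = sum b UNIV"
      using beta_sum_pos by simp
    define x where "x = m (\<lambda>k. y $ k) b"
    have x: "supported x" "row x i = y $ i" "col x j = b j" for i j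
      unfolding x_def by (rule m(1), rule m(2)[OF sums], rule m(3)[OF sums])
    have row_E: "(\<Sum>j\<in>pools E i. f i j) = row f i" and col_E: "(\<Sum>i\<in>types E j. f i j) = col f j"
      if "supported f" for f i j
      using that unfolding row_def col_def pools_def types_def supported_def
      by (auto intro!: sum.mono_neutral_left)
    let ?Q = "\<lambda>z. z \<in> PiE E (\<lambda>_. UNIV) \<and>
      (\<forall>j. (\<Sum>i\<in>types E j. z (i, j)) = b j) \<and> (\<forall>i. (\<Sum>j\<in>pools E i. z (i, j)) = y $ i)"
    have "(THE z. ?Q z) = restrict (case_prod x) E"
    proof (rule the_equality)
      have "(\<Sum>i\<in>types E j. restrict (case_prod x) E (i, j)) = (\<Sum>i\<in>types E j. x i j)" for j
        by (intro sum.cong) (auto simp: types_def)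
      moreover have "(\<Sum>j\<in>pools E i. restrict (case_prod x) E (i, j)) = (\<Sum>j\<in>pools E i. x i j)" for i
        by (intro sum.cong) (auto simp: pools_def)
      ultimately show "?Q (restrict (case_prod x) E)"
        using x row_E[of x] col_E[of x] by simp
    next
      fix w assume w: "?Q w"
      \<comment> \<open>Vectors over \<open>E\<close> are \<open>undefined\<close> elsewhere;
        extension by 0 makes uniqueness of tree allocations applicable.\<close>
      define z where "z i j = (if (i, j) \<in> E then w (i, j) else 0)" for i j
      have sz: "supported z" by (simp add: supported_def z_def)
      have "(\<Sum>i\<in>types E j. z i j) = b j" "(\<Sum>j\<in>pools E i. z i j) = y $ i" for i j
        using w by (simp_all add: z_def types_def pools_def)
      then have "row z i = y $ i" "col z j = b j" for i j
        using row_E[OF sz] col_E[OF sz] by auto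
      then have "z i j = x i j" for i j
        by (intro tree_allocation_unique[of z x i j, OF sz x(1)]) (simp_all add: x)
      then have "w (i, j) = x i j" if "(i, j) \<in> E" for i j
        using that by (metis z_def)
      then show "w = restrict (case_prod x) E"
        using w by (auto simp: fun_eq_iff restrict_def PiE_def extensional_def)
    qed
    then have "balanced_allocation \<beta> E y = restrict (case_prod x) E"
      by (simp add: balanced_allocation_def b_def)
    then show "balanced_allocation \<beta> E y (i, j) =
       (\<Sum>k\<in>UNIV. y $ k * n (Inl k) i j) -
       (\<Sum>k\<in>UNIV. (\<Sum>i\<in>UNIV. y $ i) / (\<Sum>k\<in>UNIV. \<beta> k) * \<beta> k * n (Inr k) i j)"
      using ij by (simp add: x_def m_def b_def)
  qed
qed

text \<open>\<open>matrix\<close> represents a map only if the map is linear, and linearity is not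
  visible through \<open>THE\<close>; the flow formula supplies it.\<close>

lemma A_u_apply:
  "(A_u \<beta> \<mu> E *v y) $ i = - (\<Sum>j\<in>pools E i. \<mu> i j * balanced_allocation \<beta> E y (i, j))"
proof -
  obtain n where n: "\<And>y i j. (i, j) \<in> E \<Longrightarrow> balanced_allocation \<beta> E y (i, j) =
       (\<Sum>k\<in>UNIV. y $ k * n (Inl k) i j) -
       (\<Sum>k\<in>UNIV. (\<Sum>i\<in>UNIV. y $ i) / (\<Sum>k\<in>UNIV. \<beta> k) * \<beta> k * n (Inr k) i j)"
    by (rule flow_representation) blast
  let ?f = "\<lambda>y. \<chi> i. - (\<Sum>j\<in>pools E i. \<mu> i j * balanced_allocation \<beta> E y (i, j))"
  have add: "balanced_allocation \<beta> E (x + y) (i, j) =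
      balanced_allocation \<beta> E x (i, j) + balanced_allocation \<beta> E y (i, j)" if "(i, j) \<in> E" for x y i j
    using that by (simp add: n sum.distrib distrib_right add_divide_distrib)
  have scale: "balanced_allocation \<beta> E (c *\<^sub>R y) (i, j) = c * balanced_allocation \<beta> E y (i, j)"
    if "(i, j) \<in> E" for c y i j
    using that by (simp add: n sum_distrib_left[symmetric] right_diff_distrib mult.assoc times_divide_eq_right[symmetric]
      del: times_divide_eq_right)
  have "linear ?f"
  proof (rule linearI)
    have "(\<Sum>j\<in>pools E i. \<mu> i j * balanced_allocation \<beta> E (x + y) (i, j)) =
        (\<Sum>j\<in>pools E i. \<mu> i j * balanced_allocation \<beta> E x (i, j)) +
        (\<Sum>j\<in>pools E i. \<mu> i j * balanced_allocation \<beta> E y (i, j))" for x y i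
      unfolding sum.distrib[symmetric]
      by (intro sum.cong refl) (simp add: pools_def add distrib_left)
    then show "?f (x + y) = ?f x + ?f y" for x y
      by (simp add: vec_eq_iff)
    show "?f (c *\<^sub>R x) = c *\<^sub>R ?f x" for c x
      by (simp add: vec_eq_iff pools_def scale sum_distrib_left mult.left_commute)
  qed
  then show ?thesis by (simp add: A_u_def matrix_works)
qed

lemma abs_sum_le_const:
  fixes f c :: "'k::finite \<Rightarrow> real"
  assumes "\<And>k. \<bar>f k\<bar> \<le> M"
  shows "\<bar>\<Sum>k\<in>UNIV. f k * c k\<bar> \<le> (\<Sum>k\<in>UNIV. \<bar>c k\<bar>) * M"
proof -
  have "\<bar>\<Sum>k\<in>UNIV. f k * c k\<bar> \<le> (\<Sum>k\<in>UNIV. \<bar>f k\<bar> * \<bar>c k\<bar>)"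
    by (rule order_trans[OF sum_abs]) (simp add: abs_mult)
  also have "\<dots> \<le> (\<Sum>k\<in>UNIV. M * \<bar>c k\<bar>)"
    by (intro sum_mono mult_right_mono assms) auto
  finally show ?thesis by (simp add: sum_distrib_left mult.commute)
qed

text \<open>\<open>A_u\<close> gives the drift of the row sums for perfectly balanced pools. With
  the same row sums, \<open>z\<close> differs from the balanced allocation by a linear function of
  the imbalance.\<close>

lemma linear_drift_bound:
  obtains C where "0 \<le> C" "\<And>z i. supported z \<Longrightarrow>
    \<bar>- (\<Sum>j\<in>UNIV. \<mu> i j * z i j) - (A_u \<beta> \<mu> E *v (\<chi> k. row z k)) $ i\<bar> \<le> C * total_imbalance z"
proof -
  obtain n where n: "\<And>z i j. supported z \<Longrightarrow>
       z i j = (\<Sum>k\<in>UNIV. row z k * n (Inl k) i j) - (\<Sum>k\<in>UNIV. col z k * n (Inr k) i j)"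
    "\<And>y i j. (i, j) \<in> E \<Longrightarrow> balanced_allocation \<beta> E y (i, j) =
       (\<Sum>k\<in>UNIV. y $ k * n (Inl k) i j) -
       (\<Sum>k\<in>UNIV. (\<Sum>i\<in>UNIV. y $ i) / (\<Sum>k\<in>UNIV. \<beta> k) * \<beta> k * n (Inr k) i j)"
    by (rule flow_representation) blast
  define c where "c i j = (\<Sum>k\<in>UNIV. \<bar>\<beta> k * n (Inr k) i j\<bar>)" for i j
  define C where "C = (\<Sum>i\<in>UNIV. \<Sum>j\<in>UNIV. \<mu> i j * c i j)"
  have c0: "0 \<le> c i j" for i j by (simp add: c_def sum_nonneg)
  show thesis
  proof (rule that[of C])
    show "0 \<le> C" unfolding C_def using \<mu>_nonneg c0 by (intro sum_nonneg) auto
    fix z i assume z: "supported z"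
    let ?y = "\<chi> k. row z k"
    have D: "\<bar>z i j - balanced_allocation \<beta> E ?y (i, j)\<bar> \<le> c i j * total_imbalance z" if "(i, j) \<in> E" for j
    proof -
      \<comment> \<open>The row parts of the two flow formulas cancel, and \<open>col z k\<close>
        exceeds its balanced value by \<open>\<beta> k * imbalance z k\<close>.\<close>
      have "z i j - balanced_allocation \<beta> E ?y (i, j) = - (\<Sum>k\<in>UNIV. imbalance z k * (\<beta> k * n (Inr k) i j))"
      proof -
        define q where "q = (\<Sum>i\<in>UNIV. row z i) / (\<Sum>k\<in>UNIV. \<beta> k)"
        have "z i j - balanced_allocation \<beta> E ?y (i, j) =
            (\<Sum>k\<in>UNIV. q * \<beta> k * n (Inr k) i j) - (\<Sum>k\<in>UNIV. col z k * n (Inr k) i j)"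
          using n(1)[OF z, of i j] n(2)[OF that, of ?y] by (simp add: q_def)
        also have "\<dots> = (\<Sum>k\<in>UNIV. - (imbalance z k * (\<beta> k * n (Inr k) i j)))"
          unfolding sum_subtractf[symmetric]
          by (intro sum.cong refl) (simp add: col_eq[of z] q_def[symmetric] algebra_simps)
        finally show ?thesis by (simp add: sum_negf)
      qed
      then show ?thesis
        using abs_sum_le_const[of "imbalance z" "total_imbalance z" "\<lambda>k. \<beta> k * n (Inr k) i j"]
          imbalance_le_total by (simp add: c_def)
    qed
    have "(\<Sum>j\<in>UNIV. \<mu> i j * z i j) = (\<Sum>j\<in>pools E i. \<mu> i j * z i j)"
      using z by (intro sum.mono_neutral_right) (auto simp: pools_def supported_def)
    then have "- (\<Sum>j\<in>UNIV. \<mu> i j * z i j) - (A_u \<beta> \<mu> E *v ?y) $ i =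
        - (\<Sum>j\<in>pools E i. \<mu> i j * (z i j - balanced_allocation \<beta> E ?y (i, j)))"
      by (simp add: A_u_apply right_diff_distrib sum_subtractf)
    also have "\<bar>\<dots>\<bar> \<le> (\<Sum>j\<in>pools E i. \<bar>\<mu> i j * (z i j - balanced_allocation \<beta> E ?y (i, j))\<bar>)"
      by (simp add: sum_abs)
    also have "\<dots> \<le> (\<Sum>j\<in>pools E i. \<mu> i j * (c i j * total_imbalance z))"
      using D \<mu>_nonneg by (intro sum_mono) (auto simp: abs_mult pools_def intro!: mult_left_mono)
    also have "\<dots> \<le> (\<Sum>j\<in>UNIV. \<mu> i j * (c i j * total_imbalance z))"
      using \<mu>_nonneg c0 total_imbalance_nonneg by (intro sum_mono2) auto
    also have "\<dots> = (\<Sum>j\<in>UNIV. \<mu> i j * c i j) * total_imbalance z"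
      by (simp add: sum_distrib_right mult.assoc)
    also have "\<dots> \<le> C * total_imbalance z"
      unfolding C_def using \<mu>_nonneg c0 total_imbalance_nonneg
      by (intro mult_right_mono member_le_sum) (auto intro!: sum_nonneg)
    finally show "\<bar>- (\<Sum>j\<in>UNIV. \<mu> i j * z i j) - (A_u \<beta> \<mu> E *v ?y) $ i\<bar> \<le> C * total_imbalance z" .
  qed
qed

text \<open>Row sums and imbalance determine the column sums by \<open>col_eq\<close>, hence the
  whole allocation by the flow formula.\<close>

lemma supported_bound:
  obtains C where "0 \<le> C" "\<And>z i j. supported z \<Longrightarrow>
    \<bar>z i j\<bar> \<le> C * ((\<Sum>k\<in>UNIV. \<bar>row z k\<bar>) + total_imbalance z)"
proof -
  obtain n where n: "\<And>z i j. supported z \<Longrightarrow>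
       z i j = (\<Sum>k\<in>UNIV. row z k * n (Inl k) i j) - (\<Sum>k\<in>UNIV. col z k * n (Inr k) i j)"
    by (rule flow_representation) blast
  have ring: "b * (x + x / b) = b * (1 + 1 / b) * x" for b x :: real
    by (cases "b = 0") (simp_all add: field_simps)
  define B where "B = (\<Sum>j\<in>UNIV. \<beta> j) * (1 + 1 / (\<Sum>k\<in>UNIV. \<beta> k))"
  have B0: "0 \<le> B" using beta_sum_pos by (simp add: B_def)
  define c where "c i j = (\<Sum>k\<in>UNIV. \<bar>n (Inl k) i j\<bar>) + (\<Sum>k\<in>UNIV. \<bar>n (Inr k) i j\<bar>) * B" for i j
  have c0: "0 \<le> c i j" for i j using B0 by (simp add: c_def sum_nonneg)
  define C where "C = (\<Sum>i\<in>UNIV. \<Sum>j\<in>UNIV. c i j)"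
  show thesis
  proof (rule that[of C])
    show "0 \<le> C" unfolding C_def using c0 by (intro sum_nonneg) auto
    fix z i j assume z: "supported z"
    let ?R = "\<Sum>k\<in>UNIV. \<bar>row z k\<bar>" and ?N = "(\<Sum>k\<in>UNIV. \<bar>row z k\<bar>) + total_imbalance z"
    have N0: "0 \<le> ?R" "?R \<le> ?N" "0 \<le> ?N" using total_imbalance_nonneg by (auto intro!: add_nonneg_nonneg sum_nonneg)
    have row_le: "\<bar>row z k\<bar> \<le> ?N" for k
      using member_le_sum[of k UNIV "\<lambda>k. \<bar>row z k\<bar>"] N0 by simp
    have col_le: "\<bar>col z k\<bar> \<le> B * ?N" for k
    proof -
      have "\<bar>(\<Sum>i\<in>UNIV. row z i) / (\<Sum>k\<in>UNIV. \<beta> k)\<bar> \<le> ?R / (\<Sum>k\<in>UNIV. \<beta> k)"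
        using beta_sum_pos by (auto intro: divide_right_mono simp: sum_abs)
      also have "\<dots> \<le> ?N / (\<Sum>k\<in>UNIV. \<beta> k)"
        using N0 beta_sum_pos by (intro divide_right_mono) auto
      finally have "\<bar>imbalance z k + (\<Sum>i\<in>UNIV. row z i) / (\<Sum>k\<in>UNIV. \<beta> k)\<bar> \<le> ?N + ?N / (\<Sum>k\<in>UNIV. \<beta> k)"
        using imbalance_le_total[of z k] N0 by linarith
      then have "\<bar>col z k\<bar> \<le> \<beta> k * (?N + ?N / (\<Sum>k\<in>UNIV. \<beta> k))"
        unfolding col_eq[of z k] abs_mult using \<beta>_pos[of k] by (simp add: mult_left_mono)
      also have "\<dots> \<le> (\<Sum>k\<in>UNIV. \<beta> k) * (?N + ?N / (\<Sum>k\<in>UNIV. \<beta> k))"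
        using N0 beta_sum_pos \<beta>_pos by (intro mult_right_mono member_le_sum add_nonneg_nonneg divide_nonneg_pos) (auto intro: less_imp_le)
      also have "\<dots> = B * ?N"
        using ring[of "\<Sum>k\<in>UNIV. \<beta> k" ?N] by (simp add: B_def)
      finally show ?thesis .
    qed
    have "\<bar>z i j\<bar> \<le> (\<Sum>k\<in>UNIV. \<bar>n (Inl k) i j\<bar>) * ?N + (\<Sum>k\<in>UNIV. \<bar>n (Inr k) i j\<bar>) * (B * ?N)"
      using n[OF z, of i j] abs_sum_le_const[of "row z" ?N "\<lambda>k. n (Inl k) i j"]
        abs_sum_le_const[of "col z" "B * ?N" "\<lambda>k. n (Inr k) i j"] row_le col_le by fastforce
    also have "\<dots> = c i j * ?N" by (simp add: c_def algebra_simps)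
    also have "\<dots> \<le> C * ?N"
    proof (rule mult_right_mono)
      have "c i j \<le> (\<Sum>j\<in>UNIV. c i j)" using c0 by (intro member_le_sum) auto
      also have "\<dots> \<le> C" unfolding C_def using c0 by (intro member_le_sum sum_nonneg) auto
      finally show "c i j \<le> C" .
    qed (rule N0)
    finally show "\<bar>z i j\<bar> \<le> C * ?N" .
  qed
qed

end

subsection \<open>Drift of the imbalance and of the logarithm\<close>

text \<open>Telescoping along the path; \<open>N\<close> counts its edges and does not depend on the
  potential.\<close>

lemma path_potential_bound:
  assumes "(activity_adj E)\<^sup>*\<^sup>* u v"
  shows "\<exists>N\<ge>0. \<forall>(p :: 'i + 'j \<Rightarrow> real) T. (\<forall>i j. (i, j) \<in> E \<longrightarrow> \<bar>p (Inl i) - p (Inr j)\<bar> \<le> T) \<longrightarrow>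
    \<bar>p u - p v\<bar> \<le> N * T"
  using assms
proof (induction rule: rtranclp_induct)
  case base
  show ?case by (intro exI[of _ 0]) simp
next
  case (step v w)
  then obtain N where N: "0 \<le> N" "\<And>(p :: 'i + 'j \<Rightarrow> real) T. (\<forall>i j. (i, j) \<in> E \<longrightarrow> \<bar>p (Inl i) - p (Inr j)\<bar> \<le> T) \<Longrightarrow>
    \<bar>p u - p v\<bar> \<le> N * T" by blast
  have "\<bar>p u - p w\<bar> \<le> (N + 1) * T"
    if p: "\<forall>i j. (i, j) \<in> E \<longrightarrow> \<bar>p (Inl i) - p (Inr j)\<bar> \<le> T" for p :: "'i + 'j \<Rightarrow> real" and T
  proof -
    have "\<bar>p v - p w\<bar> \<le> T"
      using step(2) p by (auto simp: activity_adj_def abs_minus_commute)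
    then show ?thesis using N(2)[OF p] by (simp add: distrib_right)
  qed
  then show ?case using N(1) by (intro exI[of _ "N + 1"]) auto
qed

context network
begin

definition generator ::
  "('i \<Rightarrow> 'j \<Rightarrow> real) \<Rightarrow> ('i \<Rightarrow> 'j \<Rightarrow> real) \<Rightarrow> real \<Rightarrow> (('i \<Rightarrow> 'j \<Rightarrow> real) \<Rightarrow> real) \<Rightarrow> ('i \<Rightarrow> 'j \<Rightarrow> real) \<Rightarrow> real"
where
  "generator a b \<tau> W z =
     (\<Sum>i\<in>UNIV. \<Sum>j\<in>UNIV. a i j * (W (bump z i j \<tau>) - W z)) +
     (\<Sum>i\<in>UNIV. \<Sum>j\<in>UNIV. b i j * (W (bump z i j (- \<tau>)) - W z))"

text \<open>
  Here \<open>a i j\<close> is the rate of type \<open>i\<close> arrivals routed to pool \<open>j\<close> and \<open>b i j\<close> the rate of type \<open>i\<close>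
  completions in pool \<open>j\<close>, in a state with scaled occupancy \<open>z\<close> and empty queues.
\<close>

definition event_rates ::
  "real \<Rightarrow> ('i \<Rightarrow> 'j \<Rightarrow> real) \<Rightarrow> ('i \<Rightarrow> 'j \<Rightarrow> real) \<Rightarrow> ('i \<Rightarrow> 'j \<Rightarrow> real) \<Rightarrow> bool"
where
  "event_rates r z a b \<longleftrightarrow> supported z \<and>
     (\<forall>i j. 0 \<le> a i j) \<and> (\<forall>i. (\<Sum>j\<in>UNIV. a i j) = r * \<Lambda> i) \<and>
     (\<forall>i j k. 0 < a i j \<longrightarrow> (i, k) \<in> E \<longrightarrow> imbalance z j \<le> imbalance z k) \<and>
     (\<forall>i j. 0 \<le> b i j \<and> b i j \<le> r * (\<mu> i j * \<beta> j) \<and> b i j = r * l i j + sqrt r * (\<mu> i j * z i j))"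

lemma event_ratesD:
  assumes "event_rates r z a b"
  shows "supported z" "0 \<le> a i j" "(\<Sum>j\<in>UNIV. a i j) = r * \<Lambda> i"
    "0 < a i j \<Longrightarrow> (i, k) \<in> E \<Longrightarrow> imbalance z j \<le> imbalance z k"
    "0 \<le> b i j" "b i j \<le> r * (\<mu> i j * \<beta> j)" "b i j = r * l i j + sqrt r * (\<mu> i j * z i j)"
  using assms unfolding event_rates_def by blast+

text \<open>A discrete Ito inequality: \<open>t\<close> is a jump of either sign, so the first-order
  parts combine with the net rates \<open>a - b\<close> and the second-order parts with the total
  rates \<open>a + b\<close>.\<close>

lemma generator_le:
  assumes ev: "event_rates r z a b"
    and W: "\<And>i j t. t\<^sup>2 = \<tau>\<^sup>2 \<Longrightarrow> W (bump z i j t) - W z \<le> t * g i j + t\<^sup>2 * k i j"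
  shows "generator a b \<tau> W z \<le> \<tau> * (\<Sum>i\<in>UNIV. \<Sum>j\<in>UNIV. (a i j - b i j) * g i j)
    + \<tau>\<^sup>2 * (\<Sum>i\<in>UNIV. \<Sum>j\<in>UNIV. (a i j + b i j) * k i j)"
proof -
  have "generator a b \<tau> W z = (\<Sum>i\<in>UNIV. \<Sum>j\<in>UNIV.
      a i j * (W (bump z i j \<tau>) - W z) + b i j * (W (bump z i j (- \<tau>)) - W z))"
    by (simp add: generator_def sum.distrib)
  also have "\<dots> \<le> (\<Sum>i\<in>UNIV. \<Sum>j\<in>UNIV. \<tau> * ((a i j - b i j) * g i j) + \<tau>\<^sup>2 * ((a i j + b i j) * k i j))"
  proof (intro sum_mono)
    fix i j
    have "a i j * (W (bump z i j \<tau>) - W z) \<le> a i j * (\<tau> * g i j + \<tau>\<^sup>2 * k i j)"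
      using W[of \<tau> i j] event_ratesD(2)[OF ev] by (intro mult_left_mono) auto
    moreover have "b i j * (W (bump z i j (- \<tau>)) - W z) \<le> b i j * (- \<tau> * g i j + \<tau>\<^sup>2 * k i j)"
      using W[of "- \<tau>" i j] event_ratesD(5)[OF ev] by (intro mult_left_mono) auto
    ultimately show "a i j * (W (bump z i j \<tau>) - W z) + b i j * (W (bump z i j (- \<tau>)) - W z)
      \<le> \<tau> * ((a i j - b i j) * g i j) + \<tau>\<^sup>2 * ((a i j + b i j) * k i j)"
      by (simp add: algebra_simps)
  qed
  also have "\<dots> = \<tau> * (\<Sum>i\<in>UNIV. \<Sum>j\<in>UNIV. (a i j - b i j) * g i j)
    + \<tau>\<^sup>2 * (\<Sum>i\<in>UNIV. \<Sum>j\<in>UNIV. (a i j + b i j) * k i j)"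
    by (simp add: sum.distrib sum_distrib_left)
  finally show ?thesis .
qed

text \<open>A bound for the total event rate per unit of \<open>r\<close>, crude in that every
  activity is counted as if it filled its whole pool.\<close>

definition rate_bound :: real where
  "rate_bound = (\<Sum>i\<in>UNIV. \<Lambda> i) + (\<Sum>i\<in>UNIV. \<Sum>j\<in>UNIV. \<mu> i j * \<beta> j)"

lemma rate_bound_nonneg: "0 \<le> rate_bound"
  unfolding rate_bound_def using \<Lambda>_pos \<mu>_nonneg \<beta>_pos
  by (intro add_nonneg_nonneg sum_nonneg mult_nonneg_nonneg) (auto intro: less_imp_le)

lemma total_rate_le:
  assumes ev: "event_rates r z a b"
  shows "(\<Sum>i\<in>UNIV. \<Sum>j\<in>UNIV. a i j + b i j) \<le> r * rate_bound"
proof -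
  have "(\<Sum>i\<in>UNIV. \<Sum>j\<in>UNIV. b i j) \<le> (\<Sum>i\<in>UNIV. \<Sum>j\<in>UNIV. r * (\<mu> i j * \<beta> j))"
    by (intro sum_mono event_ratesD(6)[OF ev])
  then show ?thesis
    by (simp add: rate_bound_def sum.distrib event_ratesD(3)[OF ev] sum_distrib_left distrib_left)
qed

text \<open>Jumps have squared size \<open>1 / r\<close> and occur at total rate of order
  \<open>r\<close>, so second-order terms stay bounded.\<close>

lemma second_order_le:
  assumes ev: "event_rates r z a b" and r: "0 < r"
    and k: "\<And>i j. k i j \<le> K" and K: "0 \<le> K"
  shows "(1 / sqrt r)\<^sup>2 * (\<Sum>i\<in>UNIV. \<Sum>j\<in>UNIV. (a i j + b i j) * k i j) \<le> rate_bound * K"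
proof -
  have "(\<Sum>i\<in>UNIV. \<Sum>j\<in>UNIV. (a i j + b i j) * k i j) \<le> (\<Sum>i\<in>UNIV. \<Sum>j\<in>UNIV. (a i j + b i j) * K)"
    using event_ratesD(2,5)[OF ev] by (intro sum_mono mult_left_mono k add_nonneg_nonneg)
  also have "\<dots> = (\<Sum>i\<in>UNIV. \<Sum>j\<in>UNIV. a i j + b i j) * K"
    by (simp add: sum_distrib_right)
  also have "\<dots> \<le> r * rate_bound * K"
    by (intro mult_right_mono total_rate_le[OF ev] K)
  finally show ?thesis
    using r by (simp add: power_divide pos_divide_le_eq mult_ac)
qed

text \<open>Arrivals at rate \<open>r * \<Lambda> i\<close> cancel the nominal completions, whose
  rates sum to the same by \<open>l_row\<close>. What survives is of order \<open>sqrt r\<close> and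
  is normalised by the jump size. Routing does not enter, since \<open>g\<close> depends on the type
  only.\<close>

lemma row_drift:
  assumes ev: "event_rates r z a b" and r: "0 < r"
  shows "1 / sqrt r * (\<Sum>i\<in>UNIV. \<Sum>j\<in>UNIV. (a i j - b i j) * g i) =
    (\<Sum>i\<in>UNIV. g i * - (\<Sum>j\<in>UNIV. \<mu> i j * z i j))"
proof -
  have "(\<Sum>j\<in>UNIV. (a i j - b i j) * g i) = sqrt r * (g i * - (\<Sum>j\<in>UNIV. \<mu> i j * z i j))" for i
  proof -
    have "(\<Sum>j\<in>UNIV. b i j) = r * \<Lambda> i + sqrt r * (\<Sum>j\<in>UNIV. \<mu> i j * z i j)"
      unfolding event_ratesD(7)[OF ev] sum.distrib sum_distrib_left[symmetric] l_row ..
    then have "(\<Sum>j\<in>UNIV. a i j - b i j) = - sqrt r * (\<Sum>j\<in>UNIV. \<mu> i j * z i j)"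
      by (simp add: sum_subtractf event_ratesD(3)[OF ev])
    then show ?thesis by (simp add: sum_distrib_right[symmetric])
  qed
  then have "(\<Sum>i\<in>UNIV. \<Sum>j\<in>UNIV. (a i j - b i j) * g i) =
      sqrt r * (\<Sum>i\<in>UNIV. g i * - (\<Sum>j\<in>UNIV. \<mu> i j * z i j))"
    by (simp only: sum_distrib_left[symmetric])
  then show ?thesis using r by simp
qed

section \<open>Contraction of the imbalance by the routing rule\<close>

definition V :: "('i \<Rightarrow> 'j \<Rightarrow> real) \<Rightarrow> real" where
  "V z = (\<Sum>j\<in>UNIV. \<beta> j * (imbalance z j)\<^sup>2)"

text \<open>The identity of mean square minus squared mean for the weights \<open>\<beta>\<close>.
  It isolates the effect of one jump, which changes a single column and the total.\<close>

lemma V_alt: "V z = (\<Sum>j\<in>UNIV. (col z j)\<^sup>2 / \<beta> j) - (\<Sum>j\<in>UNIV. col z j)\<^sup>2 / (\<Sum>j\<in>UNIV. \<beta> j)"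
proof -
  define B where "B = (\<Sum>j\<in>UNIV. \<beta> j)"
  define S where "S = (\<Sum>j\<in>UNIV. col z j)"
  have "B \<noteq> 0" using beta_sum_pos by (simp add: B_def)
  have "\<beta> j * (imbalance z j)\<^sup>2 = (col z j)\<^sup>2 / \<beta> j - 2 * (S / B) * col z j + (S / B)\<^sup>2 * \<beta> j" for j
    using \<beta>_pos[of j] unfolding imbalance_def S_def[symmetric] B_def[symmetric]
    by (simp add: power2_eq_square algebra_simps)
  then have "V z = (\<Sum>j\<in>UNIV. (col z j)\<^sup>2 / \<beta> j) - 2 * (S / B) * S + (S / B)\<^sup>2 * B"
    unfolding V_def by (simp only: sum.distrib sum_subtractf sum_distrib_left[symmetric] S_def[symmetric] B_def[symmetric])
  also have "\<dots> = (\<Sum>j\<in>UNIV. (col z j)\<^sup>2 / \<beta> j) - S\<^sup>2 / B"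
    using \<open>B \<noteq> 0\<close> by (simp add: power2_eq_square)
  finally show ?thesis by (simp add: S_def B_def)
qed

text \<open>The increment is exactly quadratic in \<open>t\<close>; the dropped part
  \<open>- t\<^sup>2 / B\<close> comes from the shift of the mean load.\<close>

lemma V_bump: "V (bump z i j t) - V z \<le> t * (2 * imbalance z j) + t\<^sup>2 * (1 / \<beta> j)"
proof -
  define B where "B = (\<Sum>j\<in>UNIV. \<beta> j)"
  define S where "S = (\<Sum>j\<in>UNIV. col z j)"
  have B: "0 < B" using beta_sum_pos by (simp add: B_def)
  have "(\<Sum>k\<in>UNIV. (col (bump z i j t) k)\<^sup>2 / \<beta> k) =
      (\<Sum>k\<in>UNIV. (col z k)\<^sup>2 / \<beta> k + (if k = j then (2 * t * col z j + t\<^sup>2) / \<beta> j else 0))"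
    by (intro sum.cong) (auto simp: col_bump power2_eq_square algebra_simps add_divide_distrib)
  then have "V (bump z i j t) - V z = (2 * t * col z j + t\<^sup>2) / \<beta> j - ((S + t)\<^sup>2 - S\<^sup>2) / B"
    by (simp add: V_alt sum.distrib col_bump S_def B_def diff_divide_distrib)
  also have "\<dots> = t * (2 * imbalance z j) + t\<^sup>2 * (1 / \<beta> j) - t\<^sup>2 / B"
    using B \<beta>_pos[of j] unfolding imbalance_def S_def[symmetric] B_def[symmetric]
    by (simp add: field_simps power2_eq_square)
  also have "\<dots> \<le> t * (2 * imbalance z j) + t\<^sup>2 * (1 / \<beta> j)"
    using B by simp
  finally show ?thesis .
qed

text \<open>All summands on the right are nonnegative, so a small sum forces a small gap across
  every edge of the tree. Then all pools have nearly equal imbalance, and a zero weighted mean makes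
  all imbalances small.\<close>

lemma routing_contracts:
  obtains c where "0 < c" "\<And>z m. (\<And>i k. (i, k) \<in> E \<Longrightarrow> m i \<le> imbalance z k) \<Longrightarrow>
    c * total_imbalance z \<le> (\<Sum>i\<in>UNIV. \<Sum>j\<in>UNIV. l i j * (imbalance z j - m i))"
proof -
  obtain l0 where l0: "0 < l0" "\<And>i j. (i, j) \<in> E \<Longrightarrow> l0 \<le> l i j"
  proof
    \<comment> \<open>The extra 1 keeps the set nonempty for \<open>Min\<close> without affecting
      the bounds on \<open>E\<close>.\<close>
    let ?L = "insert 1 ((\<lambda>(i, j). l i j) ` E)"
    have "x > 0" if "x \<in> ?L" for x using that l_pos by auto
    then show "0 < Min ?L" by (subst Min_gr_iff) auto
    show "Min ?L \<le> l i j" if "(i, j) \<in> E" for i j using that by (intro Min_le) auto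
  qed
  have "\<forall>u v. \<exists>N\<ge>0. \<forall>(p :: 'i + 'j \<Rightarrow> real) T. (\<forall>i j. (i, j) \<in> E \<longrightarrow> \<bar>p (Inl i) - p (Inr j)\<bar> \<le> T) \<longrightarrow>
    \<bar>p u - p v\<bar> \<le> N * T"
    using tree path_potential_bound unfolding activity_tree_def by blast
  then obtain N where N0: "\<And>u v. 0 \<le> N u v"
    and N: "\<And>u v p T. (\<forall>i j. (i, j) \<in> E \<longrightarrow> \<bar>p (Inl i) - p (Inr j)\<bar> \<le> T) \<Longrightarrow>
    \<bar>p u - p v\<bar> \<le> N u v * (T :: real)"
    by metis
  define M where "M = (\<Sum>u\<in>UNIV. \<Sum>v\<in>UNIV. N u v)"
  have M: "N u v \<le> M" for u v
  proof -
    have "N u v \<le> (\<Sum>v\<in>UNIV. N u v)" using N0 by (intro member_le_sum) auto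
    also have "\<dots> \<le> M" unfolding M_def using N0 by (intro member_le_sum sum_nonneg) auto
    finally show ?thesis .
  qed
  have M0: "0 \<le> M" using N0 M order_trans by blast
  \<comment> \<open>\<open>l0\<close> turns the sum into a gap per edge, \<open>M\<close> adds gaps
    along paths, and \<open>CARD('j)\<close> sums over pools; the extra 1 keeps the denominator
    positive.\<close>
  define c where "c = l0 / (real CARD('j) * M + 1)"
  have cpos: "0 < real CARD('j) * M + 1" using M0 by (simp add: add_nonneg_pos)
  show thesis
  proof (rule that)
    show "0 < c" using l0 cpos by (simp add: c_def)
    fix z and m :: "'i \<Rightarrow> real" assume m: "\<And>i k. (i, k) \<in> E \<Longrightarrow> m i \<le> imbalance z k"
    let ?S = "\<Sum>i\<in>UNIV. \<Sum>j\<in>UNIV. l i j * (imbalance z j - m i)"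
    have term0: "0 \<le> l i j * (imbalance z j - m i)" for i j
      using m[of i j] l_nonneg[of i j] l_pos[of i j] by (cases "l i j = 0") auto
    have S0: "0 \<le> ?S" using term0 by (intro sum_nonneg) auto
    \<comment> \<open>A potential on both sides of the graph, with value \<open>m\<close> on types
      and the imbalance on pools, so that paths can pass through types.\<close>
    define p where "p v = (case v of Inl i \<Rightarrow> m i | Inr j \<Rightarrow> imbalance z j)" for v
    have edge: "\<forall>i j. (i, j) \<in> E \<longrightarrow> \<bar>p (Inl i) - p (Inr j)\<bar> \<le> ?S / l0"
    proof (intro allI impI)
      fix i j assume e: "(i, j) \<in> E"
      have "l0 * (imbalance z j - m i) \<le> l i j * (imbalance z j - m i)"
        using l0(2)[OF e] m[OF e] by (intro mult_right_mono) auto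
      also have "\<dots> \<le> (\<Sum>j\<in>UNIV. l i j * (imbalance z j - m i))"
        using term0 by (intro member_le_sum) auto
      also have "\<dots> \<le> ?S"
        using term0 by (intro member_le_sum[where f="\<lambda>i. \<Sum>j\<in>UNIV. l i j * (imbalance z j - m i)"] sum_nonneg) auto
      finally show "\<bar>p (Inl i) - p (Inr j)\<bar> \<le> ?S / l0"
        using m[OF e] l0(1) by (simp add: p_def pos_le_divide_eq mult.commute)
    qed
    have diff: "\<bar>imbalance z j - imbalance z k\<bar> \<le> M * (?S / l0)" for j k
    proof -
      have "\<bar>imbalance z j - imbalance z k\<bar> \<le> N (Inr j) (Inr k) * (?S / l0)"
        using N[OF edge, of "Inr j" "Inr k"] by (simp add: p_def)
      also have "\<dots> \<le> M * (?S / l0)" using S0 l0(1) by (intro mult_right_mono M) auto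
      finally show ?thesis .
    qed
    have imb: "\<bar>imbalance z j\<bar> \<le> M * (?S / l0)" for j
    proof -
      let ?B = "\<Sum>k\<in>UNIV. \<beta> k"
      \<comment> \<open>Zero weighted mean: subtracting it writes one imbalance as a weighted sum of
        differences.\<close>
      have "?B * imbalance z j = (\<Sum>k\<in>UNIV. \<beta> k * (imbalance z j - imbalance z k))"
        by (simp add: right_diff_distrib sum_subtractf weighted_imbalance sum_distrib_right)
      then have "?B * \<bar>imbalance z j\<bar> = \<bar>\<Sum>k\<in>UNIV. \<beta> k * (imbalance z j - imbalance z k)\<bar>"
        using beta_sum_pos by (metis abs_mult abs_of_pos)
      also have "\<dots> \<le> (\<Sum>k\<in>UNIV. \<bar>\<beta> k * (imbalance z j - imbalance z k)\<bar>)"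
        by (rule sum_abs)
      also have "\<dots> \<le> (\<Sum>k\<in>UNIV. \<beta> k * (M * (?S / l0)))"
        unfolding abs_mult abs_of_pos[OF \<beta>_pos]
        by (intro sum_mono mult_left_mono diff less_imp_le \<beta>_pos)
      also have "\<dots> = ?B * (M * (?S / l0))" by (rule sum_distrib_right[symmetric])
      finally show ?thesis using beta_sum_pos by (simp only: mult_le_cancel_left_pos)
    qed
    have "total_imbalance z \<le> (\<Sum>j\<in>(UNIV :: 'j set). M * (?S / l0))"
      unfolding total_imbalance_def by (intro sum_mono imb)
    also have "\<dots> = real CARD('j) * M * (?S / l0)" by simp
    also have "\<dots> \<le> (real CARD('j) * M + 1) * (?S / l0)"
      using S0 l0(1) by (intro mult_right_mono) auto
    finally have "l0 * total_imbalance z \<le> (real CARD('j) * M + 1) * ?S"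
      using l0(1) by (simp add: pos_le_divide_eq mult.commute)
    then show "c * total_imbalance z \<le> ?S"
      using cpos by (simp add: c_def pos_divide_le_eq mult.commute)
  qed
qed

text \<open>The order \<open>r\<close> part of the net rates, routed arrivals against nominal
  completions, is the contraction of \<open>routing_contracts\<close>; after multiplication by the
  jump size it has order \<open>sqrt r\<close>. The fluctuation of the completion rates gives the
  product term, the jumps themselves the constant.\<close>

lemma imbalance_drift:
  obtains c C where "0 < c" "0 \<le> C" "\<And>r z a b. 0 < r \<Longrightarrow> event_rates r z a b \<Longrightarrow>
    generator a b (1 / sqrt r) V z \<le> - c * sqrt r * total_imbalance z
      + C * ((\<Sum>k\<in>UNIV. \<bar>row z k\<bar>) + total_imbalance z) * total_imbalance z + C"
proof -
  obtain c where c: "0 < c" "\<And>z m. (\<And>i k. (i, k) \<in> E \<Longrightarrow> m i \<le> imbalance z k) \<Longrightarrow>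
    c * total_imbalance z \<le> (\<Sum>i\<in>UNIV. \<Sum>j\<in>UNIV. l i j * (imbalance z j - m i))"
    by (rule routing_contracts) blast
  obtain C where C: "0 \<le> C" "\<And>z i j. supported z \<Longrightarrow>
    \<bar>z i j\<bar> \<le> C * ((\<Sum>k\<in>UNIV. \<bar>row z k\<bar>) + total_imbalance z)"
    by (rule supported_bound) blast
  define K where "K = (\<Sum>j\<in>UNIV. 1 / \<beta> j)"
  have K: "1 / \<beta> j \<le> K" for j
    unfolding K_def using \<beta>_pos by (intro member_le_sum) (auto intro: less_imp_le)
  have K0: "0 \<le> K" unfolding K_def using \<beta>_pos by (intro sum_nonneg) (auto intro: less_imp_le)
  define U where "U = (\<Sum>i\<in>UNIV. \<Sum>j\<in>UNIV. \<mu> i j)"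
  have U0: "0 \<le> U" unfolding U_def using \<mu>_nonneg by (intro sum_nonneg) auto
  define C' where "C' = 2 * U * C + rate_bound * K"
  have C': "2 * U * C \<le> C'" "rate_bound * K \<le> C'" "0 \<le> C'"
    using U0 C(1) rate_bound_nonneg K0 by (auto simp: C'_def)
  show thesis
  proof (rule that[of "2 * c" C'])
    show "0 < 2 * c" "0 \<le> C'" using c C' by auto
    fix r z a b assume r: "0 < (r :: real)" and ev: "event_rates r z a b"
    let ?D = "total_imbalance z" and ?N = "(\<Sum>k\<in>UNIV. \<bar>row z k\<bar>) + total_imbalance z"
    have N0: "0 \<le> ?N" "0 \<le> ?D" using total_imbalance_nonneg by (auto intro!: add_nonneg_nonneg sum_nonneg)
    \<comment> \<open>The mean imbalance over the pools that receive type \<open>i\<close> arrivals.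
      Load balancing puts it below the imbalance of every pool serving the type, as
      \<open>routing_contracts\<close> requires.\<close>
    define m where "m i = (\<Sum>j\<in>UNIV. a i j * imbalance z j) / (r * \<Lambda> i)" for i
    have am: "(\<Sum>j\<in>UNIV. a i j * imbalance z j) = r * \<Lambda> i * m i" for i
      using r \<Lambda>_pos[of i] by (simp add: m_def)
    have m: "m i \<le> imbalance z k" if "(i, k) \<in> E" for i k
    proof -
      have "(\<Sum>j\<in>UNIV. a i j * imbalance z j) \<le> (\<Sum>j\<in>UNIV. a i j * imbalance z k)"
      proof (rule sum_mono)
        fix j show "a i j * imbalance z j \<le> a i j * imbalance z k"
          using event_ratesD(2)[OF ev, of i j] event_ratesD(4)[OF ev, of i j k] that
          by (cases "a i j = 0") (auto intro: mult_left_mono)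
      qed
      also have "\<dots> = r * \<Lambda> i * imbalance z k"
        by (simp add: sum_distrib_right[symmetric] event_ratesD(3)[OF ev])
      finally show ?thesis using r \<Lambda>_pos[of i] by (simp add: am)
    qed
    have rowwise: "(\<Sum>j\<in>UNIV. (a i j - b i j) * (2 * imbalance z j)) =
        2 * (- r * (\<Sum>j\<in>UNIV. l i j * (imbalance z j - m i)) - sqrt r * (\<Sum>j\<in>UNIV. \<mu> i j * z i j * imbalance z j))" for i
    proof -
      have "(\<Sum>j\<in>UNIV. (a i j - b i j) * (2 * imbalance z j)) =
          (\<Sum>j\<in>UNIV. 2 * (a i j * imbalance z j) - 2 * r * (l i j * imbalance z j) - 2 * sqrt r * (\<mu> i j * z i j * imbalance z j))"
        by (intro sum.cong refl) (simp add: event_ratesD(7)[OF ev] algebra_simps)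
      also have "\<dots> = 2 * (r * \<Lambda> i * m i) - 2 * r * (\<Sum>j\<in>UNIV. l i j * imbalance z j)
          - 2 * sqrt r * (\<Sum>j\<in>UNIV. \<mu> i j * z i j * imbalance z j)"
        by (simp only: sum_subtractf sum_distrib_left[symmetric] am)
      \<comment> \<open>Since nominal flows sum to \<open>\<Lambda> i\<close>, arrivals can be
        charged to edges with the weights \<open>l i j\<close>.\<close>
      also have "r * \<Lambda> i * m i = r * (\<Sum>j\<in>UNIV. l i j * m i)"
        by (simp only: l_row[symmetric] sum_distrib_right mult.assoc)
      finally show ?thesis by (simp add: right_diff_distrib sum_subtractf mult.assoc)
    qed
    let ?X = "\<Sum>i\<in>UNIV. \<Sum>j\<in>UNIV. l i j * (imbalance z j - m i)"
    let ?Y = "\<Sum>i\<in>UNIV. \<Sum>j\<in>UNIV. \<mu> i j * z i j * imbalance z j"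
    have first: "1 / sqrt r * (\<Sum>i\<in>UNIV. \<Sum>j\<in>UNIV. (a i j - b i j) * (2 * imbalance z j)) = - 2 * sqrt r * ?X - 2 * ?Y"
    proof -
      have "(\<Sum>i\<in>UNIV. \<Sum>j\<in>UNIV. (a i j - b i j) * (2 * imbalance z j)) = 2 * (- r * ?X - sqrt r * ?Y)"
        unfolding rowwise by (simp only: sum_subtractf sum_distrib_left[symmetric])
      moreover have "r = sqrt r * sqrt r" using r by simp
      ultimately have "(\<Sum>i\<in>UNIV. \<Sum>j\<in>UNIV. (a i j - b i j) * (2 * imbalance z j)) = sqrt r * (- 2 * sqrt r * ?X - 2 * ?Y)"
        by (simp add: algebra_simps)
      then show ?thesis using r by simp
    qed
    have "\<bar>?Y\<bar> \<le> (\<Sum>i\<in>UNIV. \<Sum>j\<in>UNIV. \<bar>\<mu> i j * z i j * imbalance z j\<bar>)"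
      by (rule order_trans[OF sum_abs]) (intro sum_mono sum_abs)
    also have "\<dots> \<le> (\<Sum>i\<in>UNIV. \<Sum>j\<in>UNIV. \<mu> i j * (C * ?N * ?D))"
    proof (intro sum_mono)
      fix i j
      have "\<bar>z i j\<bar> * \<bar>imbalance z j\<bar> \<le> C * ?N * ?D"
        using C(2)[OF event_ratesD(1)[OF ev], of i j] imbalance_le_total[of z j] N0 C(1)
        by (intro mult_mono) auto
      then show "\<bar>\<mu> i j * z i j * imbalance z j\<bar> \<le> \<mu> i j * (C * ?N * ?D)"
        using \<mu>_nonneg[of i j] by (simp add: abs_mult mult.assoc mult_left_mono)
    qed
    also have "\<dots> = U * (C * ?N * ?D)" by (simp add: U_def sum_distrib_right)
    finally have Y: "- ?Y \<le> U * (C * ?N * ?D)" by linarith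
    have X: "2 * sqrt r * (c * ?D) \<le> 2 * sqrt r * ?X"
      by (intro mult_left_mono c(2)[of m z, OF m]) (use r in auto)
    have "generator a b (1 / sqrt r) V z \<le> (- 2 * sqrt r * ?X - 2 * ?Y) + rate_bound * K"
      using generator_le[OF ev, where W=V and \<tau>="1 / sqrt r" and g="\<lambda>_ j. 2 * imbalance z j" and k="\<lambda>_ j. 1 / \<beta> j"]
        V_bump second_order_le[OF ev r, of "\<lambda>_ j. 1 / \<beta> j" K] K K0 unfolding first by fastforce
    also have "\<dots> \<le> - 2 * sqrt r * (c * ?D) + 2 * (U * (C * ?N * ?D)) + C'"
      using X Y C'(2) by linarith
    also have "2 * (U * (C * ?N * ?D)) = 2 * U * C * (?N * ?D)" by simp
    also have "\<dots> \<le> C' * (?N * ?D)" using C' N0 by (intro mult_right_mono) auto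
    finally show "generator a b (1 / sqrt r) V z \<le> - (2 * c) * sqrt r * ?D + C' * ?N * ?D + C'"
      by (simp add: mult_ac)
  qed
qed

section \<open>Bounded drift of the logarithm\<close>

definition row_sq :: "('i \<Rightarrow> 'j \<Rightarrow> real) \<Rightarrow> real" where
  "row_sq z = (\<Sum>i\<in>UNIV. (row z i)\<^sup>2)"

lemma row_sq_nonneg: "0 \<le> row_sq z"
  by (simp add: row_sq_def sum_nonneg)

lemma row_le_row_sq: "(row z i)\<^sup>2 \<le> row_sq z"
  unfolding row_sq_def by (rule member_le_sum) auto

lemma row_sq_bump: "row_sq (bump z i j t) = row_sq z + 2 * t * row z i + t\<^sup>2"
proof -
  have "row_sq (bump z i j t) = (\<Sum>k\<in>UNIV. (row z k)\<^sup>2 + (if k = i then 2 * t * row z i + t\<^sup>2 else 0))"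
    unfolding row_sq_def by (intro sum.cong) (auto simp: row_bump power2_eq_square algebra_simps)
  then show ?thesis by (simp add: sum.distrib row_sq_def)
qed

text \<open>Concavity bounds the increment of the logarithm by that of \<open>row_sq\<close> divided
  by \<open>q = 1 + row_sq z\<close>. The drift of the rows is at most linear, so its product with
  \<open>row z i\<close> is of order \<open>q\<close>, up to a factor linear in the
  imbalance.\<close>

lemma log_row_drift:
  obtains C where "0 \<le> C" "\<And>r z a b. 0 < r \<Longrightarrow> event_rates r z a b \<Longrightarrow>
    generator a b (1 / sqrt r) (\<lambda>z. ln (1 + row_sq z)) z \<le> C * (1 + total_imbalance z)"
proof -
  obtain C where C: "0 \<le> C" "\<And>z i j. supported z \<Longrightarrow>
    \<bar>z i j\<bar> \<le> C * ((\<Sum>k\<in>UNIV. \<bar>row z k\<bar>) + total_imbalance z)"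
    by (rule supported_bound) blast
  define U where "U = (\<Sum>i\<in>UNIV. \<Sum>j\<in>UNIV. \<mu> i j)"
  have U0: "0 \<le> U" unfolding U_def using \<mu>_nonneg by (intro sum_nonneg) auto
  define n where "n = real CARD('i)"
  have n: "1 \<le> n" by (simp add: n_def Suc_le_eq)
  define C' where "C' = 2 * U * C * n + rate_bound"
  show thesis
  proof (rule that[of C'])
    show "0 \<le> C'" using U0 C(1) n rate_bound_nonneg by (simp add: C'_def)
    fix r z a b assume r: "0 < (r :: real)" and ev: "event_rates r z a b"
    let ?D = "total_imbalance z" and ?R = "\<Sum>k\<in>UNIV. \<bar>row z k\<bar>"
    define q where "q = 1 + row_sq z"
    have q: "1 \<le> q" using row_sq_nonneg by (simp add: q_def)
    have D0: "0 \<le> ?D" by (rule total_imbalance_nonneg)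
    have step: "ln (1 + row_sq (bump z i j t)) - ln (1 + row_sq z) \<le> t * (2 * row z i / q) + t\<^sup>2 * 1" for i j t
    proof -
      let ?q = "1 + row_sq (bump z i j t)"
      have qpos: "1 \<le> ?q" using row_sq_nonneg by simp
      have "ln ?q - ln q = ln (?q / q)" using q qpos by (simp add: ln_div)
      also have "\<dots> \<le> ?q / q - 1" using q qpos by (intro ln_le_minus_one) auto
      also have "\<dots> = (2 * t * row z i + t\<^sup>2) / q"
        using q by (simp add: row_sq_bump q_def field_simps)
      also have "\<dots> = t * (2 * row z i / q) + t\<^sup>2 / q" by (simp add: add_divide_distrib)
      also have "t\<^sup>2 / q \<le> t\<^sup>2" using q by (simp add: divide_le_eq mult_le_cancel_left1)
      finally show ?thesis by (simp add: q_def)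
    qed
    have abs_prod: "\<bar>row z i\<bar> * \<bar>row z k\<bar> \<le> q" for i k
    proof -
      have "2 * (\<bar>row z i\<bar> * \<bar>row z k\<bar>) \<le> (row z i)\<^sup>2 + (row z k)\<^sup>2"
        using sum_squares_bound[of "\<bar>row z i\<bar>" "\<bar>row z k\<bar>"] by simp
      then show ?thesis using row_le_row_sq[of z i] row_le_row_sq[of z k] unfolding q_def by linarith
    qed
    have abs1: "\<bar>row z i\<bar> \<le> q" for i
    proof -
      have "2 * \<bar>row z i\<bar> \<le> 1 + (row z i)\<^sup>2"
        using sum_squares_bound[of 1 "\<bar>row z i\<bar>"] by simp
      then show ?thesis using row_le_row_sq[of z i] row_sq_nonneg[of z] unfolding q_def by linarith
    qed
    have rowR: "\<bar>row z i\<bar> * (?R + ?D) \<le> q * (n * (1 + ?D))" for i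
    proof -
      have "\<bar>row z i\<bar> * ?R \<le> (\<Sum>k\<in>(UNIV :: 'i set). q)"
        unfolding sum_distrib_left by (intro sum_mono abs_prod)
      then have "\<bar>row z i\<bar> * ?R \<le> q * n" by (simp add: n_def mult.commute)
      moreover have "\<bar>row z i\<bar> * ?D \<le> q * ?D" by (intro mult_right_mono abs1 D0)
      moreover have "q * ?D \<le> q * (n * ?D)" using n D0 q by (intro mult_left_mono) (simp_all add: mult_le_cancel_right1)
      ultimately show ?thesis by (simp add: distrib_left)
    qed
    have F: "2 * row z i / q * - (\<Sum>j\<in>UNIV. \<mu> i j * z i j) \<le> (\<Sum>j\<in>UNIV. \<mu> i j) * (2 * C * (n * (1 + ?D)))" for i
    proof -
      have "\<bar>\<Sum>j\<in>UNIV. \<mu> i j * z i j\<bar> \<le> (\<Sum>j\<in>UNIV. \<mu> i j * (C * (?R + ?D)))"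
        using C(2)[OF event_ratesD(1)[OF ev]] \<mu>_nonneg
        by (intro order_trans[OF sum_abs] sum_mono) (simp add: abs_mult mult_left_mono)
      also have "\<dots> = (\<Sum>j\<in>UNIV. \<mu> i j) * (C * (?R + ?D))" by (simp add: sum_distrib_right)
      finally have "\<bar>row z i\<bar> * \<bar>\<Sum>j\<in>UNIV. \<mu> i j * z i j\<bar> \<le> \<bar>row z i\<bar> * ((\<Sum>j\<in>UNIV. \<mu> i j) * (C * (?R + ?D)))"
        by (intro mult_left_mono) auto
      also have "\<dots> = (\<Sum>j\<in>UNIV. \<mu> i j) * C * (\<bar>row z i\<bar> * (?R + ?D))" by simp
      also have "\<dots> \<le> (\<Sum>j\<in>UNIV. \<mu> i j) * C * (q * (n * (1 + ?D)))"
        using C(1) \<mu>_nonneg by (intro mult_left_mono rowR mult_nonneg_nonneg sum_nonneg) auto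
      finally have "\<bar>row z i\<bar> * \<bar>\<Sum>j\<in>UNIV. \<mu> i j * z i j\<bar> / q \<le> (\<Sum>j\<in>UNIV. \<mu> i j) * C * (n * (1 + ?D))"
        using q by (simp add: pos_divide_le_eq mult_ac)
      moreover have "2 * row z i / q * - (\<Sum>j\<in>UNIV. \<mu> i j * z i j) \<le> 2 * (\<bar>row z i\<bar> * \<bar>\<Sum>j\<in>UNIV. \<mu> i j * z i j\<bar> / q)"
      proof -
        have "2 * row z i / q * - (\<Sum>j\<in>UNIV. \<mu> i j * z i j) \<le> \<bar>2 * row z i / q * - (\<Sum>j\<in>UNIV. \<mu> i j * z i j)\<bar>"
          by (rule abs_ge_self)
        also have "\<dots> = 2 * (\<bar>row z i\<bar> * \<bar>\<Sum>j\<in>UNIV. \<mu> i j * z i j\<bar> / q)" using q by (simp add: abs_mult)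
        finally show ?thesis .
      qed
      ultimately have "2 * row z i / q * - (\<Sum>j\<in>UNIV. \<mu> i j * z i j) \<le> 2 * ((\<Sum>j\<in>UNIV. \<mu> i j) * C * (n * (1 + ?D)))"
        by linarith
      then show ?thesis by (simp only: mult_ac)
    qed
    have "generator a b (1 / sqrt r) (\<lambda>z. ln (1 + row_sq z)) z
        \<le> (\<Sum>i\<in>UNIV. 2 * row z i / q * - (\<Sum>j\<in>UNIV. \<mu> i j * z i j)) + rate_bound * 1"
      using generator_le[OF ev, where W="\<lambda>z. ln (1 + row_sq z)" and \<tau>="1 / sqrt r" and g="\<lambda>i _. 2 * row z i / q" and k="\<lambda>_ _. 1"]
        step second_order_le[OF ev r, of "\<lambda>_ _. 1" 1] row_drift[OF ev r, of "\<lambda>i. 2 * row z i / q"] by fastforce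
    also have "\<dots> \<le> (\<Sum>i\<in>UNIV. (\<Sum>j\<in>UNIV. \<mu> i j) * (2 * C * (n * (1 + ?D)))) + rate_bound"
      using F by (simp add: sum_mono)
    also have "\<dots> = U * (2 * C * (n * (1 + ?D))) + rate_bound" by (simp add: U_def sum_distrib_right)
    also have "\<dots> \<le> U * (2 * C * (n * (1 + ?D))) + rate_bound * (1 + ?D)"
      using rate_bound_nonneg D0 by (simp add: mult_le_cancel_left1)
    also have "\<dots> = C' * (1 + ?D)" by (simp add: C'_def algebra_simps)
    finally show "generator a b (1 / sqrt r) (\<lambda>z. ln (1 + row_sq z)) z \<le> C' * (1 + ?D)" .
  qed
qed

end

subsection \<open>Drift along the unstable mode\<close>

context network
begin

text \<open>The squared modulus of the complex coordinate of the row sums with real part along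
  \<open>u\<close> and imaginary part along \<open>v\<close>.\<close>

definition mode_sq :: "('i \<Rightarrow> real) \<Rightarrow> ('i \<Rightarrow> real) \<Rightarrow> ('i \<Rightarrow> 'j \<Rightarrow> real) \<Rightarrow> real" where
  "mode_sq u v z = (\<Sum>i\<in>UNIV. u i * row z i)\<^sup>2 + (\<Sum>i\<in>UNIV. v i * row z i)\<^sup>2"

lemma mode_sq_nonneg: "0 \<le> mode_sq u v z"
  by (simp add: mode_sq_def)

lemma mode_sq_bump:
  "mode_sq u v (bump z i j t) = mode_sq u v z
     + t * (2 * ((\<Sum>i\<in>UNIV. u i * row z i) * u i + (\<Sum>i\<in>UNIV. v i * row z i) * v i))
     + t\<^sup>2 * ((u i)\<^sup>2 + (v i)\<^sup>2)"
proof -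
  have lin: "(\<Sum>k\<in>UNIV. w k * row (bump z i j t) k) = (\<Sum>k\<in>UNIV. w k * row z k) + t * w i" for w
  proof -
    have "(\<Sum>k\<in>UNIV. w k * row (bump z i j t) k) = (\<Sum>k\<in>UNIV. w k * row z k + (if k = i then t * w k else 0))"
      by (intro sum.cong) (auto simp: row_bump algebra_simps)
    then show ?thesis by (simp add: sum.distrib)
  qed
  show ?thesis unfolding mode_sq_def lin by (simp add: power2_eq_square algebra_simps)
qed

text \<open>The remainder of the expansion is exactly
  \<open>e\<^sup>2 / x\<^sup>2 / (x + e)\<close>, and its last denominator is at least 1.\<close>

lemma reciprocal_second_order:
  fixes x e :: real
  assumes "0 < x" "1 \<le> x + e"
  shows "1 / (x + e) \<le> 1 / x - e / x\<^sup>2 + e\<^sup>2 / x\<^sup>2"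
proof -
  have "1 / (x + e) = 1 / x - e / x\<^sup>2 + e\<^sup>2 / x\<^sup>2 / (x + e)"
  proof -
    define y where "y = x + e"
    then have e: "e = y - x" and "0 < y" using assms by auto
    then show ?thesis unfolding y_def[symmetric] e
      using assms(1) by (simp add: field_simps power2_eq_square)
  qed
  moreover have "e\<^sup>2 / x\<^sup>2 / (x + e) \<le> e\<^sup>2 / x\<^sup>2"
    using assms by (simp add: divide_le_eq mult_le_cancel_left1)
  ultimately show ?thesis by simp
qed

lemma cauchy_schwarz_2: "((p :: real) * a + q * b)\<^sup>2 \<le> (p\<^sup>2 + q\<^sup>2) * (a\<^sup>2 + b\<^sup>2)"
proof -
  have "(p\<^sup>2 + q\<^sup>2) * (a\<^sup>2 + b\<^sup>2) - (p * a + q * b)\<^sup>2 = (p * b - q * a)\<^sup>2"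
    by (simp add: power2_eq_square algebra_simps)
  then show ?thesis by (metis diff_ge_0_iff_ge zero_le_power2)
qed

text \<open>
  The first-order part of the bound is exact and the negative \<open>- 1\<close> in the second-order part is the noise
  that drives \<open>Z\<close> away from \<open>0\<close>; the positive remainder \<open>8 * a * |Z|\<^sup>2\<close> is beaten by the unstable drift
  for small \<open>a\<close>.
\<close>

lemma reciprocal_mode_bump:
  assumes a: "0 < a" and t: "t\<^sup>2 = \<tau>\<^sup>2" and K: "(u i)\<^sup>2 + (v i)\<^sup>2 \<le> K"
  shows "1 / (1 + a * mode_sq u v (bump z i j t)) - 1 / (1 + a * mode_sq u v z) \<le>
    t * (- (a / (1 + a * mode_sq u v z)\<^sup>2) *
      (2 * ((\<Sum>i\<in>UNIV. u i * row z i) * u i + (\<Sum>i\<in>UNIV. v i * row z i) * v i)))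
    + t\<^sup>2 * (a / (1 + a * mode_sq u v z)\<^sup>2 * (8 * a * mode_sq u v z + 2 * a * \<tau>\<^sup>2 * K - 1) * ((u i)\<^sup>2 + (v i)\<^sup>2))"
proof -
  define p where "p = (\<Sum>i\<in>UNIV. u i * row z i)"
  define q where "q = (\<Sum>i\<in>UNIV. v i * row z i)"
  define s where "s = mode_sq u v z"
  define g where "g = 2 * (p * u i + q * v i)"
  define c where "c = (u i)\<^sup>2 + (v i)\<^sup>2"
  define x where "x = 1 + a * s"
  define \<Delta> where "\<Delta> = t * g + t\<^sup>2 * c"
  have c0: "0 \<le> c" by (simp add: c_def)
  have s: "s = p\<^sup>2 + q\<^sup>2" by (simp add: s_def mode_sq_def p_def q_def)
  have x0: "0 < x" using a mode_sq_nonneg[of u v z] by (simp add: x_def s_def add_pos_nonneg)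
  have bump: "1 + a * mode_sq u v (bump z i j t) = x + a * \<Delta>"
    by (simp add: mode_sq_bump x_def s_def \<Delta>_def g_def c_def p_def q_def distrib_left)
  have "1 \<le> x + a * \<Delta>"
    unfolding bump[symmetric] using a mode_sq_nonneg by simp
  from reciprocal_second_order[OF x0 this]
  have *: "1 / (x + a * \<Delta>) - 1 / x \<le> a / x\<^sup>2 * (- \<Delta> + a * \<Delta>\<^sup>2)"
    using x0 by (simp add: power_mult_distrib algebra_simps power2_eq_square)
  have "g\<^sup>2 = 4 * (p * u i + q * v i)\<^sup>2" unfolding g_def power_mult_distrib by simp
  then have "g\<^sup>2 \<le> 4 * (s * c)"
    using cauchy_schwarz_2[of p "u i" q "v i"] unfolding s c_def by linarith
  then have g2: "t\<^sup>2 * g\<^sup>2 \<le> t\<^sup>2 * (4 * (s * c))" by (intro mult_left_mono) auto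
  have "c * c \<le> K * c" using K c0 by (intro mult_right_mono) (auto simp: c_def)
  then have c2: "t\<^sup>2 * t\<^sup>2 * (c * c) \<le> t\<^sup>2 * t\<^sup>2 * (K * c)" by (intro mult_left_mono) auto
  have "0 \<le> (t * g - t\<^sup>2 * c)\<^sup>2" by simp
  then have "\<Delta>\<^sup>2 \<le> 2 * (t\<^sup>2 * g\<^sup>2) + 2 * (t\<^sup>2 * t\<^sup>2 * (c * c))"
    by (simp add: \<Delta>_def power2_eq_square algebra_simps)
  \<comment> \<open>The 8 is twice the 4 of the bound for \<open>g\<^sup>2\<close>; the other
    summand uses \<open>c * c \<le> K * c\<close>.\<close>
  also have "\<dots> \<le> t\<^sup>2 * (8 * s + 2 * \<tau>\<^sup>2 * K) * c"
    using g2 c2 unfolding t by (simp add: algebra_simps)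
  finally have "- \<Delta> + a * \<Delta>\<^sup>2 \<le> - \<Delta> + a * (t\<^sup>2 * (8 * s + 2 * \<tau>\<^sup>2 * K) * c)"
    using a by simp
  then have "a / x\<^sup>2 * (- \<Delta> + a * \<Delta>\<^sup>2) \<le> a / x\<^sup>2 * (- \<Delta> + a * (t\<^sup>2 * (8 * s + 2 * \<tau>\<^sup>2 * K) * c))"
    using a by (intro mult_left_mono) auto
  also have "\<dots> = t * (- (a / x\<^sup>2) * g) + t\<^sup>2 * (a / x\<^sup>2 * (8 * a * s + 2 * a * \<tau>\<^sup>2 * K - 1) * c)"
    by (simp add: \<Delta>_def algebra_simps add_divide_distrib diff_divide_distrib)
  finally show ?thesis
    using * unfolding bump by (simp add: x_def s_def g_def c_def p_def q_def)
qed

text \<open>In the drift, common factor \<open>A\<close> aside, the unstable mode contributes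
  \<open>- 2 * \<alpha> * s\<close>. The second-order remainder is at most
  \<open>8 * \<theta> * R * s\<close>, which a small \<open>\<theta>\<close> absorbs, leaving minus
  half the noise.\<close>

lemma unstable_mode_drift:
  assumes \<alpha>: "0 < \<alpha>" and nz: "\<exists>i. u i \<noteq> 0 \<or> v i \<noteq> 0"
    and u: "\<And>y. (\<Sum>i\<in>UNIV. u i * (A_u \<beta> \<mu> E *v y) $ i) = \<alpha> * (\<Sum>i\<in>UNIV. u i * y $ i) - \<gamma> * (\<Sum>i\<in>UNIV. v i * y $ i)"
    and v: "\<And>y. (\<Sum>i\<in>UNIV. v i * (A_u \<beta> \<mu> E *v y) $ i) = \<alpha> * (\<Sum>i\<in>UNIV. v i * y $ i) + \<gamma> * (\<Sum>i\<in>UNIV. u i * y $ i)"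
  obtains \<theta> C \<sigma> r0 where "0 < \<theta>" "0 \<le> C" "0 < \<sigma>" "0 < r0"
    "\<And>r z a b. r0 \<le> r \<Longrightarrow> event_rates r z a b \<Longrightarrow>
      generator a b (1 / sqrt r) (\<lambda>z. 1 / (1 + \<theta> * mode_sq u v z)) z
        \<le> C * total_imbalance z - \<sigma> / (1 + \<theta> * mode_sq u v z)\<^sup>2"
proof -
  obtain C0 where C0: "0 \<le> C0" "\<And>z i. supported z \<Longrightarrow>
    \<bar>- (\<Sum>j\<in>UNIV. \<mu> i j * z i j) - (A_u \<beta> \<mu> E *v (\<chi> k. row z k)) $ i\<bar> \<le> C0 * total_imbalance z"
    by (rule linear_drift_bound) blast
  define c where "c i = (u i)\<^sup>2 + (v i)\<^sup>2" for i
  have c0: "0 \<le> c i" for i by (simp add: c_def)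
  define K where "K = (\<Sum>i\<in>UNIV. c i)"
  have cK: "c i \<le> K" for i unfolding K_def using c0 by (intro member_le_sum) auto
  have K0: "0 \<le> K" unfolding K_def using c0 by (intro sum_nonneg) auto
  \<comment> \<open>Noise along the mode from arrivals alone: their total rate per type is known
    exactly and positive, however they are routed.\<close>
  define \<sigma> where "\<sigma> = (\<Sum>i\<in>UNIV. \<Lambda> i * c i)"
  have \<sigma>: "0 < \<sigma>"
  proof -
    from nz obtain i where "0 < c i" by (auto simp: c_def sum_power2_gt_zero_iff)
    then have "0 < \<Lambda> i * c i" using \<Lambda>_pos by simp
    also have "\<dots> \<le> \<sigma>" unfolding \<sigma>_def using c0 \<Lambda>_pos by (intro member_le_sum) (auto intro: mult_nonneg_nonneg less_imp_le)
    finally show ?thesis .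
  qed
  define M where "M = (\<Sum>i\<in>UNIV. \<bar>u i\<bar> + \<bar>v i\<bar>)"
  have M0: "0 \<le> M" unfolding M_def by (intro sum_nonneg) auto
  define C where "C = 2 * M * C0"
  define R where "R = rate_bound * K"
  have R0: "0 \<le> R" using rate_bound_nonneg K0 by (simp add: R_def)
  \<comment> \<open>The second bound gives \<open>8 * \<theta> * R \<le> 2 * \<alpha>\<close>; the
    bound by 1 serves the estimates of \<open>w\<close> and \<open>Apq\<close>.\<close>
  define \<theta> where "\<theta> = min 1 (\<alpha> / (4 * R + 1))"
  have \<theta>: "0 < \<theta>" "\<theta> \<le> 1" using \<alpha> R0 by (auto simp: \<theta>_def)
  have \<theta>R: "8 * \<theta> * R \<le> 2 * \<alpha>"
  proof -
    have "\<theta> * (4 * R + 1) \<le> \<alpha>" using R0 by (simp add: pos_le_divide_eq[symmetric] \<theta>_def)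
    then show ?thesis using \<theta> by (simp add: algebra_simps)
  qed
  show thesis
  \<comment> \<open>From \<open>4 * K + 1\<close> on, the jump-size correction
    \<open>2 * \<theta> * K / r\<close> is at most 1/2, so half of the noise term -1
    survives.\<close>
  proof (rule that[of \<theta> C "\<theta> * \<sigma> / 2" "4 * K + 1"])
    show "0 < \<theta>" "0 \<le> C" "0 < \<theta> * \<sigma> / 2" "0 < 4 * K + 1"
      using \<theta> \<sigma> C0 M0 K0 by (auto simp: C_def)
    fix r z a b assume rK: "4 * K + 1 \<le> r" and ev: "event_rates r z a b"
    have r: "0 < r" using rK K0 by simp
    define p where "p = (\<Sum>i\<in>UNIV. u i * row z i)"
    define q where "q = (\<Sum>i\<in>UNIV. v i * row z i)"
    define s where "s = mode_sq u v z"
    define D where "D = total_imbalance z"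
    define g where "g i = 2 * (p * u i + q * v i)" for i
    define A where "A = \<theta> / (1 + \<theta> * s)\<^sup>2"
    define F where "F i = - (\<Sum>j\<in>UNIV. \<mu> i j * z i j)" for i
    define x where "x = 1 + \<theta> * s"
    have D0: "0 \<le> D" unfolding D_def by (rule total_imbalance_nonneg)
    have s: "s = p\<^sup>2 + q\<^sup>2" by (simp add: s_def mode_sq_def p_def q_def)
    then have s0: "0 \<le> s" by simp
    have x1: "1 \<le> x" using s0 \<theta> by (simp add: x_def)
    have A: "A = \<theta> / x\<^sup>2" "0 \<le> A" using \<theta> by (auto simp: A_def x_def)
    let ?S = "(1 / sqrt r)\<^sup>2 * (\<Sum>i\<in>UNIV. \<Sum>j\<in>UNIV. (a i j + b i j) * c i)"
    let ?w = "8 * \<theta> * s + 2 * \<theta> * (1 / sqrt r)\<^sup>2 * K - 1"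
    have S_le: "?S \<le> R" unfolding R_def by (rule second_order_le[OF ev r cK K0])
    have S_ge: "\<sigma> \<le> ?S"
    proof -
      have "r * \<sigma> = (\<Sum>i\<in>UNIV. \<Sum>j\<in>UNIV. a i j * c i)"
        by (simp add: \<sigma>_def sum_distrib_right[symmetric] event_ratesD(3)[OF ev] sum_distrib_left mult.assoc)
      also have "\<dots> \<le> (\<Sum>i\<in>UNIV. \<Sum>j\<in>UNIV. (a i j + b i j) * c i)"
        using c0 event_ratesD(5)[OF ev] by (intro sum_mono mult_right_mono) auto
      finally show ?thesis using r by (simp add: power_divide pos_le_divide_eq mult.commute)
    qed
    have w: "?w \<le> 8 * \<theta> * s - 1 / 2"
    proof -
      have "K / r \<le> 1 / 4" using rK r by (simp add: pos_divide_le_eq)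
      then have "\<theta> * (K / r) \<le> 1 * (1 / 4)" using \<theta> K0 r by (intro mult_mono) auto
      moreover have "2 * \<theta> * (1 / sqrt r)\<^sup>2 * K = 2 * (\<theta> * (K / r))"
        using r by (simp add: power_divide)
      ultimately show ?thesis by linarith
    qed
    have err: "- (\<Sum>i\<in>UNIV. g i * F i) \<le> C * (\<bar>p\<bar> + \<bar>q\<bar>) * D - 2 * \<alpha> * s"
    proof -
      define Y where "Y i = (A_u \<beta> \<mu> E *v (\<chi> k. row z k)) $ i" for i
      have "(\<Sum>i\<in>UNIV. g i * Y i) = (\<Sum>i\<in>UNIV. 2 * p * (u i * Y i) + 2 * q * (v i * Y i))"
        by (intro sum.cong refl) (simp add: g_def algebra_simps)
      also have "\<dots> = 2 * p * (\<Sum>i\<in>UNIV. u i * Y i) + 2 * q * (\<Sum>i\<in>UNIV. v i * Y i)"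
        by (simp only: sum.distrib sum_distrib_left)
      also have "\<dots> = 2 * p * (\<alpha> * p - \<gamma> * q) + 2 * q * (\<alpha> * q + \<gamma> * p)"
        using u[of "\<chi> k. row z k"] v[of "\<chi> k. row z k"] by (simp add: Y_def p_def q_def)
      \<comment> \<open>The terms with \<open>\<gamma>\<close> cancel: rotation does not change the
        modulus.\<close>
      also have "\<dots> = 2 * \<alpha> * s" by (simp add: s power2_eq_square algebra_simps)
      finally have lin: "(\<Sum>i\<in>UNIV. g i * Y i) = 2 * \<alpha> * s" .
      have "\<bar>\<Sum>i\<in>UNIV. g i * (F i - Y i)\<bar> \<le> (\<Sum>i\<in>UNIV. 2 * (\<bar>u i\<bar> + \<bar>v i\<bar>) * ((\<bar>p\<bar> + \<bar>q\<bar>) * (C0 * D)))"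
      proof (rule order_trans[OF sum_abs], rule sum_mono)
        fix i
        have "\<bar>F i - Y i\<bar> \<le> C0 * D"
          using C0(2)[OF event_ratesD(1)[OF ev], of i] by (simp add: F_def Y_def D_def)
        moreover have "\<bar>g i\<bar> \<le> 2 * (\<bar>p\<bar> * \<bar>u i\<bar> + \<bar>q\<bar> * \<bar>v i\<bar>)"
          unfolding g_def abs_mult[symmetric] by (simp add: abs_triangle_ineq)
        moreover have "\<bar>p\<bar> * \<bar>u i\<bar> + \<bar>q\<bar> * \<bar>v i\<bar> \<le> (\<bar>u i\<bar> + \<bar>v i\<bar>) * (\<bar>p\<bar> + \<bar>q\<bar>)"
          by (simp add: algebra_simps)
        ultimately have "\<bar>g i\<bar> * \<bar>F i - Y i\<bar> \<le> 2 * ((\<bar>u i\<bar> + \<bar>v i\<bar>) * (\<bar>p\<bar> + \<bar>q\<bar>)) * (C0 * D)"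
          by (intro mult_mono) auto
        then show "\<bar>g i * (F i - Y i)\<bar> \<le> 2 * (\<bar>u i\<bar> + \<bar>v i\<bar>) * ((\<bar>p\<bar> + \<bar>q\<bar>) * (C0 * D))"
          by (simp only: abs_mult mult_ac)
      qed
      also have "\<dots> = 2 * M * ((\<bar>p\<bar> + \<bar>q\<bar>) * (C0 * D))"
        by (simp only: M_def sum_distrib_right[symmetric] sum_distrib_left[symmetric])
      also have "\<dots> = C * (\<bar>p\<bar> + \<bar>q\<bar>) * D" by (simp add: C_def)
      finally have "- (\<Sum>i\<in>UNIV. g i * (F i - Y i)) \<le> C * (\<bar>p\<bar> + \<bar>q\<bar>) * D" by linarith
      moreover have "(\<Sum>i\<in>UNIV. g i * (F i - Y i)) = (\<Sum>i\<in>UNIV. g i * F i) - 2 * \<alpha> * s"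
        by (simp add: right_diff_distrib sum_subtractf lin)
      ultimately show ?thesis by linarith
    qed
    \<comment> \<open>The imbalance error grows linearly in the mode, but the derivative of the
      reciprocal decays faster, so the error stays bounded by a multiple of the imbalance.\<close>
    have Apq: "A * (\<bar>p\<bar> + \<bar>q\<bar>) \<le> 1"
    proof -
      have "2 * \<bar>p\<bar> \<le> 1 + p\<^sup>2" and "2 * \<bar>q\<bar> \<le> 1 + q\<^sup>2"
        using sum_squares_bound[of 1 "\<bar>p\<bar>"] sum_squares_bound[of 1 "\<bar>q\<bar>"] by simp_all
      from add_mono[OF this] have "2 * (\<bar>p\<bar> + \<bar>q\<bar>) \<le> 2 + s" by (simp add: s)
      then have "\<theta> * (2 * (\<bar>p\<bar> + \<bar>q\<bar>)) \<le> \<theta> * (2 + s)" using \<theta> by (intro mult_left_mono) auto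
      also have "\<dots> \<le> 2 * x"
      proof -
        have "0 \<le> \<theta> * s" using \<theta> s0 by simp
        then show ?thesis using \<theta>(2) unfolding x_def distrib_left by linarith
      qed
      also have "\<dots> \<le> 2 * x\<^sup>2" using x1 by (simp add: power2_eq_square mult_le_cancel_left1)
      finally have "\<theta> * (\<bar>p\<bar> + \<bar>q\<bar>) \<le> x\<^sup>2"
        unfolding mult.left_commute[of \<theta> 2] by (rule mult_left_le_imp_le) simp
      then show ?thesis using x1 by (simp add: A(1) pos_divide_le_eq)
    qed
    have "generator a b (1 / sqrt r) (\<lambda>z. 1 / (1 + \<theta> * mode_sq u v z)) z
      \<le> 1 / sqrt r * (\<Sum>i\<in>UNIV. \<Sum>j\<in>UNIV. (a i j - b i j) * (- A * g i))
        + (1 / sqrt r)\<^sup>2 * (\<Sum>i\<in>UNIV. \<Sum>j\<in>UNIV. (a i j + b i j) * (A * ?w * c i))"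
      unfolding A_def g_def c_def p_def q_def s_def
      by (rule generator_le[OF ev], rule reciprocal_mode_bump[OF \<theta>(1)])
         (use cK in \<open>auto simp: c_def\<close>)
    also have "1 / sqrt r * (\<Sum>i\<in>UNIV. \<Sum>j\<in>UNIV. (a i j - b i j) * (- A * g i)) = A * - (\<Sum>i\<in>UNIV. g i * F i)"
      by (subst row_drift[OF ev r]) (simp add: F_def sum_distrib_left sum_negf mult.assoc)
    also have "(1 / sqrt r)\<^sup>2 * (\<Sum>i\<in>UNIV. \<Sum>j\<in>UNIV. (a i j + b i j) * (A * ?w * c i)) = A * (?w * ?S)"
    proof -
      have "(\<Sum>i\<in>UNIV. \<Sum>j\<in>UNIV. (a i j + b i j) * (A * k * c i)) =
          A * k * (\<Sum>i\<in>UNIV. \<Sum>j\<in>UNIV. (a i j + b i j) * c i)" for k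
        by (simp add: sum_distrib_left mult_ac)
      then have "(1 / sqrt r)\<^sup>2 * (\<Sum>i\<in>UNIV. \<Sum>j\<in>UNIV. (a i j + b i j) * (A * ?w * c i)) =
          (1 / sqrt r)\<^sup>2 * (A * ?w * (\<Sum>i\<in>UNIV. \<Sum>j\<in>UNIV. (a i j + b i j) * c i))"
        by (simp only:)
      also have "\<dots> = A * (?w * ?S)" by (simp only: mult_ac)
      finally show ?thesis .
    qed
    also have "A * - (\<Sum>i\<in>UNIV. g i * F i) + A * (?w * ?S) \<le>
        A * (C * (\<bar>p\<bar> + \<bar>q\<bar>) * D - 2 * \<alpha> * s) + A * (2 * \<alpha> * s - \<sigma> / 2)"
    proof (intro add_mono mult_left_mono err A)
      have "?w * ?S \<le> (8 * \<theta> * s - 1 / 2) * ?S" using w S_ge \<sigma> by (intro mult_right_mono) auto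
      also have "\<dots> = 8 * \<theta> * s * ?S - ?S / 2" by (simp add: left_diff_distrib)
      also have "8 * \<theta> * s * ?S \<le> 8 * \<theta> * s * R" using \<theta> s0 S_le by (intro mult_left_mono) auto
      also have "\<dots> = (8 * \<theta> * R) * s" by simp
      also have "\<dots> \<le> 2 * \<alpha> * s" using \<theta>R s0 by (intro mult_right_mono) auto
      finally show "?w * ?S \<le> 2 * \<alpha> * s - \<sigma> / 2" using S_ge by linarith
    qed
    also have "\<dots> = A * (\<bar>p\<bar> + \<bar>q\<bar>) * (C * D) - A * (\<sigma> / 2)" by (simp add: algebra_simps)
    also have "\<dots> \<le> 1 * (C * D) - A * (\<sigma> / 2)"
      using Apq C0 M0 D0 by (intro diff_right_mono mult_right_mono) (auto simp: C_def)
    finally show "generator a b (1 / sqrt r) (\<lambda>z. 1 / (1 + \<theta> * mode_sq u v z)) z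
        \<le> C * total_imbalance z - \<theta> * \<sigma> / 2 / (1 + \<theta> * mode_sq u v z)\<^sup>2"
      by (simp add: A(1) D_def x_def s_def)
  qed
qed

section \<open>The combined Lyapunov function\<close>

text \<open>The factor 1/2 keeps the last term at most 1/2 for positive \<open>\<theta>\<close>, so
  that on a fixed ball a small \<open>\<epsilon>\<close> brings the value below the cut level
  1.\<close>

definition lyapunov :: "real \<Rightarrow> real \<Rightarrow> ('i \<Rightarrow> real) \<Rightarrow> ('i \<Rightarrow> real) \<Rightarrow> ('i \<Rightarrow> 'j \<Rightarrow> real) \<Rightarrow> real" where
  "lyapunov \<epsilon> \<theta> u v z = \<epsilon> * V z + \<epsilon> * ln (1 + row_sq z) + 1 / 2 * (1 / (1 + \<theta> * mode_sq u v z))"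

lemma V_nonneg: "0 \<le> V z"
  unfolding V_def using \<beta>_pos by (intro sum_nonneg mult_nonneg_nonneg) (auto intro: less_imp_le)

lemma generator_lyapunov:
  "generator a b \<tau> (lyapunov \<epsilon> \<theta> u v) z = \<epsilon> * generator a b \<tau> V z
    + \<epsilon> * generator a b \<tau> (\<lambda>z. ln (1 + row_sq z)) z
    + 1 / 2 * generator a b \<tau> (\<lambda>z. 1 / (1 + \<theta> * mode_sq u v z)) z"
proof -
  have add: "generator a b \<tau> (\<lambda>z. f z + g z) z = generator a b \<tau> f z + generator a b \<tau> g z" for f g
    by (simp add: generator_def distrib_left right_diff_distrib sum.distrib sum_subtractf)
  have scale: "generator a b \<tau> (\<lambda>z. c * f z) z = c * generator a b \<tau> f z" for c f
    by (simp add: generator_def right_diff_distrib sum_distrib_left sum_subtractf mult_ac distrib_left)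
  show ?thesis unfolding lyapunov_def[abs_def] add scale ..
qed

text \<open>All three summands are nonnegative, so each of the first two is below 1 on the sublevel
  set. The resulting bound explodes as \<open>\<epsilon>\<close> tends to 0, which is harmless since
  \<open>r\<close> is chosen afterwards.\<close>

lemma lyapunov_sublevel_bounded:
  assumes \<epsilon>: "0 < \<epsilon>" and \<theta>: "0 < \<theta>"
  obtains B where "\<And>z. lyapunov \<epsilon> \<theta> u v z < 1 \<Longrightarrow> (\<Sum>k\<in>UNIV. \<bar>row z k\<bar>) + total_imbalance z \<le> B"
proof (rule that)
  fix z assume less: "lyapunov \<epsilon> \<theta> u v z < 1"
  have ln0: "0 \<le> ln (1 + row_sq z)" using row_sq_nonneg[of z] by simp
  have h0: "0 \<le> 1 / (1 + \<theta> * mode_sq u v z)" using \<theta> mode_sq_nonneg by simp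
  have "0 \<le> \<epsilon> * V z" "0 \<le> \<epsilon> * ln (1 + row_sq z)" using \<epsilon> V_nonneg ln0 by simp_all
  with less h0 have Vl: "\<epsilon> * V z < 1" and Ll: "\<epsilon> * ln (1 + row_sq z) < 1"
    unfolding lyapunov_def by linarith+
  have "ln (1 + row_sq z) < 1 / \<epsilon>" using Ll \<epsilon> by (simp add: pos_less_divide_eq mult.commute)
  then have "exp (ln (1 + row_sq z)) < exp (1 / \<epsilon>)" by simp
  then have "1 + row_sq z < exp (1 / \<epsilon>)" using row_sq_nonneg[of z] by simp
  moreover have "\<bar>row z k\<bar> \<le> 1 + (row z k)\<^sup>2" for k
    using sum_squares_bound[of 1 "\<bar>row z k\<bar>"] by simp
  ultimately have "\<bar>row z k\<bar> \<le> exp (1 / \<epsilon>)" for k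
    using row_le_row_sq[of z k] by (meson add_left_mono less_imp_le order_trans)
  moreover have "\<bar>imbalance z j\<bar> \<le> 1 + 1 / (\<epsilon> * \<beta> j)" for j
  proof -
    have "\<beta> j * (imbalance z j)\<^sup>2 \<le> V z"
      unfolding V_def using \<beta>_pos by (intro member_le_sum) (simp_all add: less_imp_le)
    then have "\<epsilon> * (\<beta> j * (imbalance z j)\<^sup>2) \<le> \<epsilon> * V z" using \<epsilon> by (intro mult_left_mono) auto
    then have "\<epsilon> * (\<beta> j * (imbalance z j)\<^sup>2) \<le> 1" using Vl by linarith
    then have "(imbalance z j)\<^sup>2 \<le> 1 / (\<epsilon> * \<beta> j)"
      using \<epsilon> \<beta>_pos[of j] by (simp add: pos_le_divide_eq mult_ac)
    then show ?thesis using sum_squares_bound[of 1 "\<bar>imbalance z j\<bar>"] by simp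
  qed
  ultimately show "(\<Sum>k\<in>UNIV. \<bar>row z k\<bar>) + total_imbalance z \<le>
      (\<Sum>k\<in>(UNIV :: 'i set). exp (1 / \<epsilon>)) + (\<Sum>j\<in>UNIV. 1 + 1 / (\<epsilon> * \<beta> j))"
    unfolding total_imbalance_def by (intro add_mono sum_mono)
qed

text \<open>Every error that involves the imbalance is beaten by the contraction of order
  \<open>sqrt r\<close>; the constants left over come only from the two terms weighted by
  \<open>\<epsilon>\<close>. Thus \<open>C\<close> and \<open>\<sigma>\<close> are fixed before
  \<open>\<epsilon>\<close>.\<close>

lemma lyapunov_drift:
  assumes \<alpha>: "0 < \<alpha>" and nz: "\<exists>i. u i \<noteq> 0 \<or> v i \<noteq> 0"
    and u: "\<And>y. (\<Sum>i\<in>UNIV. u i * (A_u \<beta> \<mu> E *v y) $ i) = \<alpha> * (\<Sum>i\<in>UNIV. u i * y $ i) - \<gamma> * (\<Sum>i\<in>UNIV. v i * y $ i)"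
    and v: "\<And>y. (\<Sum>i\<in>UNIV. v i * (A_u \<beta> \<mu> E *v y) $ i) = \<alpha> * (\<Sum>i\<in>UNIV. v i * y $ i) + \<gamma> * (\<Sum>i\<in>UNIV. u i * y $ i)"
  obtains \<theta> C \<sigma> where "0 < \<theta>" "0 \<le> C" "0 < \<sigma>"
    "\<And>\<epsilon>. 0 < \<epsilon> \<Longrightarrow> \<exists>r0>0. \<forall>r\<ge>r0. \<forall>z a b. event_rates r z a b \<longrightarrow> lyapunov \<epsilon> \<theta> u v z < 1 \<longrightarrow>
      generator a b (1 / sqrt r) (lyapunov \<epsilon> \<theta> u v) z \<le> C * \<epsilon> - \<sigma> / (1 + \<theta> * mode_sq u v z)\<^sup>2"
proof -
  obtain c1 C1 where V: "0 < c1" "0 \<le> C1" "\<And>r z a b. 0 < r \<Longrightarrow> event_rates r z a b \<Longrightarrow>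
    generator a b (1 / sqrt r) V z \<le> - c1 * sqrt r * total_imbalance z
      + C1 * ((\<Sum>k\<in>UNIV. \<bar>row z k\<bar>) + total_imbalance z) * total_imbalance z + C1"
    by (rule imbalance_drift) blast
  obtain C2 where L: "0 \<le> C2" "\<And>r z a b. 0 < r \<Longrightarrow> event_rates r z a b \<Longrightarrow>
    generator a b (1 / sqrt r) (\<lambda>z. ln (1 + row_sq z)) z \<le> C2 * (1 + total_imbalance z)"
    by (rule log_row_drift) blast
  obtain \<theta> C3 \<sigma> r3 where h: "0 < \<theta>" "0 \<le> C3" "0 < \<sigma>" "0 < r3"
    "\<And>r z a b. r3 \<le> r \<Longrightarrow> event_rates r z a b \<Longrightarrow>
      generator a b (1 / sqrt r) (\<lambda>z. 1 / (1 + \<theta> * mode_sq u v z)) z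
        \<le> C3 * total_imbalance z - \<sigma> / (1 + \<theta> * mode_sq u v z)\<^sup>2"
    using unstable_mode_drift[OF assms] by blast
  show thesis
  proof (rule that[of \<theta> "C1 + C2" "\<sigma> / 2"])
    show "0 < \<theta>" "0 \<le> C1 + C2" "0 < \<sigma> / 2" using V L h by auto
    fix \<epsilon> :: real assume \<epsilon>: "0 < \<epsilon>"
    obtain B where B: "\<And>z. lyapunov \<epsilon> \<theta> u v z < 1 \<Longrightarrow> (\<Sum>k\<in>UNIV. \<bar>row z k\<bar>) + total_imbalance z \<le> B"
      using lyapunov_sublevel_bounded[OF \<epsilon> h(1)] by blast
    \<comment> \<open>The value of \<open>sqrt r\<close> at which the contraction outweighs all
      coefficients of the imbalance; \<open>C3\<close> is divided by \<open>2 * \<epsilon>\<close>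
      because its term carries weight 1/2 rather than \<open>\<epsilon>\<close>.\<close>
    define T where "T = (C1 * B + C2 + C3 / (2 * \<epsilon>)) / c1"
    have "generator a b (1 / sqrt r) (lyapunov \<epsilon> \<theta> u v) z \<le> (C1 + C2) * \<epsilon> - \<sigma> / 2 / (1 + \<theta> * mode_sq u v z)\<^sup>2"
      if r: "max r3 (T\<^sup>2) \<le> r" and ev: "event_rates r z a b" and less: "lyapunov \<epsilon> \<theta> u v z < 1" for r z a b
    proof -
      let ?D = "total_imbalance z" and ?N = "(\<Sum>k\<in>UNIV. \<bar>row z k\<bar>) + total_imbalance z"
      have D0: "0 \<le> ?D" by (rule total_imbalance_nonneg)
      have r0: "0 < r" "r3 \<le> r" using r h(4) by auto
      have "\<bar>T\<bar> \<le> sqrt r" using r by (simp add: real_le_rsqrt)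
      then have "T \<le> sqrt r" by simp
      then have "C1 * B + C2 + C3 / (2 * \<epsilon>) \<le> c1 * sqrt r"
        using V(1) by (simp add: T_def pos_divide_le_eq mult.commute)
      then have "\<epsilon> * ?D * (C1 * B + C2 + C3 / (2 * \<epsilon>)) \<le> \<epsilon> * ?D * (c1 * sqrt r)"
        using \<epsilon> D0 by (intro mult_left_mono) auto
      then have key: "\<epsilon> * (C1 * B * ?D) + \<epsilon> * (C2 * ?D) + C3 * ?D / 2 \<le> \<epsilon> * (c1 * sqrt r * ?D)"
        using \<epsilon> by (simp add: algebra_simps)
      \<comment> \<open>Boundedness of the sublevel set makes the product term linear in the
        imbalance.\<close>
      have "C1 * ?N * ?D \<le> C1 * B * ?D" using V(2) B[OF less] D0 by (intro mult_right_mono mult_left_mono) auto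
      then have "generator a b (1 / sqrt r) V z \<le> - c1 * sqrt r * ?D + C1 * B * ?D + C1"
        using V(3)[OF r0(1) ev] by linarith
      then have 1: "\<epsilon> * generator a b (1 / sqrt r) V z \<le> \<epsilon> * (- c1 * sqrt r * ?D + C1 * B * ?D + C1)"
        using \<epsilon> by (intro mult_left_mono) auto
      have 2: "\<epsilon> * generator a b (1 / sqrt r) (\<lambda>z. ln (1 + row_sq z)) z \<le> \<epsilon> * (C2 * (1 + ?D))"
        using L(2)[OF r0(1) ev] \<epsilon> by (intro mult_left_mono) auto
      have "generator a b (1 / sqrt r) (lyapunov \<epsilon> \<theta> u v) z \<le>
          \<epsilon> * (- c1 * sqrt r * ?D + C1 * B * ?D + C1) + \<epsilon> * (C2 * (1 + ?D))
          + 1 / 2 * (C3 * ?D - \<sigma> / (1 + \<theta> * mode_sq u v z)\<^sup>2)"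
        unfolding generator_lyapunov
        by (intro add_mono 1 2 mult_left_mono h(5)[OF r0(2) ev]) auto
      also have "\<dots> \<le> (C1 + C2) * \<epsilon> - \<sigma> / 2 / (1 + \<theta> * mode_sq u v z)\<^sup>2"
        using key by (simp add: algebra_simps)
      finally show ?thesis .
    qed
    then show "\<exists>r0>0. \<forall>r\<ge>r0. \<forall>z a b. event_rates r z a b \<longrightarrow> lyapunov \<epsilon> \<theta> u v z < 1 \<longrightarrow>
      generator a b (1 / sqrt r) (lyapunov \<epsilon> \<theta> u v) z \<le> (C1 + C2) * \<epsilon> - \<sigma> / 2 / (1 + \<theta> * mode_sq u v z)\<^sup>2"
      using h(4) by (intro exI[of _ "max r3 (T\<^sup>2)"]) (auto simp: less_max_iff_disj)
  qed
qed

lemma bounded_statistics: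
  obtains B where "0 \<le> B" "\<And>z. (\<And>i j. \<bar>z i j\<bar> \<le> K) \<Longrightarrow> V z \<le> B \<and> row_sq z \<le> B \<and> mode_sq u v z \<le> B"
proof -
  define R where "R = (\<Sum>j\<in>(UNIV :: 'j set). \<bar>K\<bar>)"
  define S where "S = (\<Sum>i\<in>(UNIV :: 'i set). \<bar>K\<bar>)"
  define BV where "BV = (\<Sum>j\<in>UNIV. S\<^sup>2 / \<beta> j)"
  define BR where "BR = (\<Sum>i\<in>(UNIV :: 'i set). R\<^sup>2)"
  define BM where "BM = ((\<Sum>k\<in>UNIV. \<bar>u k\<bar>) * R)\<^sup>2 + ((\<Sum>k\<in>UNIV. \<bar>v k\<bar>) * R)\<^sup>2"
  have nonneg: "0 \<le> BV" "0 \<le> BR" "0 \<le> BM"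
    unfolding BV_def BR_def BM_def using \<beta>_pos by (auto intro!: sum_nonneg divide_nonneg_pos)
  show thesis
  proof (rule that[of "BV + BR + BM"])
    show "0 \<le> BV + BR + BM" using nonneg by simp
    fix z :: "'i \<Rightarrow> 'j \<Rightarrow> real" assume z: "\<And>i j. \<bar>z i j\<bar> \<le> K"
    then have z': "\<bar>z i j\<bar> \<le> \<bar>K\<bar>" for i j by (meson abs_ge_self order_trans)
    have row: "\<bar>row z i\<bar> \<le> R" for i
      unfolding row_def R_def by (intro order_trans[OF sum_abs] sum_mono z')
    have col: "\<bar>col z j\<bar> \<le> S" for j
      unfolding col_def S_def by (intro order_trans[OF sum_abs] sum_mono z')
    have sq: "x\<^sup>2 \<le> y\<^sup>2" if "\<bar>x\<bar> \<le> y" for x y :: real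
      using that by (simp add: abs_le_square_iff[symmetric])
    have "V z \<le> (\<Sum>j\<in>UNIV. (col z j)\<^sup>2 / \<beta> j)"
      unfolding V_alt using beta_sum_pos by simp
    also have "\<dots> \<le> BV" unfolding BV_def
      by (intro sum_mono divide_right_mono sq col less_imp_le \<beta>_pos)
    finally have 1: "V z \<le> BV" .
    have 2: "row_sq z \<le> BR" unfolding row_sq_def BR_def by (intro sum_mono sq row)
    have lin: "\<bar>\<Sum>k\<in>UNIV. w k * row z k\<bar> \<le> (\<Sum>k\<in>UNIV. \<bar>w k\<bar>) * R" for w
      using abs_sum_le_const[of "row z" R w] row by (simp add: mult.commute)
    have 3: "mode_sq u v z \<le> BM" unfolding mode_sq_def BM_def by (intro add_mono sq lin)
    show "V z \<le> BV + BR + BM \<and> row_sq z \<le> BV + BR + BM \<and> mode_sq u v z \<le> BV + BR + BM"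
      using 1 2 3 nonneg by auto
  qed
qed

end

subsection \<open>The queueing system\<close>

lemma sum_mult_pmf_return:
  assumes "finite S" "\<And>y. y \<notin> S \<Longrightarrow> f y = 0"
  shows "(\<Sum>y\<in>S. f y * pmf (return_pmf x) y) = (f x :: real)"
proof -
  have "(\<Sum>y\<in>S. f y * pmf (return_pmf x) y) = (\<Sum>y\<in>S. if y = x then f y else 0)"
    by (intro sum.cong) (auto simp: pmf_return)
  then show ?thesis using assms by simp
qed

lemma sum_mult_pmf_map:
  fixes p :: "'a::finite pmf"
  assumes "finite S" "\<And>y. y \<notin> S \<Longrightarrow> f y = 0"
  shows "(\<Sum>y\<in>S. f y * pmf (map_pmf g p) y) = (\<Sum>j\<in>UNIV. pmf p j * (f (g j) :: real))"
proof -
  have "(\<Sum>y\<in>S. f y * pmf (map_pmf g p) y) = measure_pmf.expectation (map_pmf g p) f"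
    using assms by (subst integral_measure_pmf_real[of S]) auto
  also have "\<dots> = measure_pmf.expectation p (\<lambda>j. f (g j))" by simp
  also have "\<dots> = (\<Sum>j\<in>UNIV. f (g j) * pmf p j)"
    by (rule integral_measure_pmf_real) auto
  finally show ?thesis by (simp add: mult.commute)
qed

text \<open>Assumption \<open>load\<close> is tightness in units of busy servers. Assumption
  \<open>\<mu>_zero\<close> makes \<open>\<mu> i j * (l i j / \<mu> i j) = l i j\<close> hold also
  where HOL divides by 0.\<close>

locale underloaded_network = network \<Lambda> \<beta> \<mu> l E
  for \<Lambda> :: "'i::finite \<Rightarrow> real" and \<beta> :: "'j::finite \<Rightarrow> real"
    and \<mu> l :: "'i \<Rightarrow> 'j \<Rightarrow> real" and E :: "('i \<times> 'j) set" +
  fixes \<rho> :: real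
  assumes load: "\<And>j. (\<Sum>i\<in>UNIV. l i j / \<mu> i j) = \<rho> * \<beta> j" and \<rho>_less_1: "\<rho> < 1"
    and \<mu>_zero: "\<And>i j. \<mu> i j = 0 \<Longrightarrow> l i j = 0"
begin

text \<open>The diffusion scaling as a total function on pairs: 0 instead of
  \<open>undefined\<close> outside \<open>E\<close> for states of the system, so that row and column
  sums range over whole types.\<close>

definition scaled :: "real \<Rightarrow> ('i \<Rightarrow> 'j \<Rightarrow> nat) \<Rightarrow> 'i \<Rightarrow> 'j \<Rightarrow> real" where
  "scaled r \<Psi> i j = (real (\<Psi> i j) - r * (l i j / \<mu> i j)) / sqrt r"

lemma supported_scaled:
  assumes "x \<in> state_space \<beta> E r"
  shows "supported (scaled r (fst x))"
proof -
  have "l i j = 0" if "(i, j) \<notin> E" for i j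
    using that l_pos[of i j] l_nonneg[of i j] by auto
  then show ?thesis
    using assms by (auto simp: supported_def scaled_def state_space_def)
qed

lemma scaled_start_service: "scaled r (start_service i j \<Psi>) = bump (scaled r \<Psi>) i j (1 / sqrt r)"
  by (auto simp: fun_eq_iff scaled_def start_service_def bump_def add_divide_distrib diff_divide_distrib)

lemma scaled_end_service:
  "0 < \<Psi> i j \<Longrightarrow> scaled r (end_service i j \<Psi>) = bump (scaled r \<Psi>) i j (- (1 / sqrt r))"
  by (auto simp: fun_eq_iff scaled_def end_service_def bump_def of_nat_diff add_divide_distrib diff_divide_distrib)

lemma col_scaled: "col (scaled r \<Psi>) j = (real (busy \<Psi> j) - r * \<rho> * \<beta> j) / sqrt r"
proof -
  have "col (scaled r \<Psi>) j = (\<Sum>i\<in>UNIV. real (\<Psi> i j) - r * (l i j / \<mu> i j)) / sqrt r"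
    unfolding col_def scaled_def by (rule sum_divide_distrib[symmetric])
  also have "(\<Sum>i\<in>UNIV. real (\<Psi> i j) - r * (l i j / \<mu> i j)) = real (busy \<Psi> j) - r * (\<rho> * \<beta> j)"
    by (simp only: sum_subtractf sum_distrib_left[symmetric] load busy_def of_nat_sum)
  finally show ?thesis by (simp add: mult.assoc)
qed

text \<open>All pools have the same nominal load \<open>\<rho>\<close>, so centring and scaling
  preserve the order of the busy fractions by which the routing rule chooses.\<close>

lemma imbalance_scaled_mono:
  assumes "0 < r" "real (busy \<Psi> j) / \<beta> j \<le> real (busy \<Psi> k) / \<beta> k"
  shows "imbalance (scaled r \<Psi>) j \<le> imbalance (scaled r \<Psi>) k"
proof -
  have "col (scaled r \<Psi>) j / \<beta> j = (real (busy \<Psi> j) / \<beta> j - r * \<rho>) / sqrt r" for j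
    using \<beta>_pos[of j] by (simp add: col_scaled field_simps)
  then show ?thesis
    using assms by (simp add: imbalance_def divide_right_mono)
qed

lemma completion_rate:
  assumes "0 < r"
  shows "\<mu> i j * real (\<Psi> i j) = r * l i j + sqrt r * (\<mu> i j * scaled r \<Psi> i j)"
proof -
  have "sqrt r * scaled r \<Psi> i j = real (\<Psi> i j) - r * (l i j / \<mu> i j)"
    using assms by (simp add: scaled_def)
  then have "sqrt r * (\<mu> i j * scaled r \<Psi> i j) = \<mu> i j * (real (\<Psi> i j) - r * (l i j / \<mu> i j))"
    by (metis mult.left_commute)
  then show ?thesis
    using \<mu>_zero[of i j] by (cases "\<mu> i j = 0") (simp_all add: right_diff_distrib)
qed

text \<open>On the sublevel set a pool exceeds its nominal occupancy
  \<open>r * \<rho> * \<beta> j\<close> by at most order \<open>sqrt r\<close>, while the idle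
  capacity left by \<open>\<rho> < 1\<close> is of order \<open>r\<close>.\<close>

lemma sublevel_not_full:
  assumes \<epsilon>: "0 < \<epsilon>" and \<theta>: "0 < \<theta>"
  obtains r0 where "0 < r0" "\<And>r \<Psi> j. r0 \<le> r \<Longrightarrow> lyapunov \<epsilon> \<theta> u v (scaled r \<Psi>) < 1 \<Longrightarrow>
    real (busy \<Psi> j) + 1 \<le> r * \<beta> j"
proof -
  obtain B where B: "\<And>z. lyapunov \<epsilon> \<theta> u v z < 1 \<Longrightarrow> (\<Sum>k\<in>UNIV. \<bar>row z k\<bar>) + total_imbalance z \<le> B"
    using lyapunov_sublevel_bounded[OF \<epsilon> \<theta>] by blast
  define M where "M = \<bar>B\<bar> + \<bar>B\<bar> / (\<Sum>k\<in>UNIV. \<beta> k)"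
  define K where "K = (\<Sum>j\<in>UNIV. 1 / \<beta> j)"
  have K: "1 / \<beta> j \<le> K" for j
    unfolding K_def using \<beta>_pos by (intro member_le_sum) (auto intro: less_imp_le)
  \<comment> \<open>\<open>M\<close> bounds the scaled column sum per unit of
    \<open>\<beta> j\<close>, and \<open>K\<close> reserves one more server, so that a state stays
    admissible after an arrival.\<close>
  define T where "T = (M + K) / (1 - \<rho>)"
  show thesis
  proof (rule that[of "max 1 (T\<^sup>2)"])
    show "0 < max 1 (T\<^sup>2)" by simp
    fix r \<Psi> j assume r: "max 1 (T\<^sup>2) \<le> r" and less: "lyapunov \<epsilon> \<theta> u v (scaled r \<Psi>) < 1"
    let ?z = "scaled r \<Psi>"
    have "\<bar>T\<bar> \<le> sqrt r" using r by (simp add: real_le_rsqrt)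
    then have "T \<le> sqrt r" by simp
    then have T: "M + K \<le> sqrt r * (1 - \<rho>)"
      using \<rho>_less_1 by (simp add: T_def pos_divide_le_eq)
    have r1: "1 \<le> sqrt r" using r by simp
    have rr: "sqrt r * sqrt r = r" using r by simp
    have BB: "\<bar>imbalance ?z j\<bar> \<le> \<bar>B\<bar>" "\<bar>\<Sum>i\<in>UNIV. row ?z i\<bar> \<le> \<bar>B\<bar>"
    proof -
      have "0 \<le> (\<Sum>k\<in>UNIV. \<bar>row ?z k\<bar>)" by (intro sum_nonneg) auto
      then show "\<bar>imbalance ?z j\<bar> \<le> \<bar>B\<bar>" "\<bar>\<Sum>i\<in>UNIV. row ?z i\<bar> \<le> \<bar>B\<bar>"
        using B[OF less] imbalance_le_total[of ?z j] sum_abs[of "row ?z" UNIV] total_imbalance_nonneg[of ?z]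
        by linarith+
    qed
    have "(\<Sum>i\<in>UNIV. row ?z i) / (\<Sum>k\<in>UNIV. \<beta> k) \<le> \<bar>B\<bar> / (\<Sum>k\<in>UNIV. \<beta> k)"
      using BB(2) beta_sum_pos by (intro divide_right_mono) auto
    then have "imbalance ?z j + (\<Sum>i\<in>UNIV. row ?z i) / (\<Sum>k\<in>UNIV. \<beta> k) \<le> M"
      using BB(1) unfolding M_def by linarith
    then have "col ?z j \<le> \<beta> j * M"
      unfolding col_eq[of ?z j] using \<beta>_pos[of j] by (intro mult_left_mono) auto
    then have "sqrt r * col ?z j \<le> sqrt r * (\<beta> j * M)" using r1 by (intro mult_left_mono) auto
    moreover have "real (busy \<Psi> j) = r * \<rho> * \<beta> j + sqrt r * col ?z j"
      using r1 by (simp add: col_scaled)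
    moreover have "sqrt r * (\<beta> j * (M + K)) \<le> sqrt r * (\<beta> j * (sqrt r * (1 - \<rho>)))"
      using T r1 \<beta>_pos[of j] by (intro mult_left_mono) auto
    moreover have "sqrt r * (\<beta> j * (sqrt r * (1 - \<rho>))) = r * \<beta> j - r * \<rho> * \<beta> j"
    proof -
      have "sqrt r * (\<beta> j * (sqrt r * (1 - \<rho>))) = sqrt r * sqrt r * (\<beta> j * (1 - \<rho>))"
        by (simp only: mult_ac)
      then show ?thesis unfolding rr by (simp add: algebra_simps)
    qed
    moreover have "1 \<le> sqrt r * (\<beta> j * K)"
    proof -
      have "1 \<le> \<beta> j * K" using K[of j] \<beta>_pos[of j] by (simp add: pos_divide_le_eq mult.commute)
      then have "1 * 1 \<le> sqrt r * (\<beta> j * K)" using r1 by (intro mult_mono) auto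
      then show ?thesis by simp
    qed
    ultimately show "real (busy \<Psi> j) + 1 \<le> r * \<beta> j" by (simp add: algebra_simps)
  qed
qed

lemma pools_nonempty: "\<exists>j. (i, j) \<in> E"
proof (rule ccontr)
  assume "\<not> ?thesis"
  then have "l i j = 0" for j using l_pos[of i j] l_nonneg[of i j] by force
  then show False using l_row[of i] \<Lambda>_pos[of i] by simp
qed

lemma busy_start_service: "busy (start_service i j \<Psi>) k = busy \<Psi> k + (if k = j then 1 else 0)"
proof -
  have "busy (start_service i j \<Psi>) k = (\<Sum>a\<in>UNIV. \<Psi> a k + (if a = i then (if k = j then 1 else 0) else 0))"
    unfolding busy_def start_service_def by (intro sum.cong) auto
  then show ?thesis by (simp add: sum.distrib busy_def)
qed

lemma busy_end_service_le: "busy (end_service i j \<Psi>) k \<le> busy \<Psi> k"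
  unfolding busy_def end_service_def by (intro sum_mono) auto

section \<open>From drift to stationary mass\<close>

text \<open>The truncation \<open>f\<close> of \<open>1 - W\<close> agrees with \<open>1 - W\<close>
  in the current state and dominates it in every state reached, so its drift is at least
  \<open>- h\<close>; stationarity makes the mean drift over \<open>S\<close> at most 0.\<close>

lemma stationary_drift_bound:
  assumes r: "0 < r" and rule: "lqfs_lb_rule \<beta> E r route sched"
    and P: "markov_semigroup (state_space \<beta> E r) (lqfs_lb_rates \<Lambda> \<beta> \<mu> E r route sched) P"
    and \<pi>: "stationary_distribution (state_space \<beta> E r) P \<pi>"
    and room: "\<And>\<Psi> j. W (scaled r \<Psi>) < 1 \<Longrightarrow> real (busy \<Psi> j) + 1 \<le> r * \<beta> j"
    and drift: "\<And>z a b. event_rates r z a b \<Longrightarrow> W z < 1 \<Longrightarrow> generator a b (1 / sqrt r) W z \<le> h z"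
  defines "S \<equiv> {x \<in> state_space \<beta> E r. W (scaled r (fst x)) < 1}"
  shows "finite S" "0 \<le> (\<Sum>x\<in>S. pmf \<pi> x * h (scaled r (fst x)))"
proof -
  define X where "X = state_space \<beta> E r"
  \<comment> \<open>Each type has a pool in \<open>E\<close>, that pool is not full, and then the
    invariant of the state space rules out a queue.\<close>
  have no_queue: "Q = (\<lambda>_. 0)" if "(\<Psi>, Q) \<in> S" for \<Psi> Q
  proof
    fix i
    obtain j where j: "(i, j) \<in> E" using pools_nonempty by blast
    have "real (busy \<Psi> j) + 1 \<le> r * \<beta> j" using that room[of \<Psi> j] by (simp add: S_def)
    then show "Q i = 0"
      using that j by (force simp: S_def state_space_def pools_def)
  qed
  show fin: "finite S"
  proof (rule finite_subset)
    define N where "N = nat \<lceil>\<Sum>j\<in>UNIV. r * \<beta> j\<rceil>"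
    show "S \<subseteq> PiE UNIV (\<lambda>_. PiE UNIV (\<lambda>_. {..N})) \<times> {\<lambda>_. 0}"
    proof
      fix x assume x: "x \<in> S"
      obtain \<Psi> Q where xe: "x = (\<Psi>, Q)" by (cases x)
      have "\<Psi> i j \<le> N" for i j
      proof -
        have "\<Psi> i j \<le> busy \<Psi> j" unfolding busy_def by (rule member_le_sum) auto
        then have "real (\<Psi> i j) \<le> real (busy \<Psi> j)" by simp
        also have "\<dots> \<le> r * \<beta> j" using x xe by (simp add: S_def state_space_def)
        also have "\<dots> \<le> (\<Sum>j\<in>UNIV. r * \<beta> j)"
          using r \<beta>_pos by (intro member_le_sum) (auto intro: mult_nonneg_nonneg less_imp_le)
        finally show ?thesis unfolding N_def by linarith
      qed
      then show "x \<in> PiE UNIV (\<lambda>_. PiE UNIV (\<lambda>_. {..N})) \<times> {\<lambda>_. 0}"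
        using x no_queue xe by auto
    qed
  qed (intro finite_cartesian_product finite_PiE; simp)
  \<comment> \<open>This is \<open>max 0 (1 - W)\<close> on the state space but 0 off it, so
    \<open>f_ge\<close> needs every target state to be admissible.\<close>
  define f where "f x = (if x \<in> S then 1 - W (scaled r (fst x)) else 0)" for x
  have f0: "y \<notin> S \<Longrightarrow> f y = 0" for y by (simp add: f_def)
  have f_nonneg: "0 \<le> f y" for y by (simp add: f_def S_def)
  have f_ge: "1 - W (scaled r (fst y)) \<le> f y" if "y \<in> X" for y
    using that by (simp add: f_def S_def X_def)
  have gen: "- h (scaled r (fst x)) \<le> (\<Sum>y\<in>S. f y * lqfs_lb_rates \<Lambda> \<beta> \<mu> E r route sched x y)"
    if x: "x \<in> S" for x
  proof -
    obtain \<Psi> where xe: "x = (\<Psi>, \<lambda>_. 0)" using no_queue x by (cases x) auto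
    let ?z = "scaled r \<Psi>"
    have xX: "x \<in> X" and Wx: "W ?z < 1" using x xe by (auto simp: S_def X_def)
    have fx: "f x = 1 - W ?z" using x xe by (simp add: f_def)
    have roomx: "real (busy \<Psi> j) + 1 \<le> r * \<beta> j" for j by (rule room[OF Wx])
    have idle: "\<exists>j\<in>pools E i. real (busy \<Psi> j) < r * \<beta> j" for i
    proof -
      obtain j where "(i, j) \<in> E" using pools_nonempty by blast
      then show ?thesis using roomx[of j] by (intro bexI[of _ j]) (auto simp: pools_def)
    qed
    have argmin: "is_arg_min (\<lambda>k. real (busy \<Psi> k) / \<beta> k) (\<lambda>k. k \<in> pools E i) j"
      if "0 < pmf (route x i) j" for i j
    proof -
      have "set_pmf (route x i) \<subseteq> {j. is_arg_min (\<lambda>k. real (busy \<Psi> k) / \<beta> k) (\<lambda>k. k \<in> pools E i) j}"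
        using rule xX xe idle unfolding lqfs_lb_rule_def X_def by blast
      moreover have "j \<in> set_pmf (route x i)" using that by (simp add: set_pmf_iff)
      ultimately show ?thesis by blast
    qed
    define a where "a i j = r * \<Lambda> i * pmf (route x i) j" for i j
    define b where "b i j = \<mu> i j * real (\<Psi> i j)" for i j
    have a0: "0 \<le> a i j" for i j using r \<Lambda>_pos[of i] by (simp add: a_def)
    have ev: "event_rates r ?z a b"
      unfolding event_rates_def
    proof (intro conjI allI impI)
      show "supported ?z" using supported_scaled[of x r] xX xe by (simp add: X_def)
      fix i j
      show "0 \<le> a i j" by (rule a0)
      show "(\<Sum>j\<in>UNIV. a i j) = r * \<Lambda> i" for i
        by (simp add: a_def sum_distrib_left[symmetric] sum_pmf_eq_1)
      show "imbalance ?z j \<le> imbalance ?z k" if "0 < a i j" "(i, k) \<in> E" for k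
      proof (rule imbalance_scaled_mono[OF r])
        have "0 < pmf (route x i) j"
          using that(1) r \<Lambda>_pos[of i] by (simp add: a_def zero_less_mult_iff)
        then show "real (busy \<Psi> j) / \<beta> j \<le> real (busy \<Psi> k) / \<beta> k"
          using argmin[of i j] that(2) by (simp add: is_arg_min_linorder pools_def)
      qed
      show "0 \<le> b i j" using \<mu>_nonneg by (simp add: b_def)
      have "\<Psi> i j \<le> busy \<Psi> j" unfolding busy_def by (rule member_le_sum) auto
      then have "real (\<Psi> i j) \<le> r * \<beta> j" using roomx[of j] by linarith
      then have "\<mu> i j * real (\<Psi> i j) \<le> \<mu> i j * (r * \<beta> j)" by (intro mult_left_mono \<mu>_nonneg)
      then show "b i j \<le> r * (\<mu> i j * \<beta> j)" by (simp add: b_def mult_ac)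
      show "b i j = r * l i j + sqrt r * (\<mu> i j * ?z i j)"
        unfolding b_def by (rule completion_rate[OF r])
    qed
    have arr: "r * \<Lambda> i * ((\<Sum>y\<in>S. f y * pmf (after_arrival \<beta> E r route i x) y) - f x) \<ge>
        - (\<Sum>j\<in>UNIV. a i j * (W (bump ?z i j (1 / sqrt r)) - W ?z))" for i
    proof -
      have "after_arrival \<beta> E r route i x = map_pmf (\<lambda>j. (start_service i j \<Psi>, \<lambda>_. 0)) (route x i)"
        using idle[of i] by (simp add: after_arrival_def xe)
      then have "r * \<Lambda> i * ((\<Sum>y\<in>S. f y * pmf (after_arrival \<beta> E r route i x) y) - f x) =
          r * \<Lambda> i * ((\<Sum>j\<in>UNIV. pmf (route x i) j * f (start_service i j \<Psi>, \<lambda>_. 0)) - (\<Sum>j\<in>UNIV. pmf (route x i) j * f x))"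
        by (simp add: sum_mult_pmf_map[OF fin f0] sum_distrib_right[symmetric] sum_pmf_eq_1)
      also have "\<dots> = (\<Sum>j\<in>UNIV. a i j * (f (start_service i j \<Psi>, \<lambda>_. 0) - f x))"
        by (simp add: a_def sum_subtractf[symmetric] sum_distrib_left right_diff_distrib mult.assoc)
      also have "\<dots> \<ge> (\<Sum>j\<in>UNIV. a i j * - (W (bump ?z i j (1 / sqrt r)) - W ?z))"
      proof (rule sum_mono)
        fix j
        show "a i j * - (W (bump ?z i j (1 / sqrt r)) - W ?z) \<le> a i j * (f (start_service i j \<Psi>, \<lambda>_. 0) - f x)"
        \<comment> \<open>A pool that is never chosen may lie outside \<open>E\<close> and lead out
          of the state space; its rate is 0. A chosen pool lies in \<open>E\<close> as an
          argmin.\<close>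
        proof (cases "pmf (route x i) j = 0")
          case False
          then have "0 < pmf (route x i) j" by (simp add: pmf_pos)
          then have ij: "(i, j) \<in> E" using argmin[of i j] by (simp add: is_arg_min_def pools_def)
          have "(start_service i j \<Psi>, \<lambda>_. 0) \<in> X"
            unfolding X_def state_space_def
          proof (clarsimp, intro conjI allI impI)
            show "(i', j') \<notin> E \<Longrightarrow> start_service i j \<Psi> i' j' = 0" for i' j'
              using xX xe ij by (auto simp: X_def state_space_def start_service_def)
            show "real (busy (start_service i j \<Psi>) k) \<le> r * \<beta> k" for k
              using roomx[of k] by (auto simp: busy_start_service)
          qed
          from f_ge[OF this] show ?thesis
            by (intro mult_left_mono a0) (simp add: fx scaled_start_service)
        qed (simp add: a_def)
      qed
      finally show ?thesis by (simp only: mult_minus_right sum_negf)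
    qed
    have dep: "b i j * ((\<Sum>y\<in>S. f y * pmf (after_completion E sched i j x) y) - f x) \<ge>
        - (b i j * (W (bump ?z i j (- (1 / sqrt r))) - W ?z))" for i j
    \<comment> \<open>With no such service running the rate is 0; otherwise truncated subtraction is
      a genuine decrement.\<close>
    proof (cases "\<Psi> i j = 0")
      case False
      have "after_completion E sched i j x = return_pmf (end_service i j \<Psi>, \<lambda>_. 0)"
        by (simp add: after_completion_def xe)
      then have sum_eq: "(\<Sum>y\<in>S. f y * pmf (after_completion E sched i j x) y) = f (end_service i j \<Psi>, \<lambda>_. 0)"
        by (simp only:) (rule sum_mult_pmf_return[OF fin f0])
      have "(end_service i j \<Psi>, \<lambda>_. 0) \<in> X"
        unfolding X_def state_space_def
      proof (clarsimp, intro conjI allI impI)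
        show "(i', j') \<notin> E \<Longrightarrow> end_service i j \<Psi> i' j' = 0" for i' j'
          using xX xe by (auto simp: X_def state_space_def end_service_def)
        show "real (busy (end_service i j \<Psi>) k) \<le> r * \<beta> k" for k
          using roomx[of k] busy_end_service_le[of i j \<Psi> k] by linarith
      qed
      from f_ge[OF this]
      have "- (W (bump ?z i j (- (1 / sqrt r))) - W ?z) \<le> f (end_service i j \<Psi>, \<lambda>_. 0) - f x"
        using False by (simp add: fx scaled_end_service)
      then have "b i j * - (W (bump ?z i j (- (1 / sqrt r))) - W ?z) \<le> b i j * (f (end_service i j \<Psi>, \<lambda>_. 0) - f x)"
        using \<mu>_nonneg by (intro mult_left_mono) (auto simp: b_def)
      then show ?thesis by (simp only: sum_eq mult_minus_right)
    qed (simp add: b_def)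
    have diff: "(\<Sum>y\<in>S. f y * (c * (pmf p y - pmf (return_pmf x) y))) =
        c * ((\<Sum>y\<in>S. f y * pmf p y) - f x)" for c p
    proof -
      have "(\<Sum>y\<in>S. f y * (c * (pmf p y - pmf (return_pmf x) y))) =
        c * ((\<Sum>y\<in>S. f y * pmf p y) - (\<Sum>y\<in>S. f y * pmf (return_pmf x) y))"
        unfolding sum_subtractf[symmetric] sum_distrib_left by (simp add: algebra_simps)
      also have "(\<Sum>y\<in>S. f y * pmf (return_pmf x) y) = f x"
        by (rule sum_mult_pmf_return[OF fin f0])
      finally show ?thesis .
    qed
    have swap: "(\<Sum>y\<in>S. f y * (\<Sum>i\<in>(UNIV :: 'k::finite set). g i y)) = (\<Sum>i\<in>UNIV. \<Sum>y\<in>S. f y * g i y)" for g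
      unfolding sum_distrib_left by (rule sum.swap)
    have swap2: "(\<Sum>y\<in>S. f y * (\<Sum>i\<in>(UNIV :: 'i set). \<Sum>j\<in>(UNIV :: 'j set). g i j y)) = (\<Sum>i\<in>UNIV. \<Sum>j\<in>UNIV. \<Sum>y\<in>S. f y * g i j y)" for g
      unfolding swap ..
    have "(\<Sum>y\<in>S. f y * lqfs_lb_rates \<Lambda> \<beta> \<mu> E r route sched x y) =
        (\<Sum>i\<in>UNIV. r * \<Lambda> i * ((\<Sum>y\<in>S. f y * pmf (after_arrival \<beta> E r route i x) y) - f x)) +
        (\<Sum>i\<in>UNIV. \<Sum>j\<in>UNIV. b i j * ((\<Sum>y\<in>S. f y * pmf (after_completion E sched i j x) y) - f x))"
      unfolding lqfs_lb_rates_def distrib_left sum.distrib swap swap2 diff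
      by (simp add: b_def xe)
    also have "\<dots> \<ge> (\<Sum>i\<in>UNIV. - (\<Sum>j\<in>UNIV. a i j * (W (bump ?z i j (1 / sqrt r)) - W ?z))) +
        (\<Sum>i\<in>UNIV. \<Sum>j\<in>UNIV. - (b i j * (W (bump ?z i j (- (1 / sqrt r))) - W ?z)))"
      by (intro add_mono sum_mono arr dep)
    also have "(\<Sum>i\<in>UNIV. - (\<Sum>j\<in>UNIV. a i j * (W (bump ?z i j (1 / sqrt r)) - W ?z))) +
        (\<Sum>i\<in>UNIV. \<Sum>j\<in>UNIV. - (b i j * (W (bump ?z i j (- (1 / sqrt r))) - W ?z))) =
        - generator a b (1 / sqrt r) W ?z"
      by (simp only: generator_def sum_negf minus_add_distrib)
    finally show ?thesis using drift[OF ev Wx] xe by simp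
  qed
  have "(\<Sum>x\<in>S. pmf \<pi> x * - h (scaled r (fst x))) \<le>
      (\<Sum>x\<in>S. pmf \<pi> x * (\<Sum>y\<in>S. f y * lqfs_lb_rates \<Lambda> \<beta> \<mu> E r route sched x y))"
    by (intro sum_mono mult_left_mono gen pmf_nonneg)
  also have "\<dots> \<le> 0"
    using f_nonneg fin by (intro stationary_generator_nonpos[OF P \<pi>]) (auto simp: S_def)
  finally show "0 \<le> (\<Sum>x\<in>S. pmf \<pi> x * h (scaled r (fst x)))"
    by (simp add: sum_negf)
qed

text \<open>The stationary mean of \<open>\<sigma> / (1 + \<theta> * mode_sq u v z)\<^sup>2\<close>
  over the sublevel set is at most \<open>C * \<epsilon>\<close>, and on the ball this weight is
  bounded below independently of \<open>\<epsilon>\<close> and \<open>r\<close>.\<close>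

lemma ball_mass_bound:
  assumes \<alpha>: "0 < \<alpha>" and nz: "\<exists>i. u i \<noteq> 0 \<or> v i \<noteq> 0"
    and u: "\<And>y. (\<Sum>i\<in>UNIV. u i * (A_u \<beta> \<mu> E *v y) $ i) = \<alpha> * (\<Sum>i\<in>UNIV. u i * y $ i) - \<gamma> * (\<Sum>i\<in>UNIV. v i * y $ i)"
    and v: "\<And>y. (\<Sum>i\<in>UNIV. v i * (A_u \<beta> \<mu> E *v y) $ i) = \<alpha> * (\<Sum>i\<in>UNIV. v i * y $ i) + \<gamma> * (\<Sum>i\<in>UNIV. u i * y $ i)"
  obtains C \<epsilon>1 where "0 \<le> C" "0 < \<epsilon>1"
    "\<And>\<epsilon>. 0 < \<epsilon> \<Longrightarrow> \<epsilon> \<le> \<epsilon>1 \<Longrightarrow> \<exists>r0>0. \<forall>r\<ge>r0. \<forall>route sched P \<pi>. lqfs_lb_rule \<beta> E r route sched \<longrightarrow>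
      markov_semigroup (state_space \<beta> E r) (lqfs_lb_rates \<Lambda> \<beta> \<mu> E r route sched) P \<longrightarrow>
      stationary_distribution (state_space \<beta> E r) P \<pi> \<longrightarrow>
      measure \<pi> {x \<in> state_space \<beta> E r. \<forall>i j. \<bar>scaled r (fst x) i j\<bar> \<le> K} \<le> C * \<epsilon>"
proof -
  obtain \<theta> C \<sigma> where D: "0 < \<theta>" "0 \<le> C" "0 < \<sigma>"
    "\<And>\<epsilon>. 0 < \<epsilon> \<Longrightarrow> \<exists>r0>0. \<forall>r\<ge>r0. \<forall>z a b. event_rates r z a b \<longrightarrow> lyapunov \<epsilon> \<theta> u v z < 1 \<longrightarrow>
      generator a b (1 / sqrt r) (lyapunov \<epsilon> \<theta> u v) z \<le> C * \<epsilon> - \<sigma> / (1 + \<theta> * mode_sq u v z)\<^sup>2"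
    using lyapunov_drift[OF assms] by blast
  obtain B where B: "0 \<le> B"
    "\<And>z. (\<And>i j. \<bar>z i j\<bar> \<le> K) \<Longrightarrow> V z \<le> B \<and> row_sq z \<le> B \<and> mode_sq u v z \<le> B"
    by (rule bounded_statistics) blast
  define c where "c = \<sigma> / (1 + \<theta> * B)\<^sup>2"
  have \<theta>B: "0 < 1 + \<theta> * B" using D(1) B(1) by (simp add: add_pos_nonneg)
  have c: "0 < c" using D(3) \<theta>B by (simp add: c_def)
  show thesis
  \<comment> \<open>Up to this \<open>\<epsilon>1\<close> the two weighted terms add at most 1/4 on
    the ball, so \<open>lyapunov\<close> is at most 3/4 there.\<close>
  proof (rule that[of "C / c" "1 / (4 * (B + ln (1 + B) + 1))"])
    have lnB: "0 \<le> ln (1 + B)" using B(1) by simp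
    show "0 \<le> C / c" using D(2) c by simp
    have pos: "0 < B + ln (1 + B) + 1" using B(1) lnB by linarith
    have quarter: "e * y \<le> 1 / 4" if "0 < y" "e \<le> 1 / (4 * y)" for e y :: real
      using that by (simp add: field_simps)
    show "0 < 1 / (4 * (B + ln (1 + B) + 1))"
      by (intro divide_pos_pos mult_pos_pos pos) auto
    fix \<epsilon> :: real assume \<epsilon>: "0 < \<epsilon>" "\<epsilon> \<le> 1 / (4 * (B + ln (1 + B) + 1))"
    obtain r1 where r1: "0 < r1" "\<And>r z a b. r1 \<le> r \<Longrightarrow> event_rates r z a b \<Longrightarrow> lyapunov \<epsilon> \<theta> u v z < 1 \<Longrightarrow>
      generator a b (1 / sqrt r) (lyapunov \<epsilon> \<theta> u v) z \<le> C * \<epsilon> - \<sigma> / (1 + \<theta> * mode_sq u v z)\<^sup>2"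
      using D(4)[OF \<epsilon>(1)] by blast
    obtain r2 where r2: "0 < r2" "\<And>r \<Psi> j. r2 \<le> r \<Longrightarrow> lyapunov \<epsilon> \<theta> u v (scaled r \<Psi>) < 1 \<Longrightarrow>
      real (busy \<Psi> j) + 1 \<le> r * \<beta> j"
      using sublevel_not_full[OF \<epsilon>(1) D(1)] by blast
    have "measure \<pi> {x \<in> state_space \<beta> E r. \<forall>i j. \<bar>scaled r (fst x) i j\<bar> \<le> K} \<le> C / c * \<epsilon>"
      if r: "max r1 r2 \<le> r" and rule: "lqfs_lb_rule \<beta> E r route sched"
        and P: "markov_semigroup (state_space \<beta> E r) (lqfs_lb_rates \<Lambda> \<beta> \<mu> E r route sched) P"
        and \<pi>: "stationary_distribution (state_space \<beta> E r) P \<pi>" for r route sched P \<pi>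
    proof -
      define S where "S = {x \<in> state_space \<beta> E r. lyapunov \<epsilon> \<theta> u v (scaled r (fst x)) < 1}"
      define T where "T = {x \<in> state_space \<beta> E r. \<forall>i j. \<bar>scaled r (fst x) i j\<bar> \<le> K}"
      let ?m = "\<lambda>x. mode_sq u v (scaled r (fst x))"
      have "0 < r" using r r1(1) by simp
      have fin: "finite S" and sum0: "0 \<le> (\<Sum>x\<in>S. pmf \<pi> x * (C * \<epsilon> - \<sigma> / (1 + \<theta> * ?m x)\<^sup>2))"
        unfolding S_def using r
        by (intro stationary_drift_bound[OF \<open>0 < r\<close> rule P \<pi>, where W="lyapunov \<epsilon> \<theta> u v"
              and h="\<lambda>z. C * \<epsilon> - \<sigma> / (1 + \<theta> * mode_sq u v z)\<^sup>2"] r1(2) r2(2); simp)+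
      have m0: "0 \<le> \<theta> * ?m x" for x using D(1) mode_sq_nonneg by simp
      have TS: "T \<subseteq> S"
      proof
        fix x assume x: "x \<in> T"
        let ?z = "scaled r (fst x)"
        have *: "V ?z \<le> B" "row_sq ?z \<le> B" using x B(2)[of ?z] by (auto simp: T_def)
        have "ln (1 + row_sq ?z) \<le> ln (1 + B)" using *(2) row_sq_nonneg[of ?z] by simp
        then have "\<epsilon> * (V ?z + ln (1 + row_sq ?z)) \<le> \<epsilon> * (B + ln (1 + B) + 1)"
          using *(1) \<epsilon>(1) by (intro mult_left_mono) auto
        also have "\<dots> \<le> 1 / 4" using quarter[OF pos \<epsilon>(2)] .
        finally have "\<epsilon> * (V ?z + ln (1 + row_sq ?z)) \<le> 1 / 4" .
        moreover have "1 / (1 + \<theta> * mode_sq u v ?z) \<le> 1" using m0[of x] by simp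
        ultimately have "lyapunov \<epsilon> \<theta> u v ?z < 1"
          unfolding lyapunov_def distrib_left[symmetric] by linarith
        then show "x \<in> S" using x by (simp add: S_def T_def)
      qed
      have "c * measure \<pi> T = (\<Sum>x\<in>T. pmf \<pi> x * c)"
        using finite_subset[OF TS fin] by (simp add: measure_measure_pmf_finite sum_distrib_left mult.commute)
      also have "\<dots> \<le> (\<Sum>x\<in>T. pmf \<pi> x * (\<sigma> / (1 + \<theta> * ?m x)\<^sup>2))"
      proof (intro sum_mono mult_left_mono pmf_nonneg)
        fix x assume "x \<in> T"
        then have "?m x \<le> B" using B(2)[of "scaled r (fst x)"] by (auto simp: T_def)
        then have "(1 + \<theta> * ?m x)\<^sup>2 \<le> (1 + \<theta> * B)\<^sup>2"
          using D(1) m0[of x] by (intro power_mono) auto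
        then show "c \<le> \<sigma> / (1 + \<theta> * ?m x)\<^sup>2"
          unfolding c_def using D(3) m0[of x] by (intro divide_left_mono) (auto intro!: mult_pos_pos simp: add_pos_nonneg)
      qed
      also have "\<dots> \<le> (\<Sum>x\<in>S. pmf \<pi> x * (\<sigma> / (1 + \<theta> * ?m x)\<^sup>2))"
        using D(3) by (intro sum_mono2 fin TS) auto
      also have "\<dots> \<le> (\<Sum>x\<in>S. pmf \<pi> x) * (C * \<epsilon>)"
        using sum0 by (simp add: right_diff_distrib sum_subtractf sum_distrib_right)
      also have "\<dots> \<le> 1 * (C * \<epsilon>)"
        using D(2) \<epsilon>(1) fin by (intro mult_right_mono) (simp_all add: measure_measure_pmf_finite[symmetric])
      finally show ?thesis using c by (simp add: T_def pos_le_divide_eq mult.commute)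
    qed
    then show "\<exists>r0>0. \<forall>r\<ge>r0. \<forall>route sched P \<pi>. lqfs_lb_rule \<beta> E r route sched \<longrightarrow>
      markov_semigroup (state_space \<beta> E r) (lqfs_lb_rates \<Lambda> \<beta> \<mu> E r route sched) P \<longrightarrow>
      stationary_distribution (state_space \<beta> E r) P \<pi> \<longrightarrow>
      measure \<pi> {x \<in> state_space \<beta> E r. \<forall>i j. \<bar>scaled r (fst x) i j\<bar> \<le> K} \<le> C / c * \<epsilon>"
      using r1(1) by (intro exI[of _ "max r1 r2"]) (auto simp: less_max_iff_disj)
  qed
qed

text \<open>The Euclidean norm dominates every coordinate, so the ball is contained in the cube used
  for the mass bound.\<close>

lemma scaled_distribution_cball_le:
  assumes "set_pmf \<pi> \<subseteq> state_space \<beta> E r"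
  shows "measure (scaled_distribution \<mu> l r \<pi>) (euclidean_cball E K) \<le>
    measure \<pi> {x \<in> state_space \<beta> E r. \<forall>i j. \<bar>scaled r (fst x) i j\<bar> \<le> K}"
\<comment> \<open>For a nonmeasurable set \<open>measure\<close> is 0 and the bound is
  trivial.\<close>
proof (cases "euclidean_cball E K \<in> sets (scaled_distribution \<mu> l r \<pi>)")
  case True
  let ?T = "{x \<in> state_space \<beta> E r. \<forall>i j. \<bar>scaled r (fst x) i j\<bar> \<le> K}"
  let ?f = "diffusion_scaling \<mu> l r :: ('i, 'j) state \<Rightarrow> _"
  have "?f \<in> measurable (measure_pmf \<pi>) (Pi\<^sub>M E (\<lambda>_. borel))"
    by (auto simp: measurable_def space_PiM diffusion_scaling_def E_eq)
  then have "measure (scaled_distribution \<mu> l r \<pi>) (euclidean_cball E K) = measure \<pi> (?f -` euclidean_cball E K)"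
    using True by (simp add: scaled_distribution_def E_eq measure_distr)
  also have "\<dots> = measure \<pi> (?f -` euclidean_cball E K \<inter> set_pmf \<pi>)"
    by (simp add: measure_Int_set_pmf)
  also have "\<dots> \<le> measure \<pi> ?T"
  proof (rule measure_pmf.finite_measure_mono)
    show "?f -` euclidean_cball E K \<inter> set_pmf \<pi> \<subseteq> ?T"
    proof (intro subsetI CollectI conjI allI)
      fix x i j assume x: "x \<in> ?f -` euclidean_cball E K \<inter> set_pmf \<pi>"
      then show xX: "x \<in> state_space \<beta> E r" using assms by auto
      have L2: "L2_set (?f x) E \<le> K" using x by (simp add: euclidean_cball_def)
      show "\<bar>scaled r (fst x) i j\<bar> \<le> K"
      proof (cases "(i, j) \<in> E")
        case True
        then have "\<bar>scaled r (fst x) i j\<bar> = sqrt ((?f x (i, j))\<^sup>2)"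
          by (simp add: diffusion_scaling_def scaled_def E_eq)
        also have "\<dots> \<le> L2_set (?f x) E"
          unfolding L2_set_def using True by (intro real_sqrt_le_mono member_le_sum[where f="\<lambda>e. (?f x e)\<^sup>2"]) auto
        finally show ?thesis using L2 by simp
      next
        case False
        then have "scaled r (fst x) i j = 0"
          using supported_scaled[OF xX] by (simp add: supported_def)
        \<comment> \<open>A point of the ball forces \<open>K\<close> to be nonnegative, which
          covers the zero coordinates off \<open>E\<close>.\<close>
        then show ?thesis using order_trans[OF L2_set_nonneg L2] by simp
      qed
    qed
  qed simp
  finally show ?thesis .
qed (simp add: measure_notin_sets)

end

theorem theorem6p2:
  fixes \<Lambda> :: "'i::finite \<Rightarrow> real"
    and \<beta> :: "'j::finite \<Rightarrow> real"
    and \<mu> l :: "'i \<Rightarrow> 'j \<Rightarrow> real"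
    and \<rho> :: real
    and E :: "('i \<times> 'j) set"
    and r :: "nat \<Rightarrow> real"
    and route :: "nat \<Rightarrow> ('i, 'j) state \<Rightarrow> 'i \<Rightarrow> 'j pmf"
    and sched :: "nat \<Rightarrow> ('i, 'j) state \<Rightarrow> 'i \<Rightarrow> 'j \<Rightarrow> 'i pmf"
    and P :: "nat \<Rightarrow> real \<Rightarrow> ('i, 'j) state \<Rightarrow> ('i, 'j) state pmf"
    and \<pi> :: "nat \<Rightarrow> ('i, 'j) state pmf"
  assumes "\<And>i. 0 < \<Lambda> i" and "\<And>j. 0 < \<beta> j" and "\<And>i j. 0 \<le> \<mu> i j"
    and "complete_resource_pooling \<Lambda> \<beta> \<mu> l \<rho>"
    and "E = basic_activities l"
    and "\<rho> < 1"
    and "filterlim r at_top sequentially"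
    and "\<And>n. 0 < r n" and "\<And>n j. r n * \<beta> j \<in> \<nat>"
    and "\<And>n. lqfs_lb_rule \<beta> E (r n) (route n) (sched n)"
    and "\<And>n. markov_semigroup (state_space \<beta> E (r n))
               (lqfs_lb_rates \<Lambda> \<beta> \<mu> E (r n) (route n) (sched n)) (P n)"
    and "\<And>n. stationary_distribution (state_space \<beta> E (r n)) (P n) (\<pi> n)"
    and "\<exists>c. eigenvalue (A_u \<beta> \<mu> E) c \<and> 0 < Re c"
    and "\<nexists>c. eigenvalue (A_u \<beta> \<mu> E) c \<and> Re c = 0 \<and> Im c \<noteq> 0"
  shows "\<And>K. (\<lambda>n. measure (scaled_distribution \<mu> l (r n) (\<pi> n)) (euclidean_cball E K))
                \<longlonglongrightarrow> 0"
proof -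
  fix K :: real
  have feas: "spp_feasible \<Lambda> \<beta> \<mu> l \<rho>" and tree: "activity_tree E"
    using assms(4,5) by (auto simp: complete_resource_pooling_def spp_optimal_def)
  have load: "(\<Sum>i\<in>UNIV. l i j / \<mu> i j) = \<rho> * \<beta> j" for j
  proof -
    have "(\<Sum>i\<in>UNIV. l i j / (\<beta> j * \<mu> i j)) = (\<Sum>i\<in>UNIV. l i j / \<mu> i j) / \<beta> j"
      unfolding sum_divide_distrib by (intro sum.cong) (simp_all add: mult.commute)
    then show ?thesis
      using spp_load_tight[OF assms(2,3,4), of j] assms(2)[of j] by (simp add: divide_eq_eq)
  qed
  interpret underloaded_network \<Lambda> \<beta> \<mu> l E \<rho>
    using assms(1-3,5,6) feas tree load by unfold_locales (auto simp: spp_feasible_def)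
  obtain c where c: "eigenvalue (A_u \<beta> \<mu> E) c" "0 < Re c" using assms(13) by blast
  obtain u v :: "'i \<Rightarrow> real" where uv: "\<exists>i. u i \<noteq> 0 \<or> v i \<noteq> 0"
    "\<And>y. (\<Sum>i\<in>UNIV. u i * (A_u \<beta> \<mu> E *v y) $ i) = Re c * (\<Sum>i\<in>UNIV. u i * y $ i) - Im c * (\<Sum>i\<in>UNIV. v i * y $ i)"
    "\<And>y. (\<Sum>i\<in>UNIV. v i * (A_u \<beta> \<mu> E *v y) $ i) = Re c * (\<Sum>i\<in>UNIV. v i * y $ i) + Im c * (\<Sum>i\<in>UNIV. u i * y $ i)"
    using unstable_left_eigenvector[OF c(1)] by blast
  obtain C \<epsilon>1 where C: "0 \<le> C" "0 < \<epsilon>1"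
    "\<And>\<epsilon>. 0 < \<epsilon> \<Longrightarrow> \<epsilon> \<le> \<epsilon>1 \<Longrightarrow> \<exists>r0>0. \<forall>r\<ge>r0. \<forall>route sched P \<pi>. lqfs_lb_rule \<beta> E r route sched \<longrightarrow>
      markov_semigroup (state_space \<beta> E r) (lqfs_lb_rates \<Lambda> \<beta> \<mu> E r route sched) P \<longrightarrow>
      stationary_distribution (state_space \<beta> E r) P \<pi> \<longrightarrow>
      measure \<pi> {x \<in> state_space \<beta> E r. \<forall>i j. \<bar>scaled r (fst x) i j\<bar> \<le> K} \<le> C * \<epsilon>"
    by (rule ball_mass_bound[OF c(2) uv, of K]) blast
  let ?m = "\<lambda>n. measure (scaled_distribution \<mu> l (r n) (\<pi> n)) (euclidean_cball E K)"
  show "?m \<longlonglongrightarrow> 0"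
  proof (rule tendstoI)
    fix e :: real assume e: "0 < e"
    \<comment> \<open>Dividing by \<open>C + 1\<close> rather than \<open>C\<close> covers the case
      \<open>C = 0\<close>.\<close>
    define \<epsilon> where "\<epsilon> = min \<epsilon>1 (e / (2 * (C + 1)))"
    have \<epsilon>: "0 < \<epsilon>" "\<epsilon> \<le> \<epsilon>1" using e C by (auto simp: \<epsilon>_def)
    have "C * \<epsilon> \<le> (C + 1) * (e / (2 * (C + 1)))"
      using C(1) e \<epsilon>(1) by (intro mult_mono) (auto simp: \<epsilon>_def)
    also have "\<dots> < e"
    proof -
      define d where "d = C + 1"
      have "0 < d" using C(1) by (simp add: d_def)
      then show ?thesis using e unfolding d_def[symmetric] by simp
    qed
    finally have Ce: "C * \<epsilon> < e" .
    obtain r0 where r0: "\<And>n. r0 \<le> r n \<Longrightarrow>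
        measure (\<pi> n) {x \<in> state_space \<beta> E (r n). \<forall>i j. \<bar>scaled (r n) (fst x) i j\<bar> \<le> K} \<le> C * \<epsilon>"
      using C(3)[OF \<epsilon>] assms(10-12) by blast
    have "dist (?m n) 0 < e" if "r0 \<le> r n" for n
    proof -
      have "set_pmf (\<pi> n) \<subseteq> state_space \<beta> E (r n)"
        using assms(12) by (simp add: stationary_distribution_def)
      from scaled_distribution_cball_le[OF this, of K] show ?thesis
        using r0[OF that] Ce by simp
    qed
    moreover have "\<forall>\<^sub>F n in sequentially. r0 \<le> r n"
      using assms(7) by (simp add: filterlim_at_top)
    ultimately show "\<forall>\<^sub>F n in sequentially. dist (?m n) 0 < e"
      by (auto elim: eventually_mono)
  qed
qed

end
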